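(* There exist absolute constants $C_1, C_2 > 0$ such that for all integers $r \geq 3$ and $t \geq r-2$, $$ C_1\left(\frac{4^{t-r}}{\sqrt{t-r+3}} + r^2\right) \leq c(r,t) \leq C_2\left(\frac{4^{t-r} \min(r,\sqrt{t-r+3})}{\sqrt{t-r+3}} + r^2\right). $$
   Context: All graphs are finite and simple. For a graph $H$, a graph $G$ is $H$-saturated if $G$ contains no copy of $H$ but adding any new edge to $G$ creates a copy of $H$. For integers $r \geq 3$ and $t \geq r-2$, let $sat(n,K_r,t)$ be the minimum number of edges in a $K_r$-saturated graph on $n$ vertices with minimum degree at least $t$. It is known (Day) that for fixed $r,t$ the quantity $t|G|-e(G)$ is bounded over all $K_r$-saturated graphs $G$ with minimum degree $\delta(G)\ge t$, and $c(r,t)$ is defined as $$c(r,t)=\max\{\, t|G|-e(G) : G \text{ is } K_r\text{-saturated},\ \delta(G)=t \,\};$$ equivalently $c(r,t)$ is the constant with $sat(n,K_r,t)=tn-c(r,t)$ for all sufficiently large $n$. Here $|G|$ is the number of vertices and $e(G)$ the number of edges. *)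

theory Defs
  imports Complex_Main "HOL-Library.Ramsey"
begin

text \<open>
  A graph is a pair of a finite vertex set and a set of two-element subsets of it;
  \<open>[V]\<^bsup>2\<^esup>\<close> is the library's notation for the set of two-element subsets of \<open>V\<close>.
\<close>

type_synonym 'a graph = "'a set \<times> 'a set set"

definition simple_graph :: "'a graph \<Rightarrow> bool" where
  "simple_graph G \<longleftrightarrow> finite (fst G) \<and> snd G \<subseteq> [fst G]\<^bsup>2\<^esup>"

definition degree :: "'a graph \<Rightarrow> 'a \<Rightarrow> nat" where
  "degree G v = card {e \<in> snd G. v \<in> e}"

text \<open>Only meaningful for a nonempty vertex set, since \<open>Min\<close> of the empty set is unspecified.\<close>

definition min_degree :: "'a graph \<Rightarrow> nat" where
  "min_degree G = Min (degree G ` fst G)"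

definition complete_graph :: "nat \<Rightarrow> nat graph" where
  "complete_graph r = ({..<r}, [{..<r}]\<^bsup>2\<^esup>)"

text \<open>A copy of \<open>H\<close> in \<open>G\<close> is a not necessarily induced subgraph of \<open>G\<close> isomorphic to \<open>H\<close>.\<close>

definition contains_copy :: "'a graph \<Rightarrow> 'b graph \<Rightarrow> bool" where
  "contains_copy G H \<longleftrightarrow>
     (\<exists>f. inj_on f (fst H) \<and> f ` fst H \<subseteq> fst G \<and> (\<forall>e \<in> snd H. f ` e \<in> snd G))"

definition saturated :: "'b graph \<Rightarrow> 'a graph \<Rightarrow> bool" where
  "saturated H G \<longleftrightarrow> \<not> contains_copy G H \<and>
     (\<forall>e \<in> [fst G]\<^bsup>2\<^esup> - snd G. contains_copy (fst G, insert e (snd G)) H)"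

text \<open>
  The set over which the maximum is taken. Every finite graph is isomorphic to one whose
  vertices are natural numbers, so these suffice. The values may be negative, hence integers.
\<close>

definition deficits :: "nat \<Rightarrow> nat \<Rightarrow> int set" where
  "deficits r t = {int t * int (card (fst G)) - int (card (snd G)) | G :: nat graph.
     simple_graph G \<and> fst G \<noteq> {} \<and> saturated (complete_graph r) G \<and> min_degree G = t}"

text \<open>
  \<open>Max\<close> is only specified on finite sets, and \<open>deficits r t\<close> need not be bounded below,
  so the maximum is expressed by \<open>GREATEST\<close>.
\<close>

definition sat_const :: "nat \<Rightarrow> nat \<Rightarrow> int" where
  "sat_const r t = (GREATEST k. k \<in> deficits r t)"

end

theory Submission
  imports Defs "HOL-Combinatorics.Multiset_Permutations"
begin

text \<open>
  Put \<open>k = r - 3\<close> and \<open>s = t - k\<close>. For the lower bound, the points of a \<open>2(s - 1)\<close>-set and its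
  \<open>(s - 1)\<close>-subsets, each subset joined to its elements and to its complement, form a triangle-saturated
  graph of deficiency about \<open>(2(s - 1) choose (s - 1)) / 2\<close>; adding \<open>k\<close> universal vertices adds a
  quadratic term in \<open>k\<close>.

  For the upper bound, let \<open>T\<close> be a maximal independent set of vertices of degree \<open>t\<close>, let \<open>X\<close> be the
  neighbourhood of some \<open>v0 \<in> T\<close>, and distribute the edges over the vertices so that \<open>T\<close> receives \<open>t\<close> per
  vertex. The remaining vertices are removed in an order of maximum remaining degree, which groups
  them into dyadic levels. A vertex at level \<open>q\<close> receives less than \<open>t\<close> only if it and some neighbour have
  few neighbours in the set of \<open>X\<close> and the earlier levels. After passing to a subfamily without conflicts,
  these neighbourhoods satisfy the hypotheses of a two families theorem: the clique number of
  \<open>A i \<inter> B j\<close> is at most \<open>k\<close> exactly when \<open>i = j\<close>. That theorem is proved by Bollobas's method, with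
  Hajnal's theorem on maximum cliques controlling a random cut of \<open>A i \<inter> B i\<close>: a random subset gives the
  bound \<open>O(4^s)\<close>, a random permutation \<open>O(r (2s choose s))\<close>. The bounds lose factors polynomial in the level
  and decay geometrically in the degree defect, so the sum over all levels converges.
\<close>

section \<open>A two families theorem for clique numbers\<close>

text \<open>Extracting a conflict-free subfamily costs a factor polynomial in degrees among the
  remaining vertices, and these degrees have no a priori bound. Inside \<open>Z q\<close> they are
  at most \<open>F q\<close>, and the geometric decay in the shortfall beats the loss once the
  shortfall reaches \<open>L q\<close>, which is only of order \<open>log (F q)\<close>. Smaller
  shortfalls are paid differently: a vertex of class \<open>q > 0\<close> has more than
  \<open>F (q - 1)\<close> later neighbours, so a tiny share \<open>eps q\<close> from each
  suffices. The target for a remaining vertex is \<open>t + 1\<close>, not \<open>t\<close>; the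
  spare unit covers the shares diverted from it at higher levels. The offset 30 in \<open>F\<close>
  keeps the small diversions below 1 in total, and the factor 10 in \<open>L\<close> comes from
  \<open>4 * (3/4)^10 < 1/2\<close>. \<open>X\<close> is the neighbourhood of a single vertex so
  that saturation against \<open>v0\<close> puts a \<open>(k + 1)\<close>-clique into
  \<open>nb y \<inter> X\<close> for every remaining \<open>y\<close>. The \<open>t\<close> vertices
  of \<open>X\<close> receive nothing; this costs \<open>t^2\<close>, which the two terms of the
  upper bound absorb.\<close>

definition clique_num :: "'a set set \<Rightarrow> 'a set \<Rightarrow> nat" where
  "clique_num E S = Max (card ` {K. K \<subseteq> S \<and> clique K E})"

lemma card_Int_plus_Diff: "finite S \<Longrightarrow> card (S \<inter> T) + card (S - T) = card S"
  by (metis Int_lower1 card_Diff_subset_Int card_mono finite_Int le_add_diff_inverse)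

lemma clique_num_ge:
  assumes "finite S" "K \<subseteq> S" "clique K E"
  shows "card K \<le> clique_num E S"
  unfolding clique_num_def using assms by (intro Max_ge) auto

lemma clique_num_attained:
  assumes "finite S"
  obtains K where "K \<subseteq> S" "clique K E" "card K = clique_num E S"
proof -
  have "clique_num E S \<in> card ` {K. K \<subseteq> S \<and> clique K E}"
    unfolding clique_num_def using assms by (intro Max_in) (auto intro!: exI[of _ "{}"])
  thus thesis using that by auto
qed

lemma clique_num_le_card: "finite S \<Longrightarrow> clique_num E S \<le> card S"
  by (metis clique_num_attained card_mono)

lemma clique_num_mono: "finite T \<Longrightarrow> S \<subseteq> T \<Longrightarrow> clique_num E S \<le> clique_num E T"
  by (metis clique_num_attained clique_num_ge finite_subset order_trans)

lemma clique_num_Un: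
  assumes "finite S" "finite T"
  shows "clique_num E (S \<union> T) \<le> clique_num E S + clique_num E T"
proof -
  obtain K where K: "K \<subseteq> S \<union> T" "clique K E" "card K = clique_num E (S \<union> T)"
    using clique_num_attained[of "S \<union> T"] assms by blast
  have "card K \<le> card (K \<inter> S) + card (K \<inter> T)"
    using K(1) card_Un_le[of "K \<inter> S" "K \<inter> T"] by (simp add: Int_Un_distrib[symmetric] Int_absorb2)
  also have "card (K \<inter> S) \<le> clique_num E S"
    using assms K by (intro clique_num_ge) (auto intro: smaller_clique)
  also have "card (K \<inter> T) \<le> clique_num E T"
    using assms K by (intro clique_num_ge) (auto intro: smaller_clique)
  finally show ?thesis using K(3) by simp
qed

text \<open>Hajnal's theorem on maximum cliques: exchanging the new clique outside the old union for the
  part of the old intersection it misses never enlarges a maximum clique.\<close>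

lemma maximum_cliques_union_inter:
  assumes "finite W" "finite F" "F \<noteq> {}"
    and "\<And>K. K \<in> F \<Longrightarrow> K \<subseteq> W \<and> clique K E \<and> card K = clique_num E W"
  shows "2 * clique_num E W \<le> card (\<Union>F) + card (\<Inter>F)"
  using assms(2,3,4)
proof (induction F rule: finite_ne_induct)
  case (singleton K)
  thus ?case by (auto simp: mult_2)
next
  case (insert K F)
  let ?U = "\<Union>F" and ?I = "\<Inter>F"
  have K: "K \<subseteq> W" "clique K E" "card K = clique_num E W" using insert.prems by auto
  have IH: "2 * clique_num E W \<le> card ?U + card ?I" using insert by auto
  have IU: "?I \<subseteq> ?U" using insert.hyps(2) by auto
  have UW: "?U \<subseteq> W" using insert.prems by auto
  have fU: "finite ?U" and fK: "finite K" and fI: "finite ?I"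
    using UW K(1) IU assms(1) finite_subset by metis+
  have cl: "clique ((K \<inter> ?U) \<union> ?I) E"
    unfolding clique_def
  proof (intro ballI impI)
    fix u v assume u: "u \<in> (K \<inter> ?U) \<union> ?I" and v: "v \<in> (K \<inter> ?U) \<union> ?I" and ne: "u \<noteq> v"
    show "{u, v} \<in> E"
    proof (cases "u \<in> K \<and> v \<in> K")
      case True
      thus ?thesis using K(2) ne by (auto simp: clique_def)
    next
      case False
      have "u \<in> ?U" "v \<in> ?U" using u v IU by auto
      then obtain L where "L \<in> F" "u \<in> L" "v \<in> L" using u v False by blast
      thus ?thesis using insert.prems ne by (auto simp: clique_def)
    qed
  qed
  have "card ((K \<inter> ?U) \<union> ?I) \<le> card K"
    using K UW IU assms(1) cl by (metis Int_lower1 Un_least clique_num_ge order_trans)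
  moreover have "(K \<inter> ?U) \<union> ?I = (K \<inter> ?U) \<union> (?I - K)" using IU by auto
  moreover have "card ((K \<inter> ?U) \<union> (?I - K)) = card (K \<inter> ?U) + card (?I - K)"
    using fK fI by (intro card_Un_disjoint) auto
  moreover have "card K = card (K \<inter> ?U) + card (K - ?U)"
    using card_Int_plus_Diff[OF fK, of ?U] by simp
  ultimately have le: "card (?I - K) \<le> card (K - ?U)" by simp
  have "card (\<Union>(insert K F)) = card ?U + card (K - ?U)"
    using fU fK card_Un_disjoint[of ?U "K - ?U"] by (simp add: Un_commute)
  moreover have "card ?I = card (\<Inter>(insert K F)) + card (?I - K)"
    using card_Int_plus_Diff[OF fI, of K] by (simp add: Int_commute)
  ultimately show ?case using IH le by linarith
qed

text \<open>In a minimal \<open>W\<close> whose size exceeds its clique number by at least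
  \<open>j\<close>, deleting a vertex cannot lower the clique number, so no vertex lies in all
  maximum cliques. Hajnal's theorem then gives \<open>2 * clique_num E W \<le> card W\<close>, while
  minimality gives \<open>card W \<le> clique_num E W + j\<close>. A cut thus has to control only
  \<open>2 * j\<close> vertices of \<open>A \<inter> B\<close>.\<close>

lemma clique_critical_subset:
  assumes "finite Z" "clique_num E Z + j \<le> card Z"
  obtains W where "W \<subseteq> Z" "card W \<le> 2 * j" "clique_num E W + j \<le> card W"
proof -
  define P where "P = (\<lambda>W. W \<subseteq> Z \<and> clique_num E W + j \<le> card W)"
  have "P Z" using assms by (simp add: P_def)
  then obtain W where W: "P W" and min: "\<And>W'. P W' \<Longrightarrow> card W \<le> card W'"
    by (metis ex_has_least_nat)
  have fW: "finite W" using W assms(1) finite_subset by (auto simp: P_def)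
  have "card W \<le> 2 * j"
  proof (cases "W = {}")
    case False
    define F where "F = {K. K \<subseteq> W \<and> clique K E \<and> card K = clique_num E W}"
    have fF: "finite F" using fW by (auto simp: F_def)
    have ex: "\<exists>K\<in>F. w \<notin> K" if w: "w \<in> W" for w
    proof -
      have "\<not> P (W - {w})" using min[of "W - {w}"] w fW by (metis card_Diff1_less not_le)
      hence "card W - 1 < clique_num E (W - {w}) + j"
        using W w fW by (auto simp: P_def)
      moreover have "clique_num E (W - {w}) \<le> clique_num E W"
        using fW by (intro clique_num_mono) auto
      moreover have "clique_num E W + j \<le> card W" using W by (simp add: P_def)
      ultimately have "clique_num E (W - {w}) = clique_num E W" by linarith
      moreover obtain K where "K \<subseteq> W - {w}" "clique K E" "card K = clique_num E (W - {w})"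
        using clique_num_attained[of "W - {w}"] fW by blast
      ultimately have "K \<in> F" "w \<notin> K" by (auto simp: F_def)
      thus ?thesis by blast
    qed
    hence "F \<noteq> {}" using False by blast
    hence "2 * clique_num E W \<le> card (\<Union>F) + card (\<Inter>F)"
      using fW fF by (intro maximum_cliques_union_inter) (auto simp: F_def)
    moreover have "\<Inter>F = {}" using ex \<open>F \<noteq> {}\<close> by (auto simp: F_def)
    moreover have "card (\<Union>F) \<le> card W" using fW by (intro card_mono) (auto simp: F_def)
    moreover have "card W \<le> clique_num E W + j"
    proof -
      obtain w where w: "w \<in> W" using False by blast
      have "\<not> P (W - {w})" using min[of "W - {w}"] w fW by (metis card_Diff1_less not_le)
      hence "card W - 1 < clique_num E (W - {w}) + j"
        using W w fW by (auto simp: P_def)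
      moreover have "clique_num E (W - {w}) \<le> clique_num E W"
        using fW by (intro clique_num_mono) auto
      ultimately show ?thesis by linarith
    qed
    ultimately show ?thesis by simp
  qed simp
  thus thesis using that W by (auto simp: P_def)
qed

section \<open>Random cuts and their symmetries\<close>

text \<open>The involution glued from a bijection and its inverse. Such swaps act on the cuts and
  replace probability computations.\<close>

lemma swap_permutation:
  assumes "finite S" "finite T" "S \<inter> T = {}" "card S = card T" "S \<subseteq> U" "T \<subseteq> U"
  obtains \<tau> where "\<tau> permutes U" "\<tau> ` S = T" "\<tau> ` T = S" "\<And>x. x \<notin> S \<Longrightarrow> x \<notin> T \<Longrightarrow> \<tau> x = x"
proof -
  obtain b where b: "bij_betw b S T" using finite_same_card_bij[OF assms(1,2,4)] by blast
  define c where "c = inv_into S b"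
  have c: "bij_betw c T S" unfolding c_def using b by (rule bij_betw_inv_into)
  have cb: "c (b x) = x" if "x \<in> S" for x using b that by (simp add: c_def bij_betw_inv_into_left)
  have bc: "b (c x) = x" if "x \<in> T" for x using b that by (simp add: c_def bij_betw_inv_into_right)
  define \<tau> where "\<tau> = (\<lambda>x. if x \<in> S then b x else if x \<in> T then c x else x)"
  have bS: "b x \<in> T" if "x \<in> S" for x using b that by (auto simp: bij_betw_def)
  have cT: "c x \<in> S" if "x \<in> T" for x using c that by (auto simp: bij_betw_def)
  have inv: "\<tau> (\<tau> x) = x" for x
    using assms(3) by (auto simp: \<tau>_def cb bc dest: bS cT)
  have img1: "\<tau> ` S = T" using b by (auto simp: \<tau>_def bij_betw_def)
  have "\<tau> ` (\<tau> ` S) = S" by (simp add: image_image inv)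
  hence img2: "\<tau> ` T = S" by (simp add: img1)
  have "\<tau> x = x" if "x \<notin> U" for x using assms(5,6) that by (auto simp: \<tau>_def)
  moreover have "\<exists>!x. \<tau> x = y" for y by (metis inv)
  ultimately have "\<tau> permutes U" by (simp add: permutes_def)
  thus thesis using that img1 img2 by (auto simp: \<tau>_def)
qed

text \<open>The next lemma covers both a uniformly random subset (one cut) and the chain of prefixes of a
  uniformly random permutation (many cuts).\<close>

lemma separating_cuts_count:
  fixes \<Omega> :: "'w set" and cuts :: "'w \<Rightarrow> 'a set set"
  assumes fin: "finite \<Omega>" "finite U"
    and act: "\<And>\<tau>. \<tau> permutes U \<Longrightarrow>
      \<exists>\<phi>. inj_on \<phi> \<Omega> \<and> (\<forall>\<omega>\<in>\<Omega>. \<phi> \<omega> \<in> \<Omega> \<and> cuts (\<phi> \<omega>) = image \<tau> ` cuts \<omega>)"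
    and sep: "\<And>P Q. P \<subseteq> U \<Longrightarrow> Q \<subseteq> U \<Longrightarrow> P \<inter> Q = {} \<Longrightarrow> card P + card Q \<le> N \<Longrightarrow>
      card \<Omega> \<le> D * card {\<omega>\<in>\<Omega>. \<exists>C\<in>cuts \<omega>. P \<subseteq> C \<and> Q \<inter> C = {}}"
    and AB: "A \<subseteq> U" "B \<subseteq> U" "k \<le> card A" "k \<le> card B" "card A + card B \<le> N + 2 * k"
      "clique_num E (A \<inter> B) \<le> k"
  shows "card \<Omega> \<le> 2 * D * card {\<omega>\<in>\<Omega>. \<exists>C\<in>cuts \<omega>. clique_num E (A - C) + clique_num E (B \<inter> C) \<le> k}"
    (is "_ \<le> 2 * D * card ?G")
proof -
  have fA: "finite A" and fB: "finite B" using AB fin finite_subset by auto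
  let ?Z = "A \<inter> B"
  have cA: "card A = card ?Z + card (A - B)"
    using card_Int_plus_Diff[OF fA, of B] by simp
  have cB: "card B = card ?Z + card (B - A)"
    using card_Int_plus_Diff[OF fB, of A] by (simp add: Int_commute)
  have fG: "finite ?G" using fin by simp
  show ?thesis
  proof (cases "card ?Z \<le> k")
    case True
    \<comment> \<open>Forcing all of \<open>A - B\<close> into the cut and all of
      \<open>B - A\<close> out of it could constrain more than \<open>N\<close> points when
      \<open>A \<inter> B\<close> is small. Leaving \<open>m\<close> points free on each side
      reduces the constrained points to \<open>card A + card B - 2 * k\<close>.\<close>
    define m where "m = k - card ?Z"
    have "m \<le> card (A - B)" "m \<le> card (B - A)" using cA cB AB True by (auto simp: m_def)
    then obtain A' B' where A': "A' \<subseteq> A - B" "card A' = m" "finite A'"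
      and B': "B' \<subseteq> B - A" "card B' = m" "finite B'"
      using obtain_subset_with_card_n by metis
    define P where "P = A - B - A'"
    define Q where "Q = B - A - B'"
    have cP: "card P = card (A - B) - m" "card Q = card (B - A) - m"
      using A' B' by (auto simp: P_def Q_def card_Diff_subset)
    define S where "S = {\<omega>\<in>\<Omega>. \<exists>C\<in>cuts \<omega>. P \<subseteq> C \<and> Q \<inter> C = {}}"
    define T where "T = {\<omega>\<in>\<Omega>. \<exists>C\<in>cuts \<omega>. P \<subseteq> C \<and> Q \<inter> C = {} \<and> card (A' - C) + card (B' \<inter> C) \<le> m}"
    have "card \<Omega> \<le> D * card S"
      unfolding S_def
    proof (rule sep)
      show "card P + card Q \<le> N" using cP cA cB AB True by (simp add: m_def)
    qed (use AB in \<open>auto simp: P_def Q_def\<close>)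
    moreover have "card S \<le> 2 * card T"
    proof -
      have h: "A' \<inter> B' = {}" "card A' = card B'" "A' \<subseteq> U" "B' \<subseteq> U" using A' B' AB by auto
      obtain \<tau> where \<tau>: "\<tau> permutes U" "\<tau> ` A' = B'" "\<tau> ` B' = A'"
        "\<And>x. x \<notin> A' \<Longrightarrow> x \<notin> B' \<Longrightarrow> \<tau> x = x"
        using swap_permutation[OF A'(3) B'(3) h] by blast
      have inj: "inj \<tau>" using \<tau>(1) by (simp add: permutes_inj)
      obtain \<phi> where "inj_on \<phi> \<Omega> \<and> (\<forall>\<omega>\<in>\<Omega>. \<phi> \<omega> \<in> \<Omega> \<and> cuts (\<phi> \<omega>) = image \<tau> ` cuts \<omega>)"
        using act[OF \<tau>(1)] by (elim exE)
      hence \<phi>: "inj_on \<phi> \<Omega>" "\<And>\<omega>. \<omega> \<in> \<Omega> \<Longrightarrow> \<phi> \<omega> \<in> \<Omega> \<and> cuts (\<phi> \<omega>) = image \<tau> ` cuts \<omega>"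
        by simp_all
      have "\<tau> x = id x" if "x \<in> P \<union> Q" for x
        using \<tau>(4)[of x] A'(1) B'(1) that by (auto simp: P_def Q_def)
      hence tP: "\<tau> ` P = P" and tQ: "\<tau> ` Q = Q"
        using image_cong[of P P \<tau> id] image_cong[of Q Q \<tau> id] by simp_all
      \<comment> \<open>Swapping \<open>A'\<close> and \<open>B'\<close> replaces
        \<open>card (A' - C) + card (B' \<inter> C)\<close> by its complement to
        \<open>2 * m\<close>, so the sum is at most \<open>m\<close> for the cut or for its image.
        This costs the factor 2 of the statement.\<close>
      have "\<omega> \<in> T \<or> \<phi> \<omega> \<in> T" if \<omega>: "\<omega> \<in> S" for \<omega>
      proof -
        obtain C where C: "\<omega> \<in> \<Omega>" "C \<in> cuts \<omega>" "P \<subseteq> C" "Q \<inter> C = {}" using \<omega> by (auto simp: S_def)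
        have "\<tau> ` C \<in> cuts (\<phi> \<omega>)" using \<phi>(2)[OF C(1)] C(2) by auto
        moreover have "P \<subseteq> \<tau> ` C" using C(3) tP by blast
        moreover have "Q \<inter> \<tau> ` C = {}"
          using image_Int[OF inj, of Q C] C(4) tQ by simp
        moreover have "card (A' - \<tau> ` C) = card (B' - C)"
          using image_set_diff[OF inj, of B' C] \<tau>(3) card_image[OF inj_on_subset[OF inj subset_UNIV], of "B' - C"]
          by simp
        moreover have "card (B' \<inter> \<tau> ` C) = card (A' \<inter> C)"
          using image_Int[OF inj, of A' C] \<tau>(2) card_image[OF inj_on_subset[OF inj subset_UNIV], of "A' \<inter> C"]
          by simp
        moreover have "card (A' \<inter> C) + card (A' - C) = m" "card (B' \<inter> C) + card (B' - C) = m"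
          using card_Int_plus_Diff[of A' C] card_Int_plus_Diff[of B' C] A' B' by simp_all
        ultimately show ?thesis using C \<phi>(2)[OF C(1)] unfolding T_def
          by (cases "card (A' - C) + card (B' \<inter> C) \<le> m") auto
      qed
      hence "S \<subseteq> T \<union> (S \<inter> \<phi> -` T)" by auto
      hence "card S \<le> card T + card (S \<inter> \<phi> -` T)"
        using fin by (intro order_trans[OF card_mono card_Un_le]) (auto simp: S_def T_def)
      moreover have "card (S \<inter> \<phi> -` T) \<le> card T"
        using \<phi>(1) fin by (intro card_inj_on_le[of \<phi>]) (auto simp: S_def T_def intro: inj_on_subset)
      ultimately show ?thesis by simp
    qed
    moreover have "card T \<le> card ?G"
    proof (rule card_mono[OF fG], unfold T_def, safe, goal_cases)
      case (1 \<omega> C)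
      have "clique_num E (A - C) \<le> card (A - C)" "clique_num E (B \<inter> C) \<le> card (B \<inter> C)"
        using fA fB by (auto intro: clique_num_le_card)
      moreover have "A - C = (A' - C) \<union> (?Z - C)" "B \<inter> C = (B' \<inter> C) \<union> (?Z \<inter> C)"
        using 1 A'(1) B'(1) by (auto simp: P_def Q_def)
      hence "card (A - C) \<le> card (A' - C) + card (?Z - C)" "card (B \<inter> C) \<le> card (B' \<inter> C) + card (?Z \<inter> C)"
        by (metis card_Un_le)+
      moreover have "card (?Z - C) + card (?Z \<inter> C) = card ?Z"
        using card_Int_plus_Diff[of ?Z C] fA by simp
      ultimately have "clique_num E (A - C) + clique_num E (B \<inter> C) \<le> k"
        using 1 True by (simp add: m_def)
      thus ?case using 1 by blast
    qed
    ultimately have "card \<Omega> \<le> D * (2 * card ?G)"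
      by (meson le_trans mult_le_mono2)
    thus ?thesis by (simp add: mult_ac)
  next
    case False
    \<comment> \<open>Here \<open>A \<inter> B\<close> has \<open>j\<close> points too many, and
      keeping only a critical subset \<open>W\<close> out of the cut suffices: the clique number of
      \<open>A - C\<close> is at most \<open>clique_num E W\<close> plus the number of points of
      \<open>A \<inter> B\<close> outside \<open>C\<close> and \<open>W\<close>, so the total is at
      most \<open>card (A \<inter> B) - j = k\<close>.\<close>
    define j where "j = card ?Z - k"
    have "clique_num E ?Z + j \<le> card ?Z" using AB False by (simp add: j_def)
    then obtain W where W: "W \<subseteq> ?Z" "card W \<le> 2 * j" "clique_num E W + j \<le> card W"
      using clique_critical_subset[of ?Z] fA by blast
    have fW: "finite W" using W fA finite_subset by blast
    have "card \<Omega> \<le> D * card {\<omega>\<in>\<Omega>. \<exists>C\<in>cuts \<omega>. A - B \<subseteq> C \<and> ((B - A) \<union> W) \<inter> C = {}}"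
    proof (rule sep)
      have "card ((B - A) \<union> W) \<le> card (B - A) + card W" by (rule card_Un_le)
      thus "card (A - B) + card ((B - A) \<union> W) \<le> N" using W cA cB AB False by (simp add: j_def)
    qed (use AB W in auto)
    also have "\<dots> \<le> D * card ?G"
    proof (intro mult_le_mono2 card_mono[OF fG], safe, goal_cases)
      case (1 \<omega> C)
      have "A - C \<subseteq> W \<union> (?Z - C - W)" using 1 by auto
      hence "clique_num E (A - C) \<le> clique_num E (W \<union> (?Z - C - W))"
        using fA fW by (intro clique_num_mono) auto
      also have "\<dots> \<le> clique_num E W + clique_num E (?Z - C - W)"
        using fA fW by (intro clique_num_Un) auto
      also have "clique_num E (?Z - C - W) \<le> card (?Z - C - W)"
        using fA by (intro clique_num_le_card) auto
      finally have a: "clique_num E (A - C) \<le> clique_num E W + card (?Z - C - W)" by simp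
      have "B \<inter> C = ?Z \<inter> C" using 1 by auto
      hence b: "clique_num E (B \<inter> C) \<le> card (?Z \<inter> C)"
        using fA clique_num_le_card by (metis finite_Int)
      have "card ?Z = card (W \<union> ((?Z - C - W) \<union> (?Z \<inter> C)))"
        using W 1 by (intro arg_cong[of _ _ card]) auto
      also have "\<dots> = card W + (card (?Z - C - W) + card (?Z \<inter> C))"
      proof -
        have "card (W \<union> ((?Z - C - W) \<union> (?Z \<inter> C))) = card W + card ((?Z - C - W) \<union> (?Z \<inter> C))"
          using fW fA 1 by (intro card_Un_disjoint) auto
        moreover have "card ((?Z - C - W) \<union> (?Z \<inter> C)) = card (?Z - C - W) + card (?Z \<inter> C)"
          using fA by (intro card_Un_disjoint) auto
        ultimately show ?thesis by simp
      qed
      finally have "clique_num E (A - C) + clique_num E (B \<inter> C) \<le> k"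
        using a b W(3) False by (simp add: j_def)
      thus ?case using 1 by blast
    qed
    finally show ?thesis by (simp add: mult_ac)
  qed
qed

text \<open>A uniformly random subset of \<open>U\<close> contains \<open>P\<close> and avoids
  \<open>Q\<close> with probability \<open>2^-(card P + card Q)\<close>. The singleton
  \<open>{C}\<close> matches the format of \<open>separating_cuts_count\<close>.\<close>

lemma separating_subsets_count:
  assumes "finite U" "P \<subseteq> U" "Q \<subseteq> U" "P \<inter> Q = {}" "card P + card Q \<le> N"
  shows "card (Pow U) \<le> 2 ^ N * card {C\<in>Pow U. \<exists>C'\<in>{C}. P \<subseteq> C' \<and> Q \<inter> C' = {}}"
proof -
  have f: "finite P" "finite Q" using assms by (auto intro: finite_subset)
  have "card (Pow (U - (P \<union> Q))) = card ((\<union>) P ` Pow (U - (P \<union> Q)))"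
    by (rule card_image[symmetric]) (auto simp: inj_on_def)
  also have "\<dots> \<le> card {C\<in>Pow U. \<exists>C'\<in>{C}. P \<subseteq> C' \<and> Q \<inter> C' = {}}"
    using assms by (intro card_mono) auto
  finally have le: "2 ^ card (U - (P \<union> Q)) \<le> card {C\<in>Pow U. \<exists>C'\<in>{C}. P \<subseteq> C' \<and> Q \<inter> C' = {}}"
    using assms(1) by (simp add: card_Pow)
  have "card U = card (P \<union> Q) + card (U - (P \<union> Q))"
    using assms card_Int_plus_Diff[of U "P \<union> Q"] by (simp add: Int_absorb1 Int_commute)
  also have "\<dots> \<le> N + card (U - (P \<union> Q))" using assms f by (simp add: card_Un_disjoint)
  finally have "(2::nat) ^ card U \<le> 2 ^ (N + card (U - (P \<union> Q)))" by (intro power_increasing) auto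
  also have "\<dots> = 2 ^ N * 2 ^ card (U - (P \<union> Q))" by (rule power_add)
  finally show ?thesis using le assms(1) by (simp add: card_Pow) (meson le_trans mult_le_mono2)
qed

lemma central_binomial_mono:
  assumes "n \<le> N"
  shows "n choose (n div 2) \<le> N choose (N div 2)"
proof -
  have "n choose (n div 2) \<le> N choose (n div 2)" using assms by (rule binomial_right_mono)
  also have "\<dots> \<le> N choose (N div 2)" by (rule binomial_maximum)
  finally show ?thesis .
qed

text \<open>In a random order, the first \<open>card P\<close> elements of
  \<open>P \<union> Q\<close> are equally likely to be any subset of that size, and some prefix
  separates \<open>P\<close> from \<open>Q\<close> exactly when they form \<open>P\<close>. The
  events \<open>T S\<close> cover all orders, and swaps show that none is larger than
  \<open>T P\<close>.\<close>

lemma separating_prefixes_count: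
  assumes "finite U" "P \<subseteq> U" "Q \<subseteq> U" "P \<inter> Q = {}" "card P + card Q \<le> N"
  shows "card (permutations_of_set U) \<le> (N choose (N div 2)) *
    card {xs\<in>permutations_of_set U. \<exists>C\<in>range (\<lambda>h. set (take h xs)). P \<subseteq> C \<and> Q \<inter> C = {}}"
proof -
  let ?W = "P \<union> Q" and ?\<Omega> = "permutations_of_set U"
  define T where "T = (\<lambda>S. {xs\<in>?\<Omega>. \<exists>h. S \<subseteq> set (take h xs) \<and> (?W - S) \<inter> set (take h xs) = {}})"
  have f: "finite P" "finite Q" using assms by (auto intro: finite_subset)
  have "card ?\<Omega> \<le> card (\<Union>S\<in>{S. S \<subseteq> ?W \<and> card S = card P}. T S)"
  proof (rule card_mono)
    show "finite (\<Union>S\<in>{S. S \<subseteq> ?W \<and> card S = card P}. T S)"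
      using f by (auto simp: T_def)
    show "?\<Omega> \<subseteq> (\<Union>S\<in>{S. S \<subseteq> ?W \<and> card S = card P}. T S)"
    proof
      fix xs assume xs: "xs \<in> ?\<Omega>"
      \<comment> \<open>The count of elements of \<open>P \<union> Q\<close> grows by at most one
        per position, so the shortest prefix with at least \<open>card P\<close> of them has exactly
        \<open>card P\<close>.\<close>
      define c where "c = (\<lambda>h. card (set (take h xs) \<inter> ?W))"
      have "set xs = U" using xs by (simp add: permutations_of_set_def)
      hence "c (length xs) = card ?W" using assms by (simp add: c_def Int_absorb1)
      hence "card P \<le> c (length xs)" using f by (simp add: card_mono)
      moreover define h where "h = (LEAST h. card P \<le> c h)"
      ultimately have h: "card P \<le> c h" "\<And>h'. card P \<le> c h' \<Longrightarrow> h \<le> h'"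
        by (auto intro: LeastI Least_le)
      have "c h = card P"
      proof (cases h)
        case 0
        thus ?thesis using h(1) by (simp add: c_def)
      next
        case (Suc h')
        hence "c h' < card P" using h(2)[of h'] by force
        moreover have "c h \<le> Suc (c h')"
        proof (cases "h' < length xs")
          case True
          hence "set (take h xs) \<inter> ?W \<subseteq> insert (xs ! h') (set (take h' xs) \<inter> ?W)"
            using Suc by (auto simp: take_Suc_conv_app_nth)
          hence "c h \<le> card (insert (xs ! h') (set (take h' xs) \<inter> ?W))"
            unfolding c_def using f by (intro card_mono) auto
          also have "\<dots> \<le> Suc (c h')" unfolding c_def by (rule card_insert_le_m1) auto
          finally show ?thesis .
        qed (use Suc in \<open>auto simp: c_def\<close>)
        ultimately show ?thesis using h(1) by simp
      qed
      hence "xs \<in> T (set (take h xs) \<inter> ?W)" "card (set (take h xs) \<inter> ?W) = card P"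
        using xs by (auto simp: T_def c_def)
      thus "xs \<in> (\<Union>S\<in>{S. S \<subseteq> ?W \<and> card S = card P}. T S)"
        by (intro UN_I[of "set (take h xs) \<inter> ?W"]) simp_all
    qed
  qed
  also have "\<dots> \<le> (\<Sum>S\<in>{S. S \<subseteq> ?W \<and> card S = card P}. card (T S))"
    using f by (intro card_UN_le) auto
  also have "\<dots> \<le> (\<Sum>S\<in>{S. S \<subseteq> ?W \<and> card S = card P}. card (T P))"
  proof (rule sum_mono)
    fix S assume "S \<in> {S. S \<subseteq> ?W \<and> card S = card P}"
    hence S: "S \<subseteq> ?W" "card S = card P" by auto
    have fS: "finite S" using S f finite_subset by blast
    have "card (S - P) = card (P - S)"
      using card_Int_plus_Diff[of S P] card_Int_plus_Diff[of P S] fS f S(2) by (simp add: Int_commute)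
    moreover have "S - P \<subseteq> U" "P - S \<subseteq> U" "(S - P) \<inter> (P - S) = {}" using S assms by auto
    ultimately obtain \<tau> where \<tau>: "\<tau> permutes U" "\<tau> ` (S - P) = P - S" "\<tau> ` (P - S) = S - P"
      "\<And>x. x \<notin> S - P \<Longrightarrow> x \<notin> P - S \<Longrightarrow> \<tau> x = x"
      using swap_permutation[of "S - P" "P - S" U] fS f by blast
    have inj: "inj \<tau>" using \<tau>(1) by (simp add: permutes_inj)
    have id: "\<tau> ` A = A" if "A \<inter> (S - P) = {}" "A \<inter> (P - S) = {}" for A
    proof -
      have "\<tau> x = id x" if "x \<in> A" for x
        using \<tau>(4)[of x] that \<open>A \<inter> (S - P) = {}\<close> \<open>A \<inter> (P - S) = {}\<close> by auto
      thus ?thesis using image_cong[of A A \<tau> id] by simp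
    qed
    have "\<tau> ` S = \<tau> ` (S - P) \<union> \<tau> ` (S \<inter> P)" by (metis Int_Diff_Un Un_commute image_Un)
    also have "\<tau> ` (S \<inter> P) = S \<inter> P" by (rule id) auto
    finally have tS: "\<tau> ` S = P" using \<tau>(2) by auto
    have "?W - S = (P - S) \<union> (Q - S)" using S by auto
    hence "\<tau> ` (?W - S) = \<tau> ` (P - S) \<union> \<tau> ` (Q - S)" by (metis image_Un)
    also have "\<tau> ` (Q - S) = Q - S" by (rule id) (use assms in auto)
    finally have tW: "\<tau> ` (?W - S) = ?W - P" using \<tau>(3) S assms by auto
    show "card (T S) \<le> card (T P)"
    proof (rule card_inj_on_le[of "map \<tau>"])
      show "inj_on (map \<tau>) (T S)" using inj by (auto intro: inj_on_subset[OF inj_mapI])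
      show "finite (T P)" by (auto simp: T_def)
      show "map \<tau> ` T S \<subseteq> T P"
      proof
        fix ys assume "ys \<in> map \<tau> ` T S"
        then obtain xs h where xs: "ys = map \<tau> xs" "xs \<in> ?\<Omega>" "S \<subseteq> set (take h xs)"
          "(?W - S) \<inter> set (take h xs) = {}" by (auto simp: T_def)
        have "set (take h ys) = \<tau> ` set (take h xs)" using xs(1) by (simp add: take_map)
        moreover have "ys \<in> ?\<Omega>"
          using xs \<tau>(1) inj by (auto simp: permutations_of_set_def distinct_map permutes_image
              intro: inj_on_subset)
        moreover have "(?W - P) \<inter> \<tau> ` set (take h xs) = {}"
          using image_Int[OF inj, of "?W - S" "set (take h xs)"] xs(4) tW by simp
        moreover have "P \<subseteq> \<tau> ` set (take h xs)" using image_mono[OF xs(3), of \<tau>] tS by simp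
        ultimately show "ys \<in> T P" unfolding T_def by (intro CollectI conjI exI[of _ h]) simp_all
      qed
    qed
  qed
  also have "\<dots> = ((card P + card Q) choose card P) * card (T P)"
    using f assms by (simp add: n_subsets card_Un_disjoint)
  also have "\<dots> \<le> (N choose (N div 2)) * card (T P)"
    using binomial_maximum[of "card P + card Q" "card P"] central_binomial_mono[OF assms(5)]
    by (intro mult_le_mono1) linarith
  also have "T P = {xs\<in>?\<Omega>. \<exists>C\<in>range (\<lambda>h. set (take h xs)). P \<subseteq> C \<and> Q \<inter> C = {}}"
    using assms(4) by (auto simp: T_def)
  finally show ?thesis .
qed

text \<open>A version of Bollobas's two families theorem in which intersections are measured by their
  clique numbers. The last assumption bounds the number of indices which a single cut can separate.\<close>

lemma two_families_abstract:
  fixes \<Omega> :: "'w set" and cuts :: "'w \<Rightarrow> 'a set set" and A B :: "'i \<Rightarrow> 'a set"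
  assumes "finite \<Omega>" "\<Omega> \<noteq> {}" "finite U"
    and "\<And>\<tau>. \<tau> permutes U \<Longrightarrow>
      \<exists>\<phi>. inj_on \<phi> \<Omega> \<and> (\<forall>\<omega>\<in>\<Omega>. \<phi> \<omega> \<in> \<Omega> \<and> cuts (\<phi> \<omega>) = image \<tau> ` cuts \<omega>)"
    and "\<And>P Q. P \<subseteq> U \<Longrightarrow> Q \<subseteq> U \<Longrightarrow> P \<inter> Q = {} \<Longrightarrow> card P + card Q \<le> N \<Longrightarrow>
      card \<Omega> \<le> D * card {\<omega>\<in>\<Omega>. \<exists>C\<in>cuts \<omega>. P \<subseteq> C \<and> Q \<inter> C = {}}"
    and "\<And>i. i \<in> I \<Longrightarrow> A i \<subseteq> U \<and> B i \<subseteq> U \<and> k \<le> card (A i) \<and> k \<le> card (B i)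
      \<and> card (A i) + card (B i) \<le> N + 2 * k \<and> clique_num E (A i \<inter> B i) \<le> k"
    and m: "(\<Sum>i\<in>I. card {\<omega>\<in>\<Omega>. \<exists>C\<in>cuts \<omega>. clique_num E (A i - C) + clique_num E (B i \<inter> C) \<le> k})
      \<le> m * card \<Omega>"
  shows "card I \<le> 2 * D * m"
proof -
  have "card I * card \<Omega> = (\<Sum>i\<in>I. card \<Omega>)" by simp
  also have "\<dots> \<le> (\<Sum>i\<in>I. 2 * D * card {\<omega>\<in>\<Omega>. \<exists>C\<in>cuts \<omega>. clique_num E (A i - C) + clique_num E (B i \<inter> C) \<le> k})"
  proof (rule sum_mono)
    fix i assume "i \<in> I"
    thus "card \<Omega> \<le> 2 * D * card {\<omega>\<in>\<Omega>. \<exists>C\<in>cuts \<omega>. clique_num E (A i - C) + clique_num E (B i \<inter> C) \<le> k}"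
      using assms(6) by (intro separating_cuts_count[OF assms(1,3,4,5)]) auto
  qed
  also have "\<dots> \<le> 2 * D * (m * card \<Omega>)"
    unfolding sum_distrib_left[symmetric] using m by (rule mult_le_mono2)
  finally have "card I * card \<Omega> \<le> 2 * D * m * card \<Omega>" by (simp add: mult.assoc)
  thus ?thesis using assms(1,2) by (simp add: card_gt_0_iff)
qed

text \<open>If one set \<open>C\<close> separated two indices, adding the two cross conditions would
  give more than \<open>2 * k\<close> against at most \<open>2 * k\<close>; so each subset separates
  at most one index. For the prefixes of a permutation, indices are sorted by the value
  \<open>a\<close> of \<open>clique_num E (A i - C)\<close>: for equal \<open>a\<close>, nesting of
  the two cuts contradicts a cross condition, which leaves at most \<open>k + 1\<close>
  indices.\<close>

theorem two_families:
  fixes A B :: "'i \<Rightarrow> 'a set"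
  assumes I: "finite I" "\<And>i. i \<in> I \<Longrightarrow> finite (A i) \<and> finite (B i)"
    and sizes: "\<And>i. i \<in> I \<Longrightarrow> k \<le> card (A i) \<and> k \<le> card (B i) \<and> card (A i) + card (B i) \<le> N + 2 * k"
    and diag: "\<And>i. i \<in> I \<Longrightarrow> clique_num E (A i \<inter> B i) \<le> k"
    and cross: "\<And>i j. i \<in> I \<Longrightarrow> j \<in> I \<Longrightarrow> i \<noteq> j \<Longrightarrow> k < clique_num E (A i \<inter> B j)"
  shows "card I \<le> 2 * 2 ^ N" and "card I \<le> 2 * (N choose (N div 2)) * (k + 1)"
proof -
  define U where "U = (\<Union>i\<in>I. A i \<union> B i)"
  have U: "finite U" using I by (auto simp: U_def)
  have AB: "A i \<subseteq> U \<and> B i \<subseteq> U \<and> k \<le> card (A i) \<and> k \<le> card (B i)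
      \<and> card (A i) + card (B i) \<le> N + 2 * k \<and> clique_num E (A i \<inter> B i) \<le> k" if "i \<in> I" for i
    using that sizes diag by (auto simp: U_def)
  have split: "k < clique_num E (A i - C) + clique_num E (B j \<inter> C')"
    if "i \<in> I" "j \<in> I" "i \<noteq> j" "C \<subseteq> C'" for i j C C'
  proof -
    have "clique_num E (A i \<inter> B j) \<le> clique_num E ((A i - C) \<union> (B j \<inter> C'))"
      using I that by (intro clique_num_mono) auto
    also have "\<dots> \<le> clique_num E (A i - C) + clique_num E (B j \<inter> C')"
      using I that by (intro clique_num_Un) auto
    finally show ?thesis using cross[OF that(1-3)] by simp
  qed
  show "card I \<le> 2 * 2 ^ N"
  proof -
    define G where "G = (\<lambda>i. {C\<in>Pow U. \<exists>C'\<in>{C}. clique_num E (A i - C') + clique_num E (B i \<inter> C') \<le> k})"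
    have "disjoint_family_on G I"
      unfolding disjoint_family_on_def
    proof (intro ballI impI)
      fix i j assume ij: "i \<in> I" "j \<in> I" "i \<noteq> j"
      show "G i \<inter> G j = {}"
      proof (rule ccontr)
        assume "G i \<inter> G j \<noteq> {}"
        then obtain C where "C \<in> G i" "C \<in> G j" by blast
        thus False using split[of i j C C] split[of j i C C] ij by (auto simp: G_def)
      qed
    qed
    hence "(\<Sum>i\<in>I. card (G i)) = card (\<Union>i\<in>I. G i)"
      using I U by (intro card_UN_disjoint'[symmetric]) (auto simp: G_def)
    also have "\<dots> \<le> 1 * card (Pow U)"
      using U by (simp, intro card_mono) (auto simp: G_def)
    finally have "card I \<le> 2 * 2 ^ N * 1"
    proof (intro two_families_abstract[where cuts = "\<lambda>C. {C}" and \<Omega> = "Pow U" and U = U and A = A and B = B and E = E and k = k])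
      fix \<tau> :: "'a \<Rightarrow> 'a" assume \<tau>: "\<tau> permutes U"
      show "\<exists>\<phi>. inj_on \<phi> (Pow U) \<and> (\<forall>\<omega>\<in>Pow U. \<phi> \<omega> \<in> Pow U \<and> {\<phi> \<omega>} = image \<tau> ` {\<omega>})"
        using \<tau> inj_on_image_Pow[OF permutes_inj_on[OF \<tau>], of U]
        by (intro exI[of _ "image \<tau>"]) (auto simp: permutes_in_image)
    next
      show "card (Pow U) \<le> 2 ^ N * card {\<omega> \<in> Pow U. \<exists>C\<in>{\<omega>}. P \<subseteq> C \<and> Q \<inter> C = {}}"
        if "P \<subseteq> U" "Q \<subseteq> U" "P \<inter> Q = {}" "card P + card Q \<le> N" for P Q
        using U that by (rule separating_subsets_count)
    qed (use U AB in \<open>auto simp: G_def\<close>)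
    thus ?thesis by simp
  qed
  show "card I \<le> 2 * (N choose (N div 2)) * (k + 1)"
  proof -
    let ?\<Omega> = "permutations_of_set U" and ?cuts = "\<lambda>xs :: 'a list. range (\<lambda>h. set (take h xs))"
    define G where "G = (\<lambda>i. {xs\<in>?\<Omega>. \<exists>C\<in>?cuts xs. clique_num E (A i - C) + clique_num E (B i \<inter> C) \<le> k})"
    define H where "H = (\<lambda>a i. {xs\<in>?\<Omega>. \<exists>C\<in>?cuts xs. clique_num E (A i - C) = a \<and> a + clique_num E (B i \<inter> C) \<le> k})"
    have H: "(\<Sum>i\<in>I. card (H a i)) \<le> card ?\<Omega>" for a
    proof -
      have "disjoint_family_on (H a) I"
        unfolding disjoint_family_on_def
      proof (intro ballI impI)
        fix i j assume ij: "i \<in> I" "j \<in> I" "i \<noteq> j"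
        show "H a i \<inter> H a j = {}"
        proof (rule ccontr)
          assume "H a i \<inter> H a j \<noteq> {}"
          then obtain xs g h where gh:
            "clique_num E (A i - set (take g xs)) = a" "a + clique_num E (B i \<inter> set (take g xs)) \<le> k"
            "clique_num E (A j - set (take h xs)) = a" "a + clique_num E (B j \<inter> set (take h xs)) \<le> k"
            by (auto simp: H_def)
          consider "set (take g xs) \<subseteq> set (take h xs)" | "set (take h xs) \<subseteq> set (take g xs)"
            using set_take_subset_set_take[of g h xs] set_take_subset_set_take[of h g xs] by linarith
          thus False
            using split[of i j "set (take g xs)" "set (take h xs)"]
              split[of j i "set (take h xs)" "set (take g xs)"] ij gh by cases auto
        qed
      qed
      hence "(\<Sum>i\<in>I. card (H a i)) = card (\<Union>i\<in>I. H a i)"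
        using I U by (intro card_UN_disjoint'[symmetric]) (auto simp: H_def)
      also have "\<dots> \<le> card ?\<Omega>" using U by (intro card_mono) (auto simp: H_def)
      finally show ?thesis .
    qed
    have "(\<Sum>i\<in>I. card (G i)) \<le> (\<Sum>i\<in>I. \<Sum>a\<le>k. card (H a i))"
    proof (rule sum_mono)
      fix i assume "i \<in> I"
      have "G i \<subseteq> (\<Union>a\<le>k. H a i)" by (fastforce simp: G_def H_def)
      hence "card (G i) \<le> card (\<Union>a\<le>k. H a i)" by (intro card_mono) (auto simp: H_def)
      also have "\<dots> \<le> (\<Sum>a\<le>k. card (H a i))" by (rule card_UN_le) auto
      finally show "card (G i) \<le> (\<Sum>a\<le>k. card (H a i))" .
    qed
    also have "\<dots> = (\<Sum>a\<le>k. \<Sum>i\<in>I. card (H a i))" by (rule sum.swap)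
    also have "\<dots> \<le> (\<Sum>a\<le>k. card ?\<Omega>)" by (intro sum_mono H)
    also have "\<dots> = (k + 1) * card ?\<Omega>" by simp
    finally show ?thesis
    proof (intro two_families_abstract[where cuts = ?cuts and \<Omega> = ?\<Omega> and U = U and A = A and B = B and E = E and k = k])
      fix \<tau> :: "'a \<Rightarrow> 'a" assume \<tau>: "\<tau> permutes U"
      have "inj_on (map \<tau>) ?\<Omega>" using \<tau> by (auto intro: inj_on_subset[OF inj_mapI] simp: permutes_inj)
      moreover have "map \<tau> xs \<in> ?\<Omega>" if "xs \<in> ?\<Omega>" for xs
        using that \<tau> by (auto simp: permutations_of_set_def distinct_map permutes_image
            intro: permutes_inj_on)
      moreover have "?cuts (map \<tau> xs) = image \<tau> ` ?cuts xs" for xs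
        by (auto simp: take_map image_image)
      ultimately show "\<exists>\<phi>. inj_on \<phi> ?\<Omega> \<and> (\<forall>\<omega>\<in>?\<Omega>. \<phi> \<omega> \<in> ?\<Omega> \<and> ?cuts (\<phi> \<omega>) = image \<tau> ` ?cuts \<omega>)"
        by (intro exI[of _ "map \<tau>"] conjI ballI) simp_all
    next
      show "card ?\<Omega> \<le> (N choose (N div 2)) * card {\<omega> \<in> ?\<Omega>. \<exists>C\<in>?cuts \<omega>. P \<subseteq> C \<and> Q \<inter> C = {}}"
        if "P \<subseteq> U" "Q \<subseteq> U" "P \<inter> Q = {}" "card P + card Q \<le> N" for P Q
        using U that by (rule separating_prefixes_count)
    qed (use U AB in \<open>auto simp: G_def\<close>)
  qed
qed

section \<open>Saturated graphs\<close>

text \<open>Indegrees and outdegrees have equal sums, so some \<open>x\<close> has indegree at most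
  \<open>D\<close>. Keeping \<open>x\<close> greedily and discarding its in- and out-neighbours uses
  up at most \<open>2 * D + 1\<close> elements per step. \<open>R\<close> is directed because a
  conflict of \<open>y\<close> with the partner of \<open>y'\<close> need not be mutual.\<close>

lemma independent_subset_of_outdegree:
  assumes "finite S" "\<And>x. x \<in> S \<Longrightarrow> card {y\<in>S. R x y} \<le> D"
  shows "\<exists>J\<subseteq>S. card S \<le> (2 * D + 1) * card J \<and> (\<forall>x\<in>J. \<forall>y\<in>J. x \<noteq> y \<longrightarrow> \<not> R x y)"
  using assms
proof (induction "card S" arbitrary: S rule: less_induct)
  case less
  show ?case
  proof (cases "S = {}")
    case False
    have "\<exists>x\<in>S. card {y\<in>S. R y x} \<le> D"
    proof (rule ccontr)
      assume "\<not> (\<exists>x\<in>S. card {y\<in>S. R y x} \<le> D)"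
      hence "(\<Sum>x\<in>S. D) < (\<Sum>x\<in>S. card {y\<in>S. R y x})"
        using False less.prems(1) by (intro sum_strict_mono) auto
      also have "\<dots> = (\<Sum>x\<in>S. card {y\<in>S. R x y})"
        using less.prems(1) by (intro sum_multicount_gen) auto
      also have "\<dots> \<le> (\<Sum>x\<in>S. D)" using less.prems(2) by (rule sum_mono)
      finally show False by simp
    qed
    then obtain x where x: "x \<in> S" "card {y\<in>S. R y x} \<le> D" by blast
    define C where "C = insert x ({y\<in>S. R y x} \<union> {y\<in>S. R x y})"
    have "card ({y\<in>S. R y x} \<union> {y\<in>S. R x y}) \<le> 2 * D"
      using x less.prems(2)[OF x(1)] card_Un_le[of "{y\<in>S. R y x}" "{y\<in>S. R x y}"] by linarith
    hence cC: "card C \<le> 2 * D + 1"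
      unfolding C_def using card_insert_le_m1[of "2 * D + 1"] by simp
    have CS: "C \<subseteq> S" using x by (auto simp: C_def)
    have h1: "card (S - C) < card S"
      using x less.prems(1) by (intro psubset_card_mono) (auto simp: C_def)
    have h2: "card {y\<in>S - C. R z y} \<le> D" if "z \<in> S - C" for z
      using less.prems that by (intro order_trans[OF card_mono less.prems(2)[of z]]) auto
    obtain J where J: "J \<subseteq> S - C" "card (S - C) \<le> (2 * D + 1) * card J"
      "\<forall>x\<in>J. \<forall>y\<in>J. x \<noteq> y \<longrightarrow> \<not> R x y"
      using less.hyps[OF h1 finite_Diff[OF less.prems(1)] h2] by auto
    have fJ: "finite J" using J(1) less.prems(1) finite_subset by blast
    have "x \<notin> J" using J(1) by (auto simp: C_def)
    have "card S = card C + card (S - C)"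
      using CS less.prems(1) by (metis card_Diff_subset card_mono finite_subset le_add_diff_inverse)
    also have "\<dots> \<le> (2 * D + 1) * card (insert x J)"
      using cC J(2) fJ \<open>x \<notin> J\<close> by simp
    finally have "card S \<le> (2 * D + 1) * card (insert x J)" .
    moreover have "\<not> R x y \<and> \<not> R y x" if "y \<in> J" for y using that J(1) by (auto simp: C_def)
    hence "\<forall>y\<in>insert x J. \<forall>z\<in>insert x J. y \<noteq> z \<longrightarrow> \<not> R y z" using J(3) by blast
    moreover have "insert x J \<subseteq> S" using J(1) x(1) by blast
    ultimately show ?thesis by blast
  qed auto
qed

text \<open>Rank 0 goes to a vertex of maximum degree, and the rest is ordered recursively. The sets
  in the statement consist of the neighbours still present when \<open>y\<close> is removed.\<close>

lemma max_degree_removal_order: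
  assumes "finite R"
  shows "\<exists>\<rho> :: 'a \<Rightarrow> nat. inj_on \<rho> R \<and> (\<forall>y\<in>R. \<forall>z\<in>R. \<rho> y \<le> \<rho> z \<longrightarrow>
      card {u\<in>R. adj z u \<and> \<rho> y \<le> \<rho> u} \<le> card {u\<in>R. adj y u \<and> \<rho> y \<le> \<rho> u})"
  using assms
proof (induction "card R" arbitrary: R)
  case 0
  thus ?case by auto
next
  case (Suc n)
  define d where "d = (\<lambda>z. card {u\<in>R. adj z u})"
  have "R \<noteq> {}" using Suc.hyps(2) by auto
  hence "Max (d ` R) \<in> d ` R" using Suc.prems by (intro Max_in) auto
  then obtain w where "w \<in> R" "Max (d ` R) = d w" by blast
  hence w: "w \<in> R" "\<And>z. z \<in> R \<Longrightarrow> d z \<le> d w" using Suc.prems by (metis Max_ge finite_imageI imageI)+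
  have "n = card (R - {w})" using Suc.hyps(2) Suc.prems w(1) by simp
  then obtain \<rho> :: "'a \<Rightarrow> nat" where "inj_on \<rho> (R - {w}) \<and> (\<forall>y\<in>R - {w}. \<forall>z\<in>R - {w}. \<rho> y \<le> \<rho> z \<longrightarrow>
    card {u\<in>R - {w}. adj z u \<and> \<rho> y \<le> \<rho> u} \<le> card {u\<in>R - {w}. adj y u \<and> \<rho> y \<le> \<rho> u})"
    using Suc.hyps(1)[of "R - {w}"] Suc.prems by (elim exE meta_impE) auto
  hence \<rho>: "inj_on \<rho> (R - {w})"
    "\<And>y z. y \<in> R - {w} \<Longrightarrow> z \<in> R - {w} \<Longrightarrow> \<rho> y \<le> \<rho> z \<Longrightarrow>
      card {u\<in>R - {w}. adj z u \<and> \<rho> y \<le> \<rho> u} \<le> card {u\<in>R - {w}. adj y u \<and> \<rho> y \<le> \<rho> u}"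
    by auto
  define \<sigma> where "\<sigma> = (\<lambda>u. if u = w then 0 else Suc (\<rho> u))"
  have "inj_on \<sigma> R" using \<rho>(1) by (auto simp: inj_on_def \<sigma>_def)
  moreover have "card {u\<in>R. adj z u \<and> \<sigma> y \<le> \<sigma> u} \<le> card {u\<in>R. adj y u \<and> \<sigma> y \<le> \<sigma> u}"
    if yz: "y \<in> R" "z \<in> R" "\<sigma> y \<le> \<sigma> z" for y z
  proof (cases "y = w")
    case True
    thus ?thesis using w(2)[OF yz(2)] by (simp add: \<sigma>_def d_def)
  next
    case False
    have "z \<noteq> w" using yz(3) False by (auto simp: \<sigma>_def)
    have "{u\<in>R. adj v u \<and> \<sigma> y \<le> \<sigma> u} = {u\<in>R - {w}. adj v u \<and> \<rho> y \<le> \<rho> u}" for v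
      using False by (auto simp: \<sigma>_def)
    thus ?thesis using \<rho>(2)[of y z] yz False \<open>z \<noteq> w\<close> by (simp add: \<sigma>_def)
  qed
  ultimately show ?case by blast
qed

section \<open>Growth of central binomial coefficients\<close>

text \<open>The growth factor is \<open>(2 * m + 1) / (m + 1)\<close> from \<open>N = 2 * m\<close>,
  which is at least 3/2 for \<open>m \<ge> 1\<close>, and exactly 2 from odd \<open>N\<close>. From
  \<open>N = 0\<close> it is only 1.\<close>

lemma central_binomial_step: "3 * (N choose (N div 2)) \<le> 2 * (Suc N choose (Suc N div 2))" if "N \<ge> 1" for N
proof (cases "even N")
  case True
  then obtain m where m: "N = 2 * m" by blast
  have "Suc m * (Suc (2 * m) choose Suc m) = Suc (2 * m) * (2 * m choose m)"
    using Suc_times_binomial_eq[of "2 * m" m] by (simp only: mult.commute)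
  moreover have "Suc (2 * m) choose Suc m = Suc (2 * m) choose m"
    using binomial_symmetric[of "Suc m" "Suc (2 * m)"] by simp
  ultimately have *: "Suc m * (Suc (2 * m) choose m) = Suc (2 * m) * (2 * m choose m)" by simp
  have "m \<ge> 1" using that m by simp
  have "3 * Suc m * (2 * m choose m) \<le> 2 * Suc (2 * m) * (2 * m choose m)"
    using \<open>m \<ge> 1\<close> by (intro mult_le_mono1) simp
  also have "\<dots> = Suc m * (2 * (Suc (2 * m) choose m))" using * by simp
  finally have "Suc m * (3 * (2 * m choose m)) \<le> Suc m * (2 * (Suc (2 * m) choose m))"
    by (simp only: mult.assoc mult.left_commute mult.commute)
  hence "3 * (2 * m choose m) \<le> 2 * (Suc (2 * m) choose m)" by (simp only: mult_le_cancel1)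
  thus ?thesis using m by simp
next
  case False
  then obtain m where m: "N = 2 * m + 1" by (metis oddE)
  have "Suc (2 * m + 1) choose Suc m = (2 * m + 1 choose m) + (2 * m + 1 choose Suc m)"
    by simp
  moreover have "(2 * m + 1) choose Suc m = (2 * m + 1) choose m"
    using binomial_symmetric[of "Suc m" "2 * m + 1"] by simp
  moreover have "N div 2 = m" "Suc N div 2 = Suc m" using m by simp_all
  ultimately show ?thesis using m by simp
qed

text \<open>The condition \<open>j < 2 * s\<close> keeps the upper index of the coefficient
  positive, where the factor 2/3 per unit is available.\<close>

lemma central_binomial_decay:
  assumes "j < 2 * s"
  shows "real ((2 * s - j) choose ((2 * s - j) div 2)) \<le> (2/3) ^ j * real ((2 * s) choose s)"
  using assms
proof (induction j)
  case (Suc j)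
  define N where "N = 2 * s - Suc j"
  have N: "N \<ge> 1" "2 * s - j = Suc N" using Suc.prems by (auto simp: N_def)
  have "3 * real (N choose (N div 2)) \<le> 2 * real (Suc N choose (Suc N div 2))"
    using central_binomial_step[OF N(1)] by (metis (mono_tags) of_nat_le_iff of_nat_mult of_nat_numeral)
  also have "\<dots> \<le> 2 * ((2/3) ^ j * real ((2 * s) choose s))"
    using Suc N by simp
  finally show ?case by (simp add: N_def)
qed simp

text \<open>Grouping ordered pairs by their underlying edge leaves the two orientations, whose
  weights total at most 1. This turns a rule for distributing edges into a lower bound on their
  number.\<close>

lemma sum_edges_le_card:
  fixes a :: "'a \<Rightarrow> 'a \<Rightarrow> real"
  assumes V: "finite V" "E \<subseteq> [V]\<^bsup>2\<^esup>"
    and a: "\<And>u v. {u, v} \<in> E \<Longrightarrow> a u v + a v u \<le> 1"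
  shows "(\<Sum>u\<in>V. \<Sum>v\<in>{v. {u, v} \<in> E}. a u v) \<le> card E"
proof -
  have E: "u \<in> V \<and> v \<in> V \<and> u \<noteq> v" if "{u, v} \<in> E" for u v
    using that V(2) doubleton_in_nsets_2[of u v V] by blast
  have fE: "finite E" using V by (meson finite_imp_finite_nsets finite_subset)
  define S where "S = Sigma V (\<lambda>u. {v. {u, v} \<in> E})"
  have fin: "finite {v. {u, v} \<in> E}" for u
    using V(1) by (rule finite_subset[rotated]) (auto dest: E)
  have fS: "finite S" using V fin by (auto simp: S_def)
  have "(\<Sum>u\<in>V. \<Sum>v\<in>{v. {u, v} \<in> E}. a u v) = (\<Sum>(u, v)\<in>S. a u v)"
    unfolding S_def using V fin by (intro sum.Sigma) auto
  also have "\<dots> = (\<Sum>e\<in>E. \<Sum>x\<in>{x\<in>S. (\<lambda>(u, v). {u, v}) x = e}. (\<lambda>(u, v). a u v) x)"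
    using fS fE by (intro sum.group[symmetric]) (auto simp: S_def)
  also have "\<dots> \<le> (\<Sum>e\<in>E. 1)"
  proof (rule sum_mono)
    fix e assume e: "e \<in> E"
    then obtain u v where uv: "e = {u, v}" "u \<noteq> v"
      using V(2) nsets2_E[of e V] by blast
    have "{x\<in>S. (\<lambda>(u, v). {u, v}) x = e} = {(u, v), (v, u)}"
      using e uv E by (auto simp: S_def doubleton_eq_iff insert_commute)
    thus "(\<Sum>x\<in>{x\<in>S. (\<lambda>(u, v). {u, v}) x = e}. (\<lambda>(u, v). a u v) x) \<le> 1"
      using a[of u v] e uv by simp
  qed
  finally show ?thesis by simp
qed

section \<open>Saturation in terms of common cliques\<close>

text \<open>For \<open>k = r - 3\<close> this is \<open>K_r\<close>-saturation with minimum degree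
  at least \<open>t\<close>: a missing edge completes a clique on \<open>k + 3\<close> vertices,
  whose other \<open>k + 1\<close> vertices are common neighbours of its ends. A vertex of degree
  exactly \<open>t\<close> is supplied separately.\<close>

locale clique_saturated =
  fixes V :: "'a set" and E :: "'a set set" and k t :: nat
  assumes finite_V: "finite V" and E_subset: "E \<subseteq> [V]\<^bsup>2\<^esup>"
    and clique_le: "\<And>K. K \<subseteq> V \<Longrightarrow> clique K E \<Longrightarrow> card K \<le> k + 2"
    and common_clique: "\<And>u v. u \<in> V \<Longrightarrow> v \<in> V \<Longrightarrow> u \<noteq> v \<Longrightarrow> {u, v} \<notin> E \<Longrightarrow>
      \<exists>K. clique K E \<and> card K = k + 1 \<and> (\<forall>w\<in>K. {u, w} \<in> E \<and> {v, w} \<in> E)"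
    and min_deg: "\<And>v. v \<in> V \<Longrightarrow> t \<le> card {u. {v, u} \<in> E}"
    and kt: "k < t"
begin

definition nb :: "'a \<Rightarrow> 'a set" where
  "nb v = {u. {v, u} \<in> E}"

text \<open>The smaller of the two bounds of \<open>two_families\<close> when all sets have size
  \<open>t\<close>, that is, for \<open>N = 2 * (t - k)\<close>.\<close>

definition M :: real where
  "M = min (2 * 4 ^ (t - k)) (2 * (real k + 1) * real ((2 * (t - k)) choose (t - k)))"

lemma M_nonneg: "M \<ge> 0"
  by (simp add: M_def)

lemma edgeD: "{u, v} \<in> E \<Longrightarrow> u \<in> V \<and> v \<in> V \<and> u \<noteq> v"
  using E_subset doubleton_in_nsets_2[of u v V] by blast

lemma nb_iff: "u \<in> nb v \<longleftrightarrow> {v, u} \<in> E"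
  by (simp add: nb_def)

lemma nb_sym: "u \<in> nb v \<longleftrightarrow> v \<in> nb u"
  by (simp add: nb_def insert_commute)

lemma nb_subset: "nb v \<subseteq> V" and nb_irrefl: "v \<notin> nb v"
  using edgeD edgeD[of v v] by (auto simp: nb_def)

lemma finite_nb [simp]: "finite (nb v)"
  using nb_subset finite_V finite_subset by blast

lemma clique_num_edge:
  assumes "u \<in> nb v"
  shows "clique_num E (nb u \<inter> nb v) \<le> k"
proof -
  obtain K where K: "K \<subseteq> nb u \<inter> nb v" "clique K E" "card K = clique_num E (nb u \<inter> nb v)"
    using clique_num_attained[of "nb u \<inter> nb v"] by auto
  have "u \<notin> K" "v \<notin> K" "u \<noteq> v" "finite K"
    using K(1) nb_irrefl assms by (auto intro: finite_subset[of K "nb u \<inter> nb v"])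
  moreover have "clique (insert u (insert v K)) E"
    using K assms by (auto simp: clique_def nb_iff insert_commute)
  moreover have "insert u (insert v K) \<subseteq> V"
    using K(1) nb_subset assms edgeD[of v u] by (auto simp: nb_iff)
  ultimately have "card K + 2 \<le> k + 2"
    using clique_le[of "insert u (insert v K)"] by simp
  thus ?thesis using K(3) by simp
qed

lemma common_clique_nb:
  assumes "u \<in> V" "v \<in> V" "u \<noteq> v" "v \<notin> nb u"
  obtains K where "clique K E" "card K = k + 1" "K \<subseteq> nb u \<inter> nb v" "finite K"
  using common_clique[OF assms(1-3)] assms(4)
  by (metis (no_types, lifting) nb_iff Int_iff card.infinite subsetI add_is_0 one_neq_zero)

text \<open>Shortfalls \<open>\<kappa>\<close> and \<open>d\<close> below \<open>t\<close> lower
  \<open>N\<close> by \<open>\<kappa> + d\<close>, and either bound of \<open>two_families\<close>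
  falls by a factor of at least 3/2 per unit. The strict inequalities \<open>k < card\<close> keep
  \<open>N\<close> positive, as the decay requires.\<close>

lemma family_bound:
  assumes I: "finite I"
    and A: "\<And>i. i \<in> I \<Longrightarrow> finite (A i) \<and> k < card (A i) \<and> card (A i) + \<kappa> \<le> t"
    and B: "\<And>i. i \<in> I \<Longrightarrow> finite (B i) \<and> k < card (B i) \<and> card (B i) + d \<le> t"
    and diag: "\<And>i. i \<in> I \<Longrightarrow> clique_num E (A i \<inter> B i) \<le> k"
    and cross: "\<And>i j. i \<in> I \<Longrightarrow> j \<in> I \<Longrightarrow> i \<noteq> j \<Longrightarrow> k < clique_num E (A i \<inter> B j)"
  shows "real (card I) \<le> (2/3) ^ (\<kappa> + d) * M"
proof (cases "I = {}")
  case True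
  thus ?thesis using M_nonneg by simp
next
  case False
  then obtain i where i: "i \<in> I" by blast
  have lt: "\<kappa> + d < 2 * (t - k)" using A[OF i] B[OF i] by linarith
  define N where "N = 2 * (t - k) - (\<kappa> + d)"
  have sizes: "k \<le> card (A i) \<and> k \<le> card (B i) \<and> card (A i) + card (B i) \<le> N + 2 * k" if "i \<in> I" for i
    using A[OF that] B[OF that] lt kt unfolding N_def by linarith
  have fAB: "finite (A i) \<and> finite (B i)" if "i \<in> I" for i using A[OF that] B[OF that] by simp
  have "card I \<le> 2 * 2 ^ N"
    by (rule two_families(1)[where A = A and B = B and k = k and E = E]) (use I fAB sizes diag cross in auto)
  moreover have "card I \<le> 2 * (N choose (N div 2)) * (k + 1)"
    by (rule two_families(2)[where A = A and B = B and k = k and E = E]) (use I fAB sizes diag cross in auto)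
  ultimately have "real (card I) \<le> real (2 * 2 ^ N)"
    "real (card I) \<le> real (2 * (N choose (N div 2)) * (k + 1))"
    unfolding of_nat_le_iff by blast+
  hence "real (card I) \<le> 2 * 2 ^ N" and I2: "real (card I) \<le> 2 * real (N choose (N div 2)) * (real k + 1)"
    by (simp_all add: algebra_simps)
  moreover have central: "real (N choose (N div 2)) \<le> (2/3) ^ (\<kappa> + d) * real ((2 * (t - k)) choose (t - k))"
    unfolding N_def by (rule central_binomial_decay[OF lt])
  moreover have "(2::real) ^ N \<le> (2/3) ^ (\<kappa> + d) * 4 ^ (t - k)"
  proof -
    have "(4::real) ^ (t - k) = 2 ^ (N + (\<kappa> + d))" using lt by (simp add: N_def power_mult)
    also have "\<dots> = 2 ^ N * 2 ^ (\<kappa> + d)" by (rule power_add)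
    finally have "(2/3) ^ (\<kappa> + d) * (4::real) ^ (t - k) = 2 ^ N * (4/3) ^ (\<kappa> + d)"
      by (simp add: power_mult_distrib[symmetric] mult_ac)
    moreover have "(4/3::real) ^ (\<kappa> + d) \<ge> 1" by (rule one_le_power) simp
    ultimately show ?thesis by simp
  qed
  ultimately have "real (card I) \<le> (2/3) ^ (\<kappa> + d) * (2 * 4 ^ (t - k))" by simp
  moreover have "2 * real (N choose (N div 2)) * (real k + 1)
      \<le> 2 * ((2/3) ^ (\<kappa> + d) * real ((2 * (t - k)) choose (t - k))) * (real k + 1)"
    using central by (intro mult_right_mono mult_left_mono) auto
  with I2 have "real (card I) \<le> 2 * ((2/3) ^ (\<kappa> + d) * real ((2 * (t - k)) choose (t - k))) * (real k + 1)"
    by (rule order_trans)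
  hence "real (card I) \<le> (2/3) ^ (\<kappa> + d) * (2 * (real k + 1) * real ((2 * (t - k)) choose (t - k)))"
    by (simp only: mult_ac)
  ultimately show ?thesis unfolding M_def by (simp add: min_def)
qed

end

section \<open>The charging argument\<close>

text \<open>The order \<open>\<rho>\<close> always removes a vertex of maximum remaining degree.\<close>

locale removal_levels = clique_saturated V E k t for V :: "'a set" and E k t +
  fixes T :: "'a set" and v0 :: 'a and \<rho> :: "'a \<Rightarrow> nat"
  assumes T_subset: "T \<subseteq> V" and T_deg: "\<And>x. x \<in> T \<Longrightarrow> card (nb x) = t"
    and T_indep: "\<And>x y. x \<in> T \<Longrightarrow> y \<in> T \<Longrightarrow> y \<notin> nb x"
    and T_max: "\<And>v. v \<in> V \<Longrightarrow> v \<notin> T \<Longrightarrow> card (nb v) = t \<Longrightarrow> nb v \<inter> T \<noteq> {}"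
    and v0: "v0 \<in> T"
    and \<rho>_inj: "inj_on \<rho> (V - T - nb v0)"
    and \<rho>_order: "\<And>y z. y \<in> V - T - nb v0 \<Longrightarrow> z \<in> V - T - nb v0 \<Longrightarrow> \<rho> y \<le> \<rho> z \<Longrightarrow>
      card {u\<in>V - T - nb v0. {z, u} \<in> E \<and> \<rho> y \<le> \<rho> u} \<le> card {u\<in>V - T - nb v0. {y, u} \<in> E \<and> \<rho> y \<le> \<rho> u}"
begin

definition X :: "'a set" where "X = nb v0"

definition R :: "'a set" where "R = V - T - X"

text \<open>\<open>Z q\<close> consists of what is left once all vertices with more than \<open>F q\<close> remaining neighbours are
  removed, so it spans a graph of maximum degree at most \<open>F q\<close>. A vertex of \<open>Z q\<close> with \<open>g q y \<le> t\<close> is unsaturated. The paired ones have a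
  partner whose neighbourhood in \<open>G q\<close> is also small, and are counted by the two families theorem;
  the other unsaturated ones see no unsaturated vertex of \<open>Z q\<close> and need no partner.\<close>

definition f :: "'a \<Rightarrow> nat" where "f y = card {u \<in> nb y \<inter> R. \<rho> y < \<rho> u}"

definition F :: "nat \<Rightarrow> nat" where "F q = 2 ^ (q + 30)"

definition Z :: "nat \<Rightarrow> 'a set" where "Z q = {y\<in>R. f y \<le> F q}"

definition G :: "nat \<Rightarrow> 'a set" where "G q = X \<union> (R - Z q)"

definition g :: "nat \<Rightarrow> 'a \<Rightarrow> nat" where "g q y = card (nb y \<inter> G q)"

definition paired :: "nat \<Rightarrow> 'a \<Rightarrow> bool" where
  "paired q y \<longleftrightarrow> y \<in> Z q \<and> g q y \<le> t \<and> (nb y \<inter> T \<noteq> {} \<or> (\<exists>x\<in>nb y \<inter> Z q. g q x \<le> t))"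

lemma finite_R [simp]: "finite R"
  using finite_V by (simp add: R_def)

lemma finite_Z [simp]: "finite (Z q)"
  by (simp add: Z_def)

lemma Z_subset: "Z q \<subseteq> R"
  by (auto simp: Z_def)

lemma F_ge_1: "1 \<le> F q"
  by (simp add: F_def)

lemma X_T_disjoint: "X \<inter> T = {}"
  using T_indep v0 by (auto simp: X_def)

lemma R_facts: "y \<in> R \<Longrightarrow> y \<in> V \<and> y \<notin> T \<and> y \<notin> X \<and> y \<noteq> v0 \<and> y \<notin> nb v0"
  using v0 by (auto simp: R_def X_def)

lemma nb_T_subset: "x \<in> T \<Longrightarrow> nb x \<subseteq> G q \<union> Z q"
  using nb_subset T_indep by (auto simp: G_def R_def)

lemma nb_no_T_subset: "nb y \<inter> T = {} \<Longrightarrow> nb y \<subseteq> G q \<union> Z q"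
  using nb_subset by (auto simp: G_def R_def)

lemma G_Z_disjoint: "G q \<inter> Z q = {}"
  by (auto simp: G_def R_def Z_def)

text \<open>Saturation of the nonadjacent pair \<open>v0\<close>, \<open>y\<close> puts a common
  \<open>(k + 1)\<close>-clique inside \<open>X\<close>. This supplies the lower bounds on set sizes
  in the two families.\<close>

lemma base_clique:
  assumes "y \<in> V" "y \<noteq> v0" "y \<notin> nb v0"
  shows "k < card (nb y \<inter> X)"
proof -
  obtain K where K: "card K = k + 1" "K \<subseteq> nb v0 \<inter> nb y"
    using common_clique_nb[of v0 y] assms T_subset v0 by blast
  hence "card K \<le> card (nb y \<inter> X)" by (intro card_mono) (auto simp: X_def)
  thus ?thesis using K(1) by simp
qed

lemma base_le_ground: "card (nb y \<inter> X) \<le> card (nb y \<inter> G q)"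
  by (intro card_mono) (auto simp: G_def)

lemma g_gt: "y \<in> R \<Longrightarrow> k < g q y"
  using base_clique[of y] base_le_ground[of y q] R_facts[of y] by (simp add: g_def)

lemma later_eq:
  assumes "y \<in> R"
  shows "{u\<in>R. {y, u} \<in> E \<and> \<rho> y \<le> \<rho> u} = {u \<in> nb y \<inter> R. \<rho> y < \<rho> u}"
proof -
  have "\<rho> y \<le> \<rho> u \<longleftrightarrow> \<rho> y < \<rho> u" if "u \<in> R" "{y, u} \<in> E" for u
    using inj_on_eq_iff[OF \<rho>_inj, of u y] that assms edgeD[OF that(2)] by (auto simp: R_def X_def)
  thus ?thesis by (auto simp: nb_iff)
qed

text \<open>By the removal rule, \<open>z\<close> has at most as many neighbours as \<open>y\<close>
  among the vertices present when \<open>y\<close> is removed. Hence each \<open>Z q\<close> is a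
  final segment of the order.\<close>

lemma f_mono:
  assumes "y \<in> R" "z \<in> R" "\<rho> y \<le> \<rho> z"
  shows "f z \<le> f y"
proof -
  have "f z \<le> card {u\<in>R. {z, u} \<in> E \<and> \<rho> y \<le> \<rho> u}"
    unfolding f_def using assms(3) by (intro card_mono) (auto simp: nb_iff)
  also have "\<dots> \<le> card {u\<in>R. {y, u} \<in> E \<and> \<rho> y \<le> \<rho> u}"
    using \<rho>_order[of y z] assms by (simp add: R_def X_def)
  finally show ?thesis using later_eq[OF assms(1)] by (simp add: f_def)
qed

text \<open>When the earliest vertex of \<open>Z q\<close> is removed, all of \<open>Z q\<close> is
  still present, and that vertex has the maximum remaining degree, which is its \<open>f\<close>
  value.\<close>

lemma Z_degree:
  assumes "z \<in> Z q"
  shows "card (nb z \<inter> Z q) \<le> F q"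
proof -
  have "Min (\<rho> ` Z q) \<in> \<rho> ` Z q" using assms by (intro Min_in) auto
  then obtain y where y: "y \<in> Z q" "Min (\<rho> ` Z q) = \<rho> y" by blast
  have le: "\<rho> y \<le> \<rho> u" if "u \<in> Z q" for u
    using that y(2) by (metis Min_le finite_Z finite_imageI imageI)
  have R: "y \<in> R" "z \<in> R" using y assms Z_subset by auto
  have "card (nb z \<inter> Z q) \<le> card {u\<in>R. {z, u} \<in> E \<and> \<rho> y \<le> \<rho> u}"
    using le Z_subset by (intro card_mono) (auto simp: nb_iff)
  also have "\<dots> \<le> card {u\<in>R. {y, u} \<in> E \<and> \<rho> y \<le> \<rho> u}"
    using \<rho>_order[of y z] le[OF assms] R by (simp add: R_def X_def)
  also have "\<dots> = f y" unfolding later_eq[OF R(1)] f_def ..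
  also have "\<dots> \<le> F q" using y by (simp add: Z_def)
  finally show ?thesis .
qed

lemma card_second_neighbours:
  assumes "S \<subseteq> Z q"
  shows "card (\<Union>u\<in>S. nb u \<inter> Z q) \<le> card S * F q"
proof -
  have "finite S" using assms finite_subset finite_Z by blast
  hence "card (\<Union>u\<in>S. nb u \<inter> Z q) \<le> (\<Sum>u\<in>S. card (nb u \<inter> Z q))" by (rule card_UN_le)
  also have "\<dots> \<le> (\<Sum>u\<in>S. F q)" using assms by (intro sum_mono Z_degree) auto
  finally show ?thesis by simp
qed

text \<open>When \<open>i\<close> and \<open>x j\<close> are nonadjacent, a \<open>(k + 1)\<close>-clique joins them; the last assumption keeps it inside
  \<open>G q\<close>, so the neighbourhoods in \<open>G q\<close> form a pair of cross-intersecting families.\<close>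

lemma conflict_free_bound:
  fixes x :: "'a \<Rightarrow> 'a"
  assumes J: "J \<subseteq> Z q" "\<And>y. y \<in> J \<Longrightarrow> g q y + \<kappa> = t"
    and x: "\<And>y. y \<in> J \<Longrightarrow> x y \<in> nb y \<and> k < card (nb (x y) \<inter> G q) \<and> card (nb (x y) \<inter> G q) + d \<le> t"
    and sub: "\<And>i j. i \<in> J \<Longrightarrow> j \<in> J \<Longrightarrow> nb i \<inter> nb (x j) \<subseteq> G q \<union> Z q"
    and free: "\<And>i j. i \<in> J \<Longrightarrow> j \<in> J \<Longrightarrow> i \<noteq> j \<Longrightarrow>
      i \<noteq> x j \<and> i \<notin> nb (x j) \<and> (\<forall>u\<in>nb (x j) \<inter> Z q. i \<notin> nb u)"
  shows "real (card J) \<le> (2/3) ^ (\<kappa> + d) * M"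
proof (rule family_bound[where A = "\<lambda>y. nb y \<inter> G q" and B = "\<lambda>y. nb (x y) \<inter> G q"])
  show "finite J" using J(1) finite_Z finite_subset by blast
  show "finite (nb y \<inter> G q) \<and> k < card (nb y \<inter> G q) \<and> card (nb y \<inter> G q) + \<kappa> \<le> t" if "y \<in> J" for y
  proof -
    have "y \<in> R" using that J(1) Z_subset by blast
    thus ?thesis using g_gt[of y q] J(2)[OF that] by (simp add: g_def)
  qed
  show "finite (nb (x y) \<inter> G q) \<and> k < card (nb (x y) \<inter> G q) \<and> card (nb (x y) \<inter> G q) + d \<le> t"
    if "y \<in> J" for y using x[OF that] by simp
  show "clique_num E ((nb y \<inter> G q) \<inter> (nb (x y) \<inter> G q)) \<le> k" if "y \<in> J" for y
  proof -
    have "clique_num E ((nb y \<inter> G q) \<inter> (nb (x y) \<inter> G q)) \<le> clique_num E (nb (x y) \<inter> nb y)"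
      by (rule clique_num_mono) auto
    also have "\<dots> \<le> k" using x[OF that] by (intro clique_num_edge) auto
    finally show ?thesis .
  qed
  show "k < clique_num E ((nb i \<inter> G q) \<inter> (nb (x j) \<inter> G q))" if ij: "i \<in> J" "j \<in> J" "i \<noteq> j" for i j
  proof -
    have V: "i \<in> V" "x j \<in> V"
      using ij J(1) Z_subset R_facts x[OF ij(2)] nb_subset by blast+
    obtain K where K: "clique K E" "card K = k + 1" "K \<subseteq> nb i \<inter> nb (x j)"
      using common_clique_nb[of i "x j"] V free[OF ij] by (metis nb_sym)
    have "K \<subseteq> G q"
    proof
      fix w assume w: "w \<in> K"
      hence "w \<in> G q \<union> Z q" using K(3) sub[OF ij(1,2)] by blast
      moreover have "w \<notin> Z q" using free[OF ij] w K(3) nb_sym[of w i] by blast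
      ultimately show "w \<in> G q" by blast
    qed
    hence "card K \<le> clique_num E ((nb i \<inter> G q) \<inter> (nb (x j) \<inter> G q))"
      using K by (intro clique_num_ge) auto
    thus ?thesis using K(2) by simp
  qed
qed

section \<open>Counting paired vertices\<close>

text \<open>A partner in \<open>T\<close> may have many neighbours in \<open>Z q\<close>, so
  partners are sorted by that number \<open>d\<close>. Conflicts grow linearly in \<open>d\<close>,
  but at most \<open>t - d\<close> neighbours remain in \<open>G q\<close>, which gains
  \<open>(2/3)^d\<close>. Independence of \<open>T\<close> keeps the joining cliques inside
  \<open>G q \<union> Z q\<close>.\<close>

lemma count_pairs_T_degree:
  "real (card {y\<in>Z q. g q y + \<kappa> = t \<and> (\<exists>x\<in>nb y \<inter> T. card (nb x \<inter> Z q) = d)})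
    \<le> real (2 * (d + d * F q) + 1) * (2/3) ^ (\<kappa> + d) * M"
proof -
  define S where "S = {y\<in>Z q. g q y + \<kappa> = t \<and> (\<exists>x\<in>nb y \<inter> T. card (nb x \<inter> Z q) = d)}"
  have "\<forall>y\<in>S. \<exists>x. x \<in> nb y \<inter> T \<and> card (nb x \<inter> Z q) = d" by (auto simp: S_def)
  then obtain x where x: "\<And>y. y \<in> S \<Longrightarrow> x y \<in> nb y \<inter> T \<and> card (nb (x y) \<inter> Z q) = d"
    by (metis bchoice)
  \<comment> \<open>A conflict is a reason why no joining clique inside \<open>G q\<close> is
    guaranteed: \<open>y\<close> is adjacent to the partner of \<open>y'\<close>, or shares with it
    a neighbour in \<open>Z q\<close>.\<close>
  define C where "C = (\<lambda>y' y. y \<in> nb (x y') \<or> (\<exists>u\<in>nb (x y') \<inter> Z q. y \<in> nb u))"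
  have fS: "finite S" by (auto simp: S_def)
  have deg: "card {y\<in>S. C y' y} \<le> d + d * F q" if y': "y' \<in> S" for y'
  proof -
    have "{y\<in>S. C y' y} \<subseteq> (nb (x y') \<inter> Z q) \<union> (\<Union>u\<in>nb (x y') \<inter> Z q. nb u \<inter> Z q)"
      by (auto simp: C_def S_def)
    hence "card {y\<in>S. C y' y} \<le> card ((nb (x y') \<inter> Z q) \<union> (\<Union>u\<in>nb (x y') \<inter> Z q. nb u \<inter> Z q))"
      by (intro card_mono) auto
    also have "\<dots> \<le> card (nb (x y') \<inter> Z q) + card (\<Union>u\<in>nb (x y') \<inter> Z q. nb u \<inter> Z q)"
      by (rule card_Un_le)
    also have "\<dots> \<le> d + d * F q"
      using x[OF y'] card_second_neighbours[of "nb (x y') \<inter> Z q" q] by simp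
    finally show ?thesis .
  qed
  obtain J where "J \<subseteq> S \<and> card S \<le> (2 * (d + d * F q) + 1) * card J \<and> (\<forall>y\<in>J. \<forall>z\<in>J. y \<noteq> z \<longrightarrow> \<not> C y z)"
    using independent_subset_of_outdegree[where R = C and D = "d + d * F q", OF fS deg] by blast
  hence J: "J \<subseteq> S" "card S \<le> (2 * (d + d * F q) + 1) * card J"
    "\<And>y z. y \<in> J \<Longrightarrow> z \<in> J \<Longrightarrow> y \<noteq> z \<Longrightarrow> \<not> C y z"
    by simp_all
  have "real (card J) \<le> (2/3) ^ (\<kappa> + d) * M"
  proof (rule conflict_free_bound[where x = x])
    show "J \<subseteq> Z q" "\<And>y. y \<in> J \<Longrightarrow> g q y + \<kappa> = t" using J(1) by (auto simp: S_def)
    fix y assume "y \<in> J"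
    hence y: "y \<in> S" using J(1) by blast
    have xT: "x y \<in> T" "x y \<in> nb y" using x[OF y] by auto
    have yR: "y \<in> R" using y Z_subset by (auto simp: S_def)
    have "x y \<noteq> v0" using xT R_facts[OF yR] nb_sym[of y v0] by auto
    moreover have "x y \<in> V" "x y \<notin> nb v0" using xT T_subset T_indep v0 by auto
    ultimately have "k < card (nb (x y) \<inter> X)" using base_clique by blast
    hence "k < card (nb (x y) \<inter> G q)" using base_le_ground[of "x y" q] by simp
    moreover have "card (nb (x y) \<inter> G q) + card (nb (x y) \<inter> Z q) = card ((nb (x y) \<inter> G q) \<union> (nb (x y) \<inter> Z q))"
      using G_Z_disjoint[of q] by (intro card_Un_disjoint[symmetric]) auto
    moreover have "card ((nb (x y) \<inter> G q) \<union> (nb (x y) \<inter> Z q)) \<le> card (nb (x y))"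
      by (intro card_mono) auto
    ultimately show "x y \<in> nb y \<and> k < card (nb (x y) \<inter> G q) \<and> card (nb (x y) \<inter> G q) + d \<le> t"
      using x[OF y] T_deg[OF xT(1)] by simp
  next
    fix i j assume ij: "i \<in> J" "j \<in> J"
    hence xT: "x j \<in> T" using x[of j] J(1) by blast
    thus "nb i \<inter> nb (x j) \<subseteq> G q \<union> Z q" using nb_T_subset[OF xT, of q] by blast
    assume ne: "i \<noteq> j"
    have "i \<in> R" using ij J(1) Z_subset by (auto simp: S_def)
    hence "i \<noteq> x j" using xT R_facts by blast
    thus "i \<noteq> x j \<and> i \<notin> nb (x j) \<and> (\<forall>u\<in>nb (x j) \<inter> Z q. i \<notin> nb u)"
      using J(3)[OF ij(2,1)] ne unfolding C_def by blast
  qed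
  moreover have "real (card S) \<le> real (2 * (d + d * F q) + 1) * real (card J)"
    using J(2) unfolding of_nat_mult[symmetric] of_nat_le_iff .
  ultimately have "real (card S) \<le> real (2 * (d + d * F q) + 1) * ((2/3) ^ (\<kappa> + d) * M)"
    by (meson mult_left_mono of_nat_0_le_iff order_trans)
  thus ?thesis by (simp add: S_def mult.assoc)
qed

text \<open>A partner in \<open>Z q\<close> has at most \<open>F q\<close> neighbours there, so
  conflicts are bounded in terms of \<open>F q\<close>. The summand 1 covers the case that
  \<open>y\<close> is itself the partner of \<open>y'\<close>, and
  \<open>nb y \<inter> T = {}\<close> keeps the joining cliques away from \<open>T\<close>.\<close>

lemma count_pairs_Z:
  "real (card {y\<in>Z q. g q y + \<kappa> = t \<and> nb y \<inter> T = {} \<and> (\<exists>x\<in>nb y \<inter> Z q. g q x \<le> t)})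
    \<le> real (2 * (1 + F q + F q * F q) + 1) * (2/3) ^ \<kappa> * M"
proof -
  define S where "S = {y\<in>Z q. g q y + \<kappa> = t \<and> nb y \<inter> T = {} \<and> (\<exists>x\<in>nb y \<inter> Z q. g q x \<le> t)}"
  have "\<forall>y\<in>S. \<exists>x. x \<in> nb y \<inter> Z q \<and> g q x \<le> t" by (auto simp: S_def)
  then obtain x where x: "\<And>y. y \<in> S \<Longrightarrow> x y \<in> nb y \<inter> Z q \<and> g q (x y) \<le> t"
    by (metis bchoice)
  define C where "C = (\<lambda>y' y. y = x y' \<or> y \<in> nb (x y') \<or> (\<exists>u\<in>nb (x y') \<inter> Z q. y \<in> nb u))"
  have fS: "finite S" by (auto simp: S_def)
  have deg: "card {y\<in>S. C y' y} \<le> 1 + F q + F q * F q" if y': "y' \<in> S" for y'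
  proof -
    have "{y\<in>S. C y' y} \<subseteq> insert (x y') ((nb (x y') \<inter> Z q) \<union> (\<Union>u\<in>nb (x y') \<inter> Z q. nb u \<inter> Z q))"
      by (auto simp: C_def S_def)
    hence "card {y\<in>S. C y' y} \<le> card (insert (x y') ((nb (x y') \<inter> Z q) \<union> (\<Union>u\<in>nb (x y') \<inter> Z q. nb u \<inter> Z q)))"
      by (intro card_mono) auto
    also have "\<dots> \<le> Suc (card ((nb (x y') \<inter> Z q) \<union> (\<Union>u\<in>nb (x y') \<inter> Z q. nb u \<inter> Z q)))"
      by (rule card_insert_le_m1) auto
    also have "card ((nb (x y') \<inter> Z q) \<union> (\<Union>u\<in>nb (x y') \<inter> Z q. nb u \<inter> Z q))
        \<le> card (nb (x y') \<inter> Z q) + card (\<Union>u\<in>nb (x y') \<inter> Z q. nb u \<inter> Z q)"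
      by (rule card_Un_le)
    also have "card (\<Union>u\<in>nb (x y') \<inter> Z q. nb u \<inter> Z q) \<le> card (nb (x y') \<inter> Z q) * F q"
      by (rule card_second_neighbours) auto
    also have "card (nb (x y') \<inter> Z q) + card (nb (x y') \<inter> Z q) * F q \<le> F q + F q * F q"
      using Z_degree[of "x y'" q] x[OF y'] by (intro add_mono mult_le_mono1) auto
    finally show ?thesis by simp
  qed
  obtain J where "J \<subseteq> S \<and> card S \<le> (2 * (1 + F q + F q * F q) + 1) * card J \<and> (\<forall>y\<in>J. \<forall>z\<in>J. y \<noteq> z \<longrightarrow> \<not> C y z)"
    using independent_subset_of_outdegree[where R = C and D = "1 + F q + F q * F q", OF fS deg] by blast
  hence J: "J \<subseteq> S" "card S \<le> (2 * (1 + F q + F q * F q) + 1) * card J"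
    "\<And>y z. y \<in> J \<Longrightarrow> z \<in> J \<Longrightarrow> y \<noteq> z \<Longrightarrow> \<not> C y z"
    by simp_all
  have "real (card J) \<le> (2/3) ^ (\<kappa> + 0) * M"
  proof (rule conflict_free_bound[where x = x])
    show "J \<subseteq> Z q" "\<And>y. y \<in> J \<Longrightarrow> g q y + \<kappa> = t" using J(1) by (auto simp: S_def)
    fix y assume "y \<in> J"
    hence "y \<in> S" using J(1) by blast
    thus "x y \<in> nb y \<and> k < card (nb (x y) \<inter> G q) \<and> card (nb (x y) \<inter> G q) + 0 \<le> t"
      using x[of y] g_gt[of "x y" q] Z_subset[of q] by (auto simp: g_def)
  next
    fix i j assume ij: "i \<in> J" "j \<in> J"
    have "nb i \<inter> T = {}" using ij(1) J(1) by (auto simp: S_def)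
    thus "nb i \<inter> nb (x j) \<subseteq> G q \<union> Z q" using nb_no_T_subset[of i q] by blast
    assume "i \<noteq> j"
    thus "i \<noteq> x j \<and> i \<notin> nb (x j) \<and> (\<forall>u\<in>nb (x j) \<inter> Z q. i \<notin> nb u)"
      using J(3)[OF ij(2,1) not_sym] unfolding C_def by blast
  qed
  moreover have "real (card S) \<le> real (2 * (1 + F q + F q * F q) + 1) * real (card J)"
    using J(2) unfolding of_nat_mult[symmetric] of_nat_le_iff .
  ultimately have "real (card S) \<le> real (2 * (1 + F q + F q * F q) + 1) * ((2/3) ^ (\<kappa> + 0) * M)"
    by (meson mult_left_mono of_nat_0_le_iff order_trans)
  thus ?thesis by (simp add: S_def mult.assoc)
qed

end

lemma sum_arith_geom_two_thirds: "(\<Sum>d=1..n. real d * (2/3) ^ d) \<le> 6"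
proof -
  have "(\<Sum>d=1..n. real d * (2/3) ^ d) = 6 - (2 * real n + 6) * (2/3) ^ n"
    by (induction n) (simp_all add: field_simps)
  thus ?thesis by simp
qed

lemma sum_geom_le:
  fixes x :: real
  assumes "0 \<le> x" "x < 1"
  shows "(\<Sum>i=c..n. x ^ i) \<le> x ^ c / (1 - x)"
proof (cases "c \<le> n")
  case True
  have "(1 - x) * (\<Sum>i=c..n. x ^ i) = x ^ c - x ^ Suc n" by (rule sum_gp_multiplied[OF True])
  also have "\<dots> \<le> x ^ c" using assms by simp
  finally show ?thesis using assms by (simp add: field_simps)
qed (use assms in simp)

context removal_levels
begin

text \<open>The loss linear in \<open>d\<close> against the decay \<open>(2/3)^d\<close> sums to at
  most 6, and \<open>2 * (d + d * F q) + 1 \<le> 5 * d * F q\<close>; hence 30. The value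
  \<open>d = 0\<close> does not occur, because \<open>y\<close> is a neighbour of its partner in
  \<open>Z q\<close>.\<close>

lemma count_pairs_T:
  "real (card {y\<in>Z q. g q y + \<kappa> = t \<and> nb y \<inter> T \<noteq> {}}) \<le> 30 * real (F q) * (2/3) ^ \<kappa> * M"
proof -
  define S where "S = (\<lambda>d. {y\<in>Z q. g q y + \<kappa> = t \<and> (\<exists>x\<in>nb y \<inter> T. card (nb x \<inter> Z q) = d)})"
  have "{y\<in>Z q. g q y + \<kappa> = t \<and> nb y \<inter> T \<noteq> {}} \<subseteq> (\<Union>d\<in>{1..t}. S d)"
  proof
    fix y assume "y \<in> {y\<in>Z q. g q y + \<kappa> = t \<and> nb y \<inter> T \<noteq> {}}"
    then obtain x where x: "y \<in> Z q" "g q y + \<kappa> = t" "x \<in> nb y" "x \<in> T" by blast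
    have "y \<in> nb x \<inter> Z q" using x nb_sym by blast
    hence "card (nb x \<inter> Z q) \<ge> 1" by (metis One_nat_def Suc_leI card_gt_0_iff empty_iff finite_Int finite_nb)
    moreover have "card (nb x \<inter> Z q) \<le> card (nb x)" by (intro card_mono) auto
    ultimately show "y \<in> (\<Union>d\<in>{1..t}. S d)" using x T_deg[OF x(4)] by (auto simp: S_def)
  qed
  hence "card {y\<in>Z q. g q y + \<kappa> = t \<and> nb y \<inter> T \<noteq> {}} \<le> card (\<Union>d\<in>{1..t}. S d)"
    by (intro card_mono) (auto simp: S_def)
  also have "\<dots> \<le> (\<Sum>d=1..t. card (S d))" by (rule card_UN_le) auto
  finally have "real (card {y\<in>Z q. g q y + \<kappa> = t \<and> nb y \<inter> T \<noteq> {}}) \<le> real (\<Sum>d=1..t. card (S d))"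
    by (simp only: of_nat_le_iff)
  also have "\<dots> = (\<Sum>d=1..t. real (card (S d)))" by (rule of_nat_sum)
  also have "\<dots> \<le> (\<Sum>d=1..t. 5 * real (F q) * (2/3) ^ \<kappa> * M * (real d * (2/3) ^ d))"
  proof (rule sum_mono)
    fix d assume d: "d \<in> {1..t}"
    have "1 * 1 \<le> d * F q" "d * 1 \<le> d * F q" using d F_ge_1[of q] by (auto simp: mult_le_mono)
    moreover have "2 * (d + m) + 1 \<le> 5 * m" if "1 * 1 \<le> m" "d * 1 \<le> m" for m :: nat using that by simp
    ultimately have "2 * (d + d * F q) + 1 \<le> 5 * (d * F q)" by blast
    hence "real (2 * (d + d * F q) + 1) \<le> real (5 * (d * F q))" unfolding of_nat_le_iff .
    hence le: "real (2 * (d + d * F q) + 1) \<le> 5 * (real d * real (F q))" by simp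
    have "real (card (S d)) \<le> real (2 * (d + d * F q) + 1) * (2/3) ^ (\<kappa> + d) * M"
      unfolding S_def by (rule count_pairs_T_degree)
    also have "\<dots> \<le> 5 * (real d * real (F q)) * (2/3) ^ (\<kappa> + d) * M"
      using le M_nonneg by (intro mult_right_mono) auto
    finally show "real (card (S d)) \<le> 5 * real (F q) * (2/3) ^ \<kappa> * M * (real d * (2/3) ^ d)"
      by (simp add: power_add mult_ac)
  qed
  also have "\<dots> = 5 * real (F q) * (2/3) ^ \<kappa> * M * (\<Sum>d=1..t. real d * (2/3) ^ d)"
    by (rule sum_distrib_left[symmetric])
  also have "\<dots> \<le> 5 * real (F q) * (2/3) ^ \<kappa> * M * 6"
    using M_nonneg by (intro mult_left_mono sum_arith_geom_two_thirds) auto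
  finally show ?thesis by simp
qed

text \<open>Partners in \<open>T\<close> contribute 30, and those in \<open>Z q\<close> contribute
  7, as \<open>3 + 2 * F q + 2 * F q ^ 2 \<le> 7 * F q ^ 2\<close>.\<close>

lemma count_paired:
  "real (card {y\<in>Z q. paired q y \<and> g q y + \<kappa> = t}) \<le> 37 * real (F q) ^ 2 * (2/3) ^ \<kappa> * M"
proof -
  let ?S = "{y\<in>Z q. g q y + \<kappa> = t \<and> nb y \<inter> T \<noteq> {}}"
  let ?S' = "{y\<in>Z q. g q y + \<kappa> = t \<and> nb y \<inter> T = {} \<and> (\<exists>x\<in>nb y \<inter> Z q. g q x \<le> t)}"
  have F: "1 \<le> real (F q)" using F_ge_1[of q] by simp
  hence F2: "real (F q) \<le> real (F q) ^ 2" "1 \<le> real (F q) ^ 2"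
    using one_le_power[OF F, of 2] mult_left_mono[OF F, of "real (F q)"] by (auto simp: power2_eq_square)
  have "card {y\<in>Z q. paired q y \<and> g q y + \<kappa> = t} \<le> card (?S \<union> ?S')"
    by (intro card_mono) (auto simp: paired_def)
  also have "\<dots> \<le> card ?S + card ?S'" by (rule card_Un_le)
  finally have "real (card {y\<in>Z q. paired q y \<and> g q y + \<kappa> = t}) \<le> real (card ?S + card ?S')"
    by (simp only: of_nat_le_iff)
  also have "\<dots> = real (card ?S) + real (card ?S')" by (rule of_nat_add)
  also have "\<dots> \<le> 30 * real (F q) * (2/3) ^ \<kappa> * M + real (2 * (1 + F q + F q * F q) + 1) * (2/3) ^ \<kappa> * M"
    by (intro add_mono count_pairs_T count_pairs_Z)
  also have "\<dots> = (30 * real (F q) + real (2 * (1 + F q + F q * F q) + 1)) * ((2/3) ^ \<kappa> * M)"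
    by (simp only: distrib_right mult.assoc)
  also have "\<dots> \<le> (37 * real (F q) ^ 2) * ((2/3) ^ \<kappa> * M)"
  proof (rule mult_right_mono)
    show "30 * real (F q) + real (2 * (1 + F q + F q * F q) + 1) \<le> 37 * real (F q) ^ 2"
      using F2 by (simp add: power2_eq_square)
  qed (use M_nonneg in simp)
  finally show ?thesis by (simp only: mult.assoc)
qed

lemma sum_paired_large:
  "(\<Sum>y\<in>{y\<in>Z q. paired q y \<and> c \<le> t - g q y}. real (t - g q y) + 1)
    \<le> 1184 * real (F q) ^ 2 * (3/4) ^ c * M"
proof -
  define S where "S = {y\<in>Z q. paired q y \<and> c \<le> t - g q y}"
  define W where "W = 37 * real (F q) ^ 2 * M"
  have W: "W \<ge> 0" using M_nonneg by (simp add: W_def)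
  have "(\<Sum>y\<in>S. real (t - g q y) + 1)
      = (\<Sum>\<kappa>=c..t. \<Sum>y\<in>{y\<in>S. t - g q y = \<kappa>}. real (t - g q y) + 1)"
    by (intro sum.group[symmetric]) (auto simp: S_def)
  also have "\<dots> \<le> (\<Sum>\<kappa>=c..t. 8 * W * (3/4) ^ \<kappa>)"
  proof (rule sum_mono)
    fix \<kappa> assume "\<kappa> \<in> {c..t}"
    \<comment> \<open>The weight \<open>\<kappa> + 1\<close> is traded for a slower decay,
      \<open>(2/3) * (9/8) = 3/4\<close>. The geometric tail costs another 4, and
      \<open>37 * 8 * 4 = 1184\<close>.\<close>
    have "real \<kappa> + 1 \<le> 8 * (1 + real \<kappa> * (1/8))" by simp
    also have "\<dots> \<le> 8 * (1 + 1/8) ^ \<kappa>"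
      by (intro mult_left_mono Bernoulli_inequality) auto
    finally have \<kappa>: "real \<kappa> + 1 \<le> 8 * (9/8) ^ \<kappa>" by simp
    have "(\<Sum>y\<in>{y\<in>S. t - g q y = \<kappa>}. real (t - g q y) + 1) = real (card {y\<in>S. t - g q y = \<kappa>}) * (real \<kappa> + 1)"
      by simp
    also have "\<dots> \<le> real (card {y\<in>Z q. paired q y \<and> g q y + \<kappa> = t}) * (real \<kappa> + 1)"
      by (intro mult_right_mono of_nat_mono card_mono) (auto simp: S_def paired_def)
    also have "\<dots> \<le> (37 * real (F q) ^ 2 * (2/3) ^ \<kappa> * M) * (8 * (9/8) ^ \<kappa>)"
      using \<kappa> M_nonneg by (intro mult_mono count_paired) auto
    also have "\<dots> = 8 * W * ((2/3) * (9/8)) ^ \<kappa>"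
      by (simp only: power_mult_distrib W_def mult_ac)
    finally show "(\<Sum>y\<in>{y\<in>S. t - g q y = \<kappa>}. real (t - g q y) + 1) \<le> 8 * W * (3/4) ^ \<kappa>" by simp
  qed
  also have "\<dots> = 8 * W * (\<Sum>\<kappa>=c..t. (3/4) ^ \<kappa>)" by (rule sum_distrib_left[symmetric])
  also have "\<dots> \<le> 8 * W * ((3/4) ^ c / (1 - 3/4))"
    using W by (intro mult_left_mono sum_geom_le) auto
  finally show ?thesis by (simp add: S_def W_def mult_ac)
qed

end

section \<open>Distribution of the edges\<close>

context removal_levels
begin

text \<open>Each edge distributes weight at most 1 to its ends. An edge inside \<open>R\<close> is judged at the level of its
  earlier end \<open>y\<close>: a saturated end cedes the whole weight to an unsaturated one, and two unsaturated
  ends split it as \<open>eps\<close> and \<open>1 - eps\<close>. A vertex of class \<open>p > 0\<close> has more than \<open>F (p - 1)\<close> later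
  neighbours, so with this \<open>eps\<close> it still gains \<open>L p + 2\<close> from them.\<close>

definition L :: "nat \<Rightarrow> nat" where "L q = 10 * (q + 30)"

definition eps :: "nat \<Rightarrow> real" where
  "eps q = (if q = 0 then 0 else real (L q + 2) / real (F (q - 1)))"

definition cl :: "'a \<Rightarrow> nat" where "cl y = (LEAST q. f y \<le> F q)"

definition up :: "nat \<Rightarrow> 'a \<Rightarrow> 'a \<Rightarrow> real" where
  "up q y z = (if g q y \<le> t then if g q z \<le> t then eps q else 1 else 0)"

definition down :: "nat \<Rightarrow> 'a \<Rightarrow> 'a \<Rightarrow> real" where
  "down q y z = (if g q z \<le> t then if g q y \<le> t then 1 - eps q else 1 else 0)"

definition share :: "'a \<Rightarrow> 'a \<Rightarrow> real" where
  "share y u = (if y \<in> T then 1 else if y \<in> R then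
     if u \<in> X then 1 else if u \<in> R then if \<rho> y < \<rho> u then up (cl y) y u else down (cl u) u y else 0
   else 0)"

text \<open>An upper bound for what \<open>y\<close> misses at level \<open>p\<close> through the
  split: neighbours of class \<open>p\<close> give \<open>eps p\<close> too little, and at most
  \<open>t + 1 - g p y\<close> of them matter before \<open>y\<close> is saturated.\<close>

definition loss :: "nat \<Rightarrow> 'a \<Rightarrow> real" where
  "loss p y = (if paired p y then eps p * (real (t - g p y) + 1) else 0)"

text \<open>The distance to \<open>t + 1\<close>, recorded only where it must be charged to the two
  families count: always at level 0, where no gain from later neighbours is available, and from
  \<open>L p\<close> on at higher levels.\<close>

definition excess :: "nat \<Rightarrow> 'a \<Rightarrow> real" where
  "excess p y = (if paired p y \<and> (p = 0 \<or> L p \<le> t - g p y) then real (t - g p y) + 1 else 0)"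

lemma F_mono: "p \<le> q \<Longrightarrow> F p \<le> F q"
  by (simp add: F_def)

lemma le_F_cl: "f y \<le> F (cl y)"
proof -
  have "f y \<le> 2 ^ f y" by (simp add: less_imp_le)
  also have "\<dots> \<le> F (f y)" by (simp add: F_def)
  finally show ?thesis unfolding cl_def by (rule LeastI)
qed

lemma Z_iff: "y \<in> R \<Longrightarrow> y \<in> Z q \<longleftrightarrow> cl y \<le> q"
  using le_F_cl[of y] F_mono[of "cl y" q] by (auto simp: Z_def cl_def intro: Least_le)

lemma F_lt_f: "q < cl y \<Longrightarrow> F q < f y"
  unfolding cl_def using not_less_Least not_le by blast

lemma cl_mono: "y \<in> R \<Longrightarrow> z \<in> R \<Longrightarrow> \<rho> y \<le> \<rho> z \<Longrightarrow> cl z \<le> cl y"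
  using f_mono[of y z] le_F_cl[of y] Z_iff[of z "cl y"] by (simp add: Z_def)

lemma eps_bounds: "0 \<le> eps q" "eps q \<le> 1"
proof -
  show "0 \<le> eps q" by (simp add: eps_def)
  have "10 * (q + 30) + 2 \<le> 2 ^ (q + 9)" for q :: nat
  proof (induction q)
    case (Suc q)
    have "10 * (Suc q + 30) + 2 \<le> 2 * (10 * (q + 30) + 2)" by simp
    also have "\<dots> \<le> 2 * 2 ^ (q + 9)" using Suc by (rule mult_le_mono2)
    finally show ?case by (simp only: add_Suc power_Suc)
  qed simp
  hence "L q + 2 \<le> 2 ^ (q + 9)" by (simp add: L_def)
  also have "\<dots> \<le> 2 ^ (q - 1 + 30)" by (intro power_increasing) auto
  finally have "L q + 2 \<le> F (q - 1)" by (simp only: F_def)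
  hence "real (L q + 2) \<le> real (F (q - 1))" by (simp only: of_nat_le_iff)
  moreover have "0 < real (F (q - 1))" using F_ge_1[of "q - 1"] by simp
  ultimately show "eps q \<le> 1" by (simp add: eps_def)
qed

lemma up_nonneg: "0 \<le> up q y z" and down_nonneg: "0 \<le> down q y z"
  using eps_bounds[of q] by (auto simp: up_def down_def)

lemma share_nonneg: "0 \<le> share y u"
  using up_nonneg down_nonneg by (auto simp: share_def)

lemma up_plus_down: "up q y z + down q y z \<le> 1"
  by (auto simp: up_def down_def)

lemma share_sum_le:
  assumes "{u, v} \<in> E"
  shows "share u v + share v u \<le> 1"
proof -
  have nbr: "v \<in> nb u" using assms by (simp add: nb_iff)
  have V: "u \<in> V" "v \<in> V" "u \<noteq> v" using edgeD[OF assms] by auto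
  have R: "w \<in> R \<longleftrightarrow> w \<notin> T \<and> w \<notin> X" if "w \<in> V" for w using that by (auto simp: R_def)
  have indep: "\<not> (u \<in> T \<and> v \<in> T)" using T_indep nbr by blast
  have XT: "w \<notin> T" if "w \<in> X" for w using that X_T_disjoint by blast
  show ?thesis
  proof (cases "u \<in> R \<and> v \<in> R")
    case True
    hence notin: "u \<notin> T" "v \<notin> T" "u \<notin> X" "v \<notin> X" by (auto simp: R_def)
    have "\<rho> u \<noteq> \<rho> v"
      using inj_on_eq_iff[OF \<rho>_inj, of u v] True V(3) by (auto simp: R_def X_def)
    hence "share u v + share v u = up (cl u) u v + down (cl u) u v
        \<or> share u v + share v u = up (cl v) v u + down (cl v) v u"
      using True notin by (auto simp: share_def)
    thus ?thesis using up_plus_down[of "cl u" u v] up_plus_down[of "cl v" v u] by auto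
  next
    case False
    thus ?thesis using indep XT R[OF V(1)] R[OF V(2)] by (auto simp: share_def)
  qed
qed

text \<open>Passing from level \<open>p + 1\<close> to \<open>p\<close> moves exactly the vertices
  of class \<open>p + 1\<close> into the ground set.\<close>

lemma ground_step:
  assumes "y \<in> R"
  shows "g p y = g (Suc p) y + card {w \<in> nb y \<inter> R. cl w = Suc p}"
proof -
  have "nb y \<inter> G p = (nb y \<inter> G (Suc p)) \<union> {w \<in> nb y \<inter> R. cl w = Suc p}"
    using Z_iff by (auto simp: G_def)
  moreover have "(nb y \<inter> G (Suc p)) \<inter> {w \<in> nb y \<inter> R. cl w = Suc p} = {}"
    using Z_iff by (auto simp: G_def R_def)
  ultimately show ?thesis unfolding g_def
    using card_Un_disjoint[of "nb y \<inter> G (Suc p)" "{w \<in> nb y \<inter> R. cl w = Suc p}"] by simp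
qed

text \<open>Downward induction on the level \<open>p\<close>: passing from \<open>p + 1\<close> to \<open>p\<close>, the ground degree of \<open>y\<close> grows by its
  neighbours of class \<open>p + 1\<close>, each of which gives at least \<open>1 - eps (p + 1)\<close> while \<open>y\<close> is unsaturated.\<close>

lemma received_from_above:
  assumes y: "y \<in> R" and Q: "\<And>w. w \<in> R \<Longrightarrow> cl w \<le> Q" and p: "cl y \<le> p" "p \<le> Q"
  shows "min (real (g p y)) (real t + 1) - (\<Sum>q\<in>{p<..Q}. loss q y)
    \<le> real (card (nb y \<inter> X)) + (\<Sum>w\<in>{w \<in> nb y \<inter> R. p < cl w}. down (cl w) w y)"
  using p(2,1)
proof (induction rule: inc_induct)
  case base
  have none: "{w \<in> nb y \<inter> R. Q < cl w} = {}" using Q by (auto simp: not_less)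
  have "R - Z Q = {}" using Q Z_iff by auto
  hence "g Q y = card (nb y \<inter> X)" by (simp only: g_def G_def Un_empty_right)
  thus ?case unfolding none by simp
next
  case (step n)
  define N where "N = {w \<in> nb y \<inter> R. cl w = Suc n}"
  define D where "D = (\<Sum>w\<in>N. down (cl w) w y)"
  define H where "H = (\<Sum>w\<in>{w \<in> nb y \<inter> R. Suc n < cl w}. down (cl w) w y)"
  have "{w \<in> nb y \<inter> R. n < cl w} = {w \<in> nb y \<inter> R. Suc n < cl w} \<union> N" by (auto simp: N_def)
  hence "(\<Sum>w\<in>{w \<in> nb y \<inter> R. n < cl w}. down (cl w) w y) = H + D"
    unfolding H_def D_def by (simp only:) (rule sum.union_disjoint, auto simp: N_def)
  moreover have "{n<..Q} = insert (Suc n) {Suc n<..Q}" using step.hyps by auto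
  hence "(\<Sum>q\<in>{n<..Q}. loss q y) = loss (Suc n) y + (\<Sum>q\<in>{Suc n<..Q}. loss q y)" by simp
  moreover have "min (real (g (Suc n) y)) (real t + 1) - (\<Sum>q\<in>{Suc n<..Q}. loss q y)
      \<le> real (card (nb y \<inter> X)) + H"
    using step by (simp add: H_def)
  \<comment> \<open>Only growth up to the cap \<open>t + 1\<close> has to be paid for. If some
    \<open>w\<close> of class \<open>n + 1\<close> is unsaturated, then it makes an unsaturated
    \<open>y\<close> paired, and the diverted \<open>eps\<close> is booked as \<open>loss\<close>;
    otherwise all neighbours of that class give full weight.\<close>
  moreover have "min (real (g n y)) (real t + 1) - loss (Suc n) y \<le> min (real (g (Suc n) y)) (real t + 1) + D"
  proof -
    have gn: "real (g n y) = real (g (Suc n) y) + real (card N)"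
      using ground_step[OF y, of n] by (simp add: N_def)
    have D0: "0 \<le> D" unfolding D_def by (intro sum_nonneg down_nonneg)
    show ?thesis
    proof (cases "g (Suc n) y \<le> t")
      case False
      hence "loss (Suc n) y = 0" by (simp add: loss_def paired_def)
      thus ?thesis using False D0 by simp
    next
      case unsat: True
      show ?thesis
      proof (cases "\<exists>w\<in>N. g (Suc n) w \<le> t")
        case True
        then obtain w where w: "w \<in> N" "g (Suc n) w \<le> t" by blast
        have "y \<in> Z (Suc n)" "w \<in> nb y \<inter> Z (Suc n)"
          using Z_iff[OF y] step.prems w(1) Z_iff[of w] by (auto simp: N_def)
        hence "paired (Suc n) y" using w(2) unsat by (auto simp: paired_def)
        hence l: "loss (Suc n) y = eps (Suc n) * (real (t - g (Suc n) y) + 1)" by (simp add: loss_def)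
        have "real (card N) * (1 - eps (Suc n)) = (\<Sum>w\<in>N. 1 - eps (Suc n))" by simp
        also have "\<dots> \<le> D"
          unfolding D_def using unsat eps_bounds[of "Suc n"]
          by (intro sum_mono) (auto simp: down_def N_def)
        finally have D: "real (card N) * (1 - eps (Suc n)) \<le> D" .
        define m where "m = min (real (card N)) (real (t - g (Suc n) y) + 1)"
        have m: "min (real (g n y)) (real t + 1) = real (g (Suc n) y) + m"
          using unsat gn by (simp add: m_def of_nat_diff min_def)
        have "m - loss (Suc n) y \<le> m - eps (Suc n) * m"
          unfolding l using eps_bounds by (simp add: m_def mult_left_mono)
        also have "\<dots> = m * (1 - eps (Suc n))" by (simp add: algebra_simps)
        also have "\<dots> \<le> real (card N) * (1 - eps (Suc n))"
          using eps_bounds by (intro mult_right_mono) (auto simp: m_def)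
        finally show ?thesis using D m unsat by simp
      next
        case False
        have "D = (\<Sum>w\<in>N. 1)"
          unfolding D_def using unsat False by (intro sum.cong) (auto simp: down_def N_def)
        hence "D = real (card N)" by simp
        moreover have "0 \<le> loss (Suc n) y" using eps_bounds by (simp add: loss_def)
        ultimately show ?thesis using gn unsat by simp
      qed
    qed
  qed
  ultimately show ?case by linarith
qed

text \<open>Neighbours of higher class precede \<open>y\<close> in the order, so the edges to them
  are judged at the levels of these neighbours. The other neighbours in \<open>R\<close> form
  \<open>nb y \<inter> Z (cl y)\<close>.\<close>

lemma received_decomposition:
  assumes y: "y \<in> R"
  shows "(\<Sum>u\<in>nb y. share y u) = real (card (nb y \<inter> X))
    + (\<Sum>w\<in>{w \<in> nb y \<inter> R. cl y < cl w}. down (cl w) w y) + (\<Sum>u\<in>nb y \<inter> Z (cl y). share y u)"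
proof -
  let ?A = "nb y \<inter> X" and ?B = "{w \<in> nb y \<inter> R. cl y < cl w}" and ?C = "nb y \<inter> Z (cl y)"
  have yT: "y \<notin> T" using y by (simp add: R_def)
  have BR: "w \<notin> X" if "w \<in> R" for w using that by (simp add: R_def)
  have "(\<Sum>u\<in>nb y. share y u) = (\<Sum>u\<in>?A \<union> ?B \<union> ?C. share y u)"
  proof (rule sum.mono_neutral_right)
    show "\<forall>u\<in>nb y - (?A \<union> ?B \<union> ?C). share y u = 0"
      using yT y Z_iff by (auto simp: share_def)
  qed auto
  also have "\<dots> = (\<Sum>u\<in>?A. share y u) + (\<Sum>u\<in>?B. share y u) + (\<Sum>u\<in>?C. share y u)"
  proof -
    have "?A \<inter> ?B = {}" "(?A \<union> ?B) \<inter> ?C = {}"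
      using BR Z_iff Z_subset[of "cl y"] by (auto simp: not_le[symmetric])
    thus ?thesis by (simp add: sum.union_disjoint)
  qed
  also have "(\<Sum>u\<in>?A. share y u) = (\<Sum>u\<in>?A. 1)"
    using y yT by (intro sum.cong) (auto simp: share_def)
  also have "(\<Sum>u\<in>?B. share y u) = (\<Sum>w\<in>?B. down (cl w) w y)"
  proof (rule sum.cong)
    fix w assume w: "w \<in> ?B"
    hence "\<not> \<rho> y < \<rho> w" using cl_mono[OF y, of w] by auto
    thus "share y w = down (cl w) w y" using w y yT BR[of w] by (simp add: share_def)
  qed simp
  finally show ?thesis by simp
qed

text \<open>At its own level \<open>q\<close>, a saturated vertex has reached the cap
  \<open>t + 1\<close>. An unsaturated unpaired one gets full weight from
  \<open>nb y \<inter> Z q\<close>, hence its whole degree up to losses, which exceeds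
  \<open>t\<close> by maximality of \<open>T\<close>. For a paired one, a large shortfall is
  \<open>excess\<close> and a small one is covered by later neighbours. The \<open>-1\<close> is the
  spare unit that absorbs losses.\<close>

lemma received_bound:
  assumes y: "y \<in> R" and Q: "\<And>w. w \<in> R \<Longrightarrow> cl w \<le> Q"
  shows "real t - (\<Sum>u\<in>nb y. share y u) \<le> -1 + (\<Sum>q\<in>{0<..Q}. loss q y) + (\<Sum>q\<le>Q. excess q y)"
proof -
  define q where "q = cl y"
  have qQ: "q \<le> Q" using Q[OF y] by (simp add: q_def)
  have loss0: "0 \<le> loss p y" for p using eps_bounds by (simp add: loss_def)
  have "(\<Sum>p\<in>{q<..Q}. loss p y) \<le> (\<Sum>p\<in>{0<..Q}. loss p y)"
    using loss0 by (intro sum_mono2) auto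
  hence above: "min (real (g q y)) (real t + 1) - (\<Sum>p\<in>{0<..Q}. loss p y)
      \<le> real (card (nb y \<inter> X)) + (\<Sum>w\<in>{w \<in> nb y \<inter> R. q < cl w}. down (cl w) w y)"
    using received_from_above[OF y Q, of q] qQ by (simp add: q_def)
  define C where "C = (\<Sum>u\<in>nb y \<inter> Z q. share y u)"
  have rec: "(\<Sum>u\<in>nb y. share y u) = real (card (nb y \<inter> X))
    + (\<Sum>w\<in>{w \<in> nb y \<inter> R. q < cl w}. down (cl w) w y) + C"
    using received_decomposition[OF y] by (simp add: q_def C_def)
  have C0: "0 \<le> C" unfolding C_def by (intro sum_nonneg share_nonneg)
  have ex0: "0 \<le> excess p y" for p by (simp add: excess_def)
  have exs: "0 \<le> (\<Sum>p\<le>Q. excess p y)" by (intro sum_nonneg ex0)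
  have exq: "excess q y \<le> (\<Sum>p\<le>Q. excess p y)" using qQ ex0 by (intro member_le_sum) auto
  have notin: "y \<notin> T" "y \<notin> X" using y by (auto simp: R_def)
  consider "t < g q y" | "g q y \<le> t" "\<not> paired q y" | "paired q y" "q = 0 \<or> L q \<le> t - g q y"
    | "paired q y" "q \<noteq> 0" "t - g q y < L q"
    by linarith
  thus ?thesis
  proof cases
    case 1
    thus ?thesis using above rec C0 exs by simp
  next
    case 2
    have yZ: "y \<in> Z q" using Z_iff[OF y] by (simp add: q_def)
    hence noT: "nb y \<inter> T = {}" and sat: "\<And>z. z \<in> nb y \<inter> Z q \<Longrightarrow> t < g q z"
      using 2 by (auto simp: paired_def not_le)
    have "share y z = 1" if z: "z \<in> nb y \<inter> Z q" for z
    proof -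
      have zR: "z \<in> R" "z \<notin> X" using z Z_subset by (auto simp: R_def)
      show ?thesis
      proof (cases "\<rho> y < \<rho> z")
        case True
        thus ?thesis using zR y notin 2 sat[OF z] by (simp add: share_def up_def q_def[symmetric])
      next
        case False
        hence "cl y \<le> cl z" using cl_mono[OF zR(1) y] by simp
        moreover have "cl z \<le> q" using z Z_iff[OF zR(1)] by simp
        ultimately have "cl z = q" by (simp add: q_def)
        thus ?thesis using False zR y notin 2 sat[OF z] by (simp add: share_def down_def)
      qed
    qed
    hence C: "C = real (card (nb y \<inter> Z q))" by (simp add: C_def)
    have "nb y = (nb y \<inter> G q) \<union> (nb y \<inter> Z q)" using nb_no_T_subset[OF noT, of q] by blast
    hence "card (nb y) = card ((nb y \<inter> G q) \<union> (nb y \<inter> Z q))" by simp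
    also have "\<dots> = g q y + card (nb y \<inter> Z q)"
      unfolding g_def using G_Z_disjoint[of q] by (intro card_Un_disjoint) auto
    finally have "card (nb y) = g q y + card (nb y \<inter> Z q)" .
    moreover have "card (nb y) \<noteq> t" using T_max[of y] noT notin R_facts[OF y] by blast
    hence "t < card (nb y)" using min_deg[of y] R_facts[OF y] by (simp add: nb_def)
    ultimately have "real t + 1 \<le> real (g q y) + C" using C by simp
    thus ?thesis using above rec 2 exs by simp
  next
    case 3
    hence "g q y \<le> t" by (simp add: paired_def)
    moreover have "excess q y = real (t - g q y) + 1" using 3 by (simp add: excess_def)
    ultimately show ?thesis using above rec C0 exq by (simp add: of_nat_diff)
  next
    case 4
    hence gt: "g q y \<le> t" by (simp add: paired_def)
    let ?later = "{u \<in> nb y \<inter> R. \<rho> y < \<rho> u}"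
    \<comment> \<open>Leastness of the class yields more than \<open>F (q - 1)\<close> later
      neighbours. Each gives at least \<open>eps q\<close>, together at least
      \<open>L q + 2\<close>, while \<open>t - g q y\<close> is below \<open>L q\<close>.\<close>
    have "F (q - 1) < f y" using 4 F_lt_f[of "q - 1" y] by (simp add: q_def)
    hence "real (F (q - 1)) * eps q \<le> real (f y) * eps q"
      using eps_bounds by (intro mult_right_mono) auto
    moreover have "real (F (q - 1)) * eps q = real (L q) + 2" using 4 by (simp add: eps_def F_def)
    ultimately have "real (L q) + 2 \<le> (\<Sum>u\<in>?later. eps q)" by (simp add: f_def)
    also have "\<dots> \<le> (\<Sum>u\<in>?later. share y u)"
    proof (rule sum_mono)
      fix u assume u: "u \<in> ?later"
      hence "share y u = up q y u" using y notin by (auto simp: share_def q_def R_def)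
      thus "eps q \<le> share y u" using gt eps_bounds by (simp add: up_def)
    qed
    also have "\<dots> \<le> C"
      unfolding C_def
    proof (rule sum_mono2)
      show "?later \<subseteq> nb y \<inter> Z q"
        using cl_mono[OF y] Z_iff by (auto simp: q_def)
    qed (auto intro: share_nonneg)
    finally have "real (L q) + 2 \<le> C" .
    thus ?thesis using above rec exs gt 4(3) by (simp add: of_nat_diff)
  qed
qed

end

section \<open>Summation over all levels\<close>

context removal_levels
begin

text \<open>The left side is a quadratic in \<open>p\<close> over
  \<open>F (p - 1) = 2^(p + 29)\<close>. The quadratic stays below \<open>100000 * (3/2)^p\<close>,
  because \<open>302^2 \<le> 100000\<close> and each step multiplies the square by at most
  3/2.\<close>

lemma eps_L_le: "eps p * (real (L p) + 1) \<le> 100000 / 2 ^ 29 * (3/4) ^ p"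
proof (cases "p = 0")
  case False
  have sq: "(10 * real p + 302) ^ 2 \<le> 100000 * (3/2) ^ p" for p :: nat
  proof (induction p)
    case (Suc p)
    have "(10 * real (Suc p) + 302) ^ 2 \<le> 3/2 * (10 * real p + 302) ^ 2"
      by (simp add: power2_eq_square algebra_simps)
    also have "\<dots> \<le> 3/2 * (100000 * (3/2) ^ p)" using Suc by (intro mult_left_mono) auto
    finally show ?case by simp
  qed simp
  have "F (p - 1) = 2 ^ 29 * 2 ^ p" using False by (cases p) (simp_all add: F_def power_add)
  hence "eps p * (real (L p) + 1) = (10 * real p + 302) * (10 * real p + 301) / (2 ^ 29 * 2 ^ p)"
    using False by (simp add: eps_def L_def add.commute)
  also have "\<dots> \<le> (10 * real p + 302) ^ 2 / (2 ^ 29 * 2 ^ p)"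
    by (intro divide_right_mono) (auto simp: power2_eq_square intro!: mult_left_mono)
  also have "\<dots> \<le> (100000 * (3/2) ^ p) / (2 ^ 29 * 2 ^ p)"
    by (intro divide_right_mono sq) auto
  also have "\<dots> = 100000 / 2 ^ 29 * (3/4) ^ p"
  proof -
    have "(3/2 :: real) ^ p / 2 ^ p = (3/4) ^ p" by (simp add: power_divide[symmetric])
    thus ?thesis by (metis times_divide_times_eq)
  qed
  finally show ?thesis .
qed (simp add: eps_def)

text \<open>A loss with shortfall at least \<open>L p\<close> is dominated by \<open>excess\<close>,
  since \<open>eps p \<le> 1\<close>; the others sum to at most \<open>3 * 100000 / 2^29\<close>,
  far below 1.\<close>

lemma sum_loss_le: "(\<Sum>p\<in>{0<..Q}. loss p y) \<le> 1 + (\<Sum>p\<le>Q. excess p y)"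
proof -
  have "(\<Sum>p\<in>{0<..Q}. loss p y) \<le> (\<Sum>p\<in>{0<..Q}. 100000 / 2 ^ 29 * (3/4) ^ p + excess p y)"
  proof (rule sum_mono)
    fix p assume "p \<in> {0<..Q}"
    show "loss p y \<le> 100000 / 2 ^ 29 * (3/4) ^ p + excess p y"
    proof (cases "paired p y \<and> L p \<le> t - g p y")
      case True
      have "eps p * (real (t - g p y) + 1) \<le> 1 * (real (t - g p y) + 1)"
        using eps_bounds by (intro mult_right_mono) auto
      hence "loss p y \<le> excess p y" using True by (simp add: loss_def excess_def)
      thus ?thesis by (rule add_increasing[rotated]) simp
    next
      case False
      have "loss p y \<le> eps p * (real (L p) + 1)"
        using False eps_bounds(1)[of p] by (auto simp: loss_def not_le intro!: mult_left_mono mult_nonneg_nonneg)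
      moreover have "0 \<le> excess p y" by (simp add: excess_def)
      ultimately show ?thesis using eps_L_le[of p] by linarith
    qed
  qed
  also have "\<dots> = 100000 / 2 ^ 29 * (\<Sum>p=1..Q. (3/4) ^ p) + (\<Sum>p\<in>{0<..Q}. excess p y)"
    by (simp only: sum.distrib sum_distrib_left[symmetric] atLeastSucAtMost_greaterThanAtMost[symmetric] One_nat_def)
  also have "\<dots> \<le> 100000 / 2 ^ 29 * ((3/4) ^ 1 / (1 - 3/4)) + (\<Sum>p\<le>Q. excess p y)"
    by (intro add_mono mult_left_mono sum_geom_le sum_mono2) (auto simp: excess_def)
  also have "\<dots> \<le> 1 + (\<Sum>p\<le>Q. excess p y)" by simp
  finally show ?thesis .
qed

text \<open>The cutoff \<open>L p = 10 * (p + 30)\<close> is tuned to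
  \<open>F p ^ 2 = 4^(p + 30)\<close>: the tail factor \<open>((3/4)^10)^(p + 30)\<close> leaves at
  most \<open>(1/2)^(p + 30)\<close>. At \<open>p = 0\<close> there is no cutoff, and
  \<open>F 0 ^ 2 = 2^60\<close> remains.\<close>

lemma sum_excess_le: "(\<Sum>y\<in>R. excess p y) \<le> 1184 * 2 ^ 60 * (1/2) ^ p * M"
proof -
  define c where "c = (if p = 0 then 0 else L p)"
  have "(\<Sum>y\<in>R. excess p y) = (\<Sum>y\<in>{y\<in>Z p. paired p y \<and> c \<le> t - g p y}. excess p y)"
    using Z_subset[of p] by (intro sum.mono_neutral_right) (auto simp: excess_def c_def paired_def)
  also have "\<dots> = (\<Sum>y\<in>{y\<in>Z p. paired p y \<and> c \<le> t - g p y}. real (t - g p y) + 1)"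
    by (intro sum.cong) (auto simp: excess_def c_def split: if_splits)
  also have "\<dots> \<le> 1184 * real (F p) ^ 2 * (3/4) ^ c * M" by (rule sum_paired_large)
  also have "\<dots> \<le> 1184 * (2 ^ 60 * (1/2) ^ p) * M"
  proof (intro mult_right_mono M_nonneg)
    have "real (F p) ^ 2 * (3/4) ^ c \<le> 2 ^ 60 * (1/2) ^ p"
    proof (cases "p = 0")
      case False
      have "real (F p) ^ 2 = 4 ^ (p + 30)" by (simp add: F_def power_mult_distrib[symmetric] power2_eq_square)
      hence "real (F p) ^ 2 * (3/4) ^ c = 4 ^ (p + 30) * ((3/4) ^ 10) ^ (p + 30)"
        using False by (simp only: c_def L_def if_False power_mult)
      also have "\<dots> = (4 * (3/4) ^ 10) ^ (p + 30)" by (rule power_mult_distrib[symmetric])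
      also have "\<dots> \<le> (1/2) ^ (p + 30)" by (intro power_mono) (simp_all add: power_divide)
      also have "\<dots> \<le> (1/2) ^ p" by (intro power_decreasing) auto
      also have "\<dots> \<le> 2 ^ 60 * (1/2) ^ p" by simp
      finally show ?thesis .
    qed (simp add: c_def F_def)
    thus "1184 * real (F p) ^ 2 * (3/4) ^ c \<le> 1184 * (2 ^ 60 * (1/2) ^ p)" by simp
  qed
  finally show ?thesis by (simp only: mult.assoc)
qed

text \<open>\<open>T\<close> receives exactly \<open>t\<close> per vertex and \<open>X\<close>
  nothing, at a cost of \<open>t^2\<close>. Over \<open>R\<close> the shortfall is at most twice the
  total excess, one copy being direct and the other coming from the losses. The constant is
  \<open>2 * 1184 * 2\<close>, with the last 2 from the sum of \<open>(1/2)^p\<close>.\<close>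

lemma deficiency_bound:
  "real t * real (card V) - real (card E) \<le> real t ^ 2 + 4736 * 2 ^ 60 * M"
proof -
  obtain Q where Q: "\<And>w. w \<in> R \<Longrightarrow> cl w \<le> Q"
    using finite_nat_set_iff_bounded_le[of "cl ` R"] by auto
  define rec where "rec = (\<lambda>y. \<Sum>u\<in>nb y. share y u)"
  have rec0: "0 \<le> rec y" for y unfolding rec_def by (intro sum_nonneg share_nonneg)
  have VV: "V = T \<union> X \<union> R" using T_subset nb_subset by (auto simp: R_def X_def)
  have fin: "finite T" "finite X" using T_subset finite_V finite_subset by (auto simp: X_def)
  have dis: "T \<inter> X = {}" "(T \<union> X) \<inter> R = {}" using X_T_disjoint by (auto simp: R_def)
  have sumV: "sum h V = sum h T + sum h X + sum h R" for h :: "'a \<Rightarrow> real"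
    using fin dis by (subst VV) (simp add: sum.union_disjoint)
  have "(\<Sum>u\<in>V. rec u) \<le> real (card E)"
    unfolding rec_def nb_def using finite_V E_subset share_sum_le by (rule sum_edges_le_card)
  hence E: "(\<Sum>u\<in>T. rec u) + (\<Sum>u\<in>R. rec u) \<le> real (card E)"
    using sumV[of rec] sum_nonneg[of X rec] rec0 by simp
  have T: "(\<Sum>u\<in>T. rec u) = real t * real (card T)"
    using T_deg by (simp add: rec_def share_def)
  have cX: "card X = t" using T_deg v0 by (simp add: X_def)
  have cV: "card V = card T + card X + card R"
    using fin dis by (subst VV) (simp add: card_Un_disjoint)
  have "(\<Sum>y\<in>R. real t - rec y) \<le> (\<Sum>y\<in>R. 2 * (\<Sum>p\<le>Q. excess p y))"
  proof (rule sum_mono)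
    fix y assume "y \<in> R"
    thus "real t - rec y \<le> 2 * (\<Sum>p\<le>Q. excess p y)"
      using received_bound[of y Q] Q sum_loss_le[of y Q] unfolding rec_def by fastforce
  qed
  also have "\<dots> = 2 * (\<Sum>p\<le>Q. \<Sum>y\<in>R. excess p y)"
    unfolding sum_distrib_left[symmetric] by (subst sum.swap) simp
  also have "\<dots> \<le> 2 * (\<Sum>p\<le>Q. 1184 * 2 ^ 60 * M * (1/2) ^ p)"
  proof (intro mult_left_mono sum_mono)
    fix p
    show "(\<Sum>y\<in>R. excess p y) \<le> 1184 * 2 ^ 60 * M * (1/2) ^ p"
      using sum_excess_le[of p] by (simp only: mult_ac)
  qed simp
  also have "\<dots> = 2 * (1184 * 2 ^ 60 * M * (\<Sum>p=0..Q. (1/2) ^ p))"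
    by (simp only: sum_distrib_left[symmetric] atLeast0AtMost)
  also have "\<dots> \<le> 2 * (1184 * 2 ^ 60 * M * ((1/2) ^ 0 / (1 - 1/2)))"
    using M_nonneg by (intro mult_left_mono sum_geom_le) auto
  finally have "(\<Sum>y\<in>R. real t - rec y) \<le> 4736 * 2 ^ 60 * M" by simp
  moreover have "(\<Sum>y\<in>R. real t - rec y) = real t * real (card R) - (\<Sum>y\<in>R. rec y)"
    by (simp add: sum_subtractf)
  moreover have "real t * real (card V) = real t * real (card T) + real t ^ 2 + real t * real (card R)"
    using cV cX by (simp add: algebra_simps power2_eq_square)
  ultimately show ?thesis using E T by linarith
qed

end

context clique_saturated
begin

lemma deficiency_le:
  assumes v: "v \<in> V" "card (nb v) = t"
  shows "real t * real (card V) - real (card E) \<le> real t ^ 2 + 4736 * 2 ^ 60 * M"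
proof -
  define S where "S = {T. T \<subseteq> V \<and> (\<forall>x\<in>T. card (nb x) = t) \<and> (\<forall>x\<in>T. \<forall>y\<in>T. y \<notin> nb x)}"
  have "finite S" using finite_V by (auto simp: S_def)
  moreover have "{v} \<in> S" using v nb_irrefl by (auto simp: S_def)
  ultimately obtain T where T: "T \<in> S" "{v} \<subseteq> T" "\<And>T'. T' \<in> S \<Longrightarrow> T \<subseteq> T' \<Longrightarrow> T = T'"
    using finite_has_maximal2[of S "{v}"] by metis
  then obtain v0 where v0: "v0 \<in> T" by blast
  obtain \<rho> :: "'a \<Rightarrow> nat" where "inj_on \<rho> (V - T - nb v0) \<and> (\<forall>y\<in>V - T - nb v0. \<forall>z\<in>V - T - nb v0. \<rho> y \<le> \<rho> z \<longrightarrow>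
      card {u\<in>V - T - nb v0. {z, u} \<in> E \<and> \<rho> y \<le> \<rho> u} \<le> card {u\<in>V - T - nb v0. {y, u} \<in> E \<and> \<rho> y \<le> \<rho> u})"
    using max_degree_removal_order[of "V - T - nb v0" "\<lambda>z u. {z, u} \<in> E"] finite_V by auto
  hence \<rho>: "inj_on \<rho> (V - T - nb v0)" "\<And>y z. y \<in> V - T - nb v0 \<Longrightarrow> z \<in> V - T - nb v0 \<Longrightarrow> \<rho> y \<le> \<rho> z \<Longrightarrow>
      card {u\<in>V - T - nb v0. {z, u} \<in> E \<and> \<rho> y \<le> \<rho> u} \<le> card {u\<in>V - T - nb v0. {y, u} \<in> E \<and> \<rho> y \<le> \<rho> u}"
    by blast+
  interpret removal_levels V E k t T v0 \<rho>
  proof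
    fix w assume w: "w \<in> V" "w \<notin> T" "card (nb w) = t"
    show "nb w \<inter> T \<noteq> {}"
    proof
      assume "nb w \<inter> T = {}"
      hence "insert w T \<in> S" using T(1) w nb_irrefl[of w] nb_sym by (auto simp: S_def)
      thus False using T(3)[of "insert w T"] w(2) by blast
    qed
    next
    show "inj_on \<rho> (V - T - nb v0)" by (rule \<rho>(1))
    show "card {u\<in>V - T - nb v0. {z, u} \<in> E \<and> \<rho> y \<le> \<rho> u} \<le> card {u\<in>V - T - nb v0. {y, u} \<in> E \<and> \<rho> y \<le> \<rho> u}"
      if "y \<in> V - T - nb v0" "z \<in> V - T - nb v0" "\<rho> y \<le> \<rho> z" for y z using that by (rule \<rho>(2))
  qed (use T(1) v0 in \<open>auto simp: S_def\<close>)
  show ?thesis by (rule deficiency_bound)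
qed

end

section \<open>Translation to saturation numbers\<close>

lemma degree_eq_card_neighbours:
  assumes "simple_graph G"
  shows "degree G v = card {u. {v, u} \<in> snd G}"
proof -
  have ne: "u \<noteq> v" if "{v, u} \<in> snd G" for u
  proof -
    have "{v, u} \<in> [fst G]\<^bsup>2\<^esup>" using assms that unfolding simple_graph_def by blast
    thus ?thesis unfolding doubleton_in_nsets_2 by blast
  qed
  have "{e \<in> snd G. v \<in> e} = (\<lambda>u. {v, u}) ` {u. {v, u} \<in> snd G}"
  proof (rule set_eqI)
    fix e
    show "e \<in> {e \<in> snd G. v \<in> e} \<longleftrightarrow> e \<in> (\<lambda>u. {v, u}) ` {u. {v, u} \<in> snd G}"
    proof
      assume e: "e \<in> {e \<in> snd G. v \<in> e}"
      then obtain x y where "e = {x, y}"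
        using assms nsets2_E[of e "fst G"] unfolding simple_graph_def by blast
      thus "e \<in> (\<lambda>u. {v, u}) ` {u. {v, u} \<in> snd G}" using e by (auto simp: insert_commute)
    qed auto
  qed
  moreover have "inj_on (\<lambda>u. {v, u}) {u. {v, u} \<in> snd G}"
    using ne by (auto simp: inj_on_def doubleton_eq_iff)
  ultimately show ?thesis by (simp add: degree_def card_image)
qed

lemma contains_complete_graph_iff:
  "contains_copy G (complete_graph r) \<longleftrightarrow> (\<exists>K\<subseteq>fst G. finite K \<and> card K = r \<and> clique K (snd G))"
proof
  assume "contains_copy G (complete_graph r)"
  then obtain f where f: "inj_on f {..<r}" "f ` {..<r} \<subseteq> fst G" "\<forall>e\<in>[{..<r}]\<^bsup>2\<^esup>. f ` e \<in> snd G"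
    by (auto simp: contains_copy_def complete_graph_def)
  have "clique (f ` {..<r}) (snd G)"
    unfolding clique_def
  proof (intro ballI impI)
    fix u v assume "u \<in> f ` {..<r}" "v \<in> f ` {..<r}" "u \<noteq> v"
    then obtain i j where "u = f i" "v = f j" "{i, j} \<in> [{..<r}]\<^bsup>2\<^esup>" by auto
    thus "{u, v} \<in> snd G" using f(3) by (metis image_empty image_insert)
  qed
  thus "\<exists>K\<subseteq>fst G. finite K \<and> card K = r \<and> clique K (snd G)"
    using f by (intro exI[of _ "f ` {..<r}"]) (auto simp: card_image)
next
  assume "\<exists>K\<subseteq>fst G. finite K \<and> card K = r \<and> clique K (snd G)"
  then obtain K where K: "K \<subseteq> fst G" "finite K" "card K = r" "clique K (snd G)" by blast
  obtain f where f: "bij_betw f {0..<r} K" using ex_bij_betw_nat_finite[OF K(2)] K(3) by blast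
  have "f ` e \<in> snd G" if e: "e \<in> [{..<r}]\<^bsup>2\<^esup>" for e
  proof -
    obtain i j where ij: "e = {i, j}" "i < r" "j < r" "i \<noteq> j" using nsets2_E[OF e] by auto
    hence "f i \<noteq> f j" "f i \<in> K" "f j \<in> K" using f by (auto simp: bij_betw_def inj_on_def)
    thus ?thesis using K(4) ij(1) by (auto simp: clique_def)
  qed
  thus "contains_copy G (complete_graph r)"
    using f K(1) by (auto simp: contains_copy_def complete_graph_def bij_betw_def atLeast0LessThan
        intro!: exI[of _ f])
qed

text \<open>A \<open>(k + 3)\<close>-clique created by a new edge contains both of its ends; without
  them it is the common clique.\<close>

lemma clique_saturated_of_saturated:
  assumes G: "simple_graph G" "fst G \<noteq> {}" "saturated (complete_graph (k + 3)) G" "min_degree G = t"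
    and kt: "k < t"
  shows "clique_saturated (fst G) (snd G) k t" and "\<exists>v\<in>fst G. card {u. {v, u} \<in> snd G} = t"
proof -
  have V: "finite (fst G)" "snd G \<subseteq> [fst G]\<^bsup>2\<^esup>" using G(1) by (auto simp: simple_graph_def)
  have no_clique: "card K \<noteq> k + 3" if "K \<subseteq> fst G" "clique K (snd G)" for K
    using G(3) that V(1) finite_subset unfolding saturated_def contains_complete_graph_iff by blast
  have deg: "t \<le> card {u. {v, u} \<in> snd G}" if "v \<in> fst G" for v
    using that V(1) G(4) by (auto simp: min_degree_def degree_eq_card_neighbours[OF G(1), symmetric])
  show "clique_saturated (fst G) (snd G) k t"
  proof
    show "card K \<le> k + 2" if K: "K \<subseteq> fst G" "clique K (snd G)" for K
    proof (rule ccontr)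
      assume "\<not> card K \<le> k + 2"
      then obtain K' where "K' \<subseteq> K" "card K' = k + 3"
        using obtain_subset_with_card_n[of "k + 3" K] by force
      thus False using no_clique[of K'] K smaller_clique[of K "snd G" K'] by auto
    qed
    show "\<exists>K. clique K (snd G) \<and> card K = k + 1 \<and> (\<forall>w\<in>K. {u, w} \<in> snd G \<and> {v, w} \<in> snd G)"
      if uv: "u \<in> fst G" "v \<in> fst G" "u \<noteq> v" "{u, v} \<notin> snd G" for u v
    proof -
      have "{u, v} \<in> [fst G]\<^bsup>2\<^esup> - snd G" using uv by auto
      hence "contains_copy (fst G, insert {u, v} (snd G)) (complete_graph (k + 3))"
        using G(3) unfolding saturated_def by blast
      then obtain K where K: "K \<subseteq> fst G" "finite K" "card K = k + 3" "clique K (insert {u, v} (snd G))"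
        unfolding contains_complete_graph_iff by auto
      have "\<not> clique K (snd G)" using no_clique K by blast
      hence uvK: "u \<in> K" "v \<in> K"
        using K(4) by (auto simp: clique_def doubleton_eq_iff)
      have edges: "{x, y} \<in> snd G" if "x \<in> K" "y \<in> K" "x \<noteq> y" "{x, y} \<noteq> {u, v}" for x y
        using K(4) that by (auto simp: clique_def)
      show ?thesis
      proof (intro exI conjI ballI)
        show "clique (K - {u, v}) (snd G)"
          unfolding clique_def using edges by (auto simp: doubleton_eq_iff)
        show "card (K - {u, v}) = k + 1"
          using uvK uv(3) K(2,3) by (simp add: card_Diff_subset)
        fix w assume w: "w \<in> K - {u, v}"
        show "{u, w} \<in> snd G" using w uvK by (intro edges) (auto simp: doubleton_eq_iff)
        show "{v, w} \<in> snd G" using w uvK by (intro edges) (auto simp: doubleton_eq_iff)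
      qed
    qed
  qed (use V deg kt in auto)
  have "min_degree G \<in> degree G ` fst G"
    unfolding min_degree_def using V(1) G(2) by (intro Min_in) auto
  thus "\<exists>v\<in>fst G. card {u. {v, u} \<in> snd G} = t"
    using G(4) by (auto simp: degree_eq_card_neighbours[OF G(1)])
qed

lemma deficit_mem_deficits:
  fixes V :: "nat set"
  assumes "clique_saturated V E k t" "v \<in> V" "card {u. {v, u} \<in> E} = t"
  shows "int t * int (card V) - int (card E) \<in> deficits (k + 3) t"
proof -
  interpret clique_saturated V E k t by fact
  define G where "G = (V, E)"
  have VE: "V = fst G" "E = snd G" by (simp_all add: G_def)
  have G: "simple_graph G" using finite_V E_subset VE by (simp add: simple_graph_def)
  have deg: "degree G u = card (nb u)" for u
    using degree_eq_card_neighbours[OF G, of u] by (simp add: nb_def VE(2)[symmetric])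
  have "min_degree G = t"
    unfolding min_degree_def
  proof (rule Min_eqI)
    show "finite (degree G ` fst G)" using finite_V VE by simp
    show "t \<in> degree G ` fst G" using assms(2,3) deg VE by (metis imageI nb_def)
    fix d assume "d \<in> degree G ` fst G"
    then obtain x where "x \<in> V" "d = degree G x" unfolding VE(1)[symmetric] by blast
    thus "t \<le> d" using min_deg[of x] deg[of x] by (simp add: nb_def)
  qed
  moreover have "saturated (complete_graph (k + 3)) G"
    unfolding saturated_def contains_complete_graph_iff
  proof (intro conjI ballI notI)
    assume "\<exists>K\<subseteq>fst G. finite K \<and> card K = k + 3 \<and> clique K (snd G)"
    then obtain K where "K \<subseteq> V" "card K = k + 3" "clique K E" unfolding VE(1,2)[symmetric] by blast
    thus False using clique_le[of K] by simp
  next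
    fix e assume e: "e \<in> [fst G]\<^bsup>2\<^esup> - snd G"
    then obtain u v where uv: "e = {u, v}" "u \<in> V" "v \<in> V" "u \<noteq> v" "{u, v} \<notin> E"
      unfolding VE(1,2)[symmetric] using nsets2_E[of e V] by blast
    obtain K where K: "clique K E" "card K = k + 1" "\<forall>w\<in>K. {u, w} \<in> E \<and> {v, w} \<in> E"
      using common_clique[OF uv(2-5)] by blast
    have KV: "K \<subseteq> V" "u \<notin> K" "v \<notin> K" using K(3) edgeD edgeD[of u u] edgeD[of v v] by auto
    have fK: "finite K" using KV(1) finite_V finite_subset by blast
    define K' where "K' = insert u (insert v K)"
    have "clique K' (insert e E)"
      using K uv(1) by (auto simp: K'_def clique_def insert_commute)
    moreover have "K' \<subseteq> V" "finite K'" "card K' = k + 3"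
      using K(2) KV fK uv(2-4) by (simp_all add: K'_def)
    ultimately show "\<exists>K\<subseteq>fst (fst G, insert e (snd G)). finite K \<and> card K = k + 3 \<and> clique K (snd (fst G, insert e (snd G)))"
      unfolding VE fst_conv snd_conv by blast
  qed
  ultimately show ?thesis
    unfolding deficits_def using G VE assms(2) by (intro CollectI exI[of _ G]) auto
qed

section \<open>Two-sided estimates of the central binomial coefficient\<close>

lemma central_binomial_Suc:
  "(real s + 1) * real ((2 * Suc s) choose Suc s) = 2 * (2 * real s + 1) * real ((2 * s) choose s)"
proof -
  have "2 * Suc s = Suc (Suc (2 * s))" by simp
  hence "Suc s * ((2 * Suc s) choose Suc s) = Suc (Suc (2 * s)) * (Suc (2 * s) choose s)"
    using Suc_times_binomial_eq[of "Suc (2 * s)" s] by (metis mult.commute)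
  also have "\<dots> = Suc s * (2 * (Suc (2 * s) choose s))" by (simp only: mult_Suc mult_Suc_right)
  finally have "(2 * Suc s) choose Suc s = 2 * (Suc (2 * s) choose s)"
    using nat_mult_eq_cancel1[of "Suc s"] by blast
  moreover have "Suc s * (Suc (2 * s) choose s) = Suc (2 * s) * ((2 * s) choose s)"
    using Suc_times_binomial_eq[of "2 * s" s] binomial_symmetric[of "Suc s" "Suc (2 * s)"]
    by (simp add: mult.commute del: binomial_Suc_Suc)
  ultimately have "Suc s * ((2 * Suc s) choose Suc s) = 2 * (Suc (2 * s) * ((2 * s) choose s))"
    by (simp only: mult.left_commute)
  hence "real (Suc s * ((2 * Suc s) choose Suc s)) = real (2 * (Suc (2 * s) * ((2 * s) choose s)))"
    by (simp only:)
  thus ?thesis by (simp add: algebra_simps del: binomial_Suc_Suc mult_Suc mult_Suc_right)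
qed

text \<open>Squaring avoids roots; the induction step reduces to
  \<open>(2 * s + 1) * (2 * s + 3) \<le> 4 * (s + 1)^2\<close>.\<close>

lemma central_binomial_sq_upper: "real ((2 * s) choose s) ^ 2 * (2 * real s + 1) \<le> 16 ^ s"
proof (induction s)
  case (Suc s)
  define c where "c = real ((2 * s) choose s)"
  define d where "d = real ((2 * Suc s) choose Suc s)"
  have step: "(real s + 1) * d = 2 * (2 * real s + 1) * c"
    unfolding c_def d_def by (rule central_binomial_Suc)
  have "(real s + 1) ^ 2 * (d ^ 2 * (2 * real (Suc s) + 1)) = ((real s + 1) * d) ^ 2 * (2 * real s + 3)"
    by (simp add: power2_eq_square algebra_simps)
  also have "\<dots> = 4 * (2 * real s + 1) * (2 * real s + 3) * (c ^ 2 * (2 * real s + 1))"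
    unfolding step by (simp add: power2_eq_square algebra_simps)
  also have "\<dots> \<le> 16 * (real s + 1) ^ 2 * 16 ^ s"
  proof (rule mult_mono)
    show "4 * (2 * real s + 1) * (2 * real s + 3) \<le> 16 * (real s + 1) ^ 2"
      by (simp add: power2_eq_square algebra_simps)
  qed (use Suc in \<open>auto simp: c_def\<close>)
  finally have "(real s + 1) ^ 2 * (d ^ 2 * (2 * real (Suc s) + 1)) \<le> (real s + 1) ^ 2 * 16 ^ Suc s"
    by (simp add: mult_ac)
  moreover have "0 < (real s + 1) ^ 2" by simp
  ultimately show ?case unfolding d_def[symmetric] by (simp only: mult_le_cancel_left_pos)
qed simp

text \<open>Equality at \<open>s = 1\<close>; the step reduces to
  \<open>4 * s * (s + 1) \<le> (2 * s + 1)^2\<close>.\<close>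

lemma central_binomial_sq_lower:
  assumes "s \<ge> 1"
  shows "16 ^ s \<le> real ((2 * s) choose s) ^ 2 * (4 * real s)"
  using assms
proof (induction s rule: dec_induct)
  case (step s)
  define c where "c = real ((2 * s) choose s)"
  define d where "d = real ((2 * Suc s) choose Suc s)"
  have step': "(real s + 1) * d = 2 * (2 * real s + 1) * c"
    unfolding c_def d_def by (rule central_binomial_Suc)
  have s: "0 < real s * (real s + 1)" using step by simp
  have "(real s * (real s + 1)) * 16 ^ Suc s = 16 * (real s * (real s + 1)) * 16 ^ s" by simp
  also have "\<dots> \<le> 4 * (2 * real s + 1) ^ 2 * (c ^ 2 * (4 * real s))"
  proof (rule mult_mono)
    show "16 * (real s * (real s + 1)) \<le> 4 * (2 * real s + 1) ^ 2"
      by (simp add: power2_eq_square algebra_simps)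
  qed (use step in \<open>auto simp: c_def\<close>)
  also have "\<dots> = ((real s + 1) * d) ^ 2 * (4 * real s)"
    unfolding step' by (simp add: power2_eq_square algebra_simps)
  also have "\<dots> = (real s * (real s + 1)) * (d ^ 2 * (4 * real (Suc s)))"
    by (simp add: power2_eq_square algebra_simps)
  finally show ?case using s unfolding d_def[symmetric] by (simp only: mult_le_cancel_left_pos)
qed simp

section \<open>Constructions with large deficiency\<close>

text \<open>The new vertex extends every old clique and every common clique, so \<open>k\<close> and
  \<open>t\<close> rise by 1 and the deficiency grows by \<open>t + 1\<close>. The assumption
  \<open>big\<close> gives the new vertex itself degree at least \<open>t + 1\<close>.\<close>

lemma clique_saturated_cone:
  fixes V :: "'a set"
  assumes "clique_saturated V E k t" and w: "w \<notin> V" and big: "t + 1 \<le> card V"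
    and v: "v \<in> V" "card {u. {v, u} \<in> E} = t"
  defines "V' \<equiv> insert w V" and "E' \<equiv> E \<union> (\<lambda>u. {w, u}) ` V"
  shows "clique_saturated V' E' (k + 1) (t + 1)" and "card {u. {v, u} \<in> E'} = t + 1"
    and "card V' = card V + 1" and "card E' = card E + card V"
proof -
  interpret clique_saturated V E k t by fact
  have edge: "{x, y} \<in> E' \<longleftrightarrow> {x, y} \<in> E \<or> (x = w \<and> y \<in> V) \<or> (y = w \<and> x \<in> V)" for x y
    by (auto simp: E'_def doubleton_eq_iff)
  have nbV: "{u. {x, u} \<in> E'} = insert w {u. {x, u} \<in> E}" if "x \<in> V" for x
    using that w edgeD by (auto simp: edge)
  have cnb: "card {u. {x, u} \<in> E'} = card {u. {x, u} \<in> E} + 1" if "x \<in> V" for x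
  proof -
    have "w \<notin> {u. {x, u} \<in> E}" "finite {u. {x, u} \<in> E}"
      using w edgeD finite_nb[of x] by (auto simp: nb_def)
    thus ?thesis using nbV[OF that] by simp
  qed
  have nbw: "{u. {w, u} \<in> E'} = V" using w edgeD by (auto simp: edge)
  show "card {u. {v, u} \<in> E'} = t + 1" using cnb[OF v(1)] v(2) by simp
  show "card V' = card V + 1" using w finite_V by (simp add: V'_def)
  have "E \<inter> (\<lambda>u. {w, u}) ` V = {}" using edgeD w by auto
  moreover have "inj_on (\<lambda>u. {w, u}) V" using w by (auto simp: inj_on_def doubleton_eq_iff)
  moreover have "finite E" using finite_V E_subset by (meson finite_imp_finite_nsets finite_subset)
  ultimately show "card E' = card E + card V"
    using finite_V by (simp add: E'_def card_Un_disjoint card_image)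
  show "clique_saturated V' E' (k + 1) (t + 1)"
  proof
    show "finite V'" using finite_V by (simp add: V'_def)
    have "[V]\<^bsup>2\<^esup> \<subseteq> [V']\<^bsup>2\<^esup>" by (rule nsets_mono) (auto simp: V'_def)
    moreover have "{w, u} \<in> [V']\<^bsup>2\<^esup>" if "u \<in> V" for u using that w by (auto simp: V'_def)
    ultimately show "E' \<subseteq> [V']\<^bsup>2\<^esup>" using E_subset by (auto simp: E'_def)
    show "card K \<le> k + 1 + 2" if K: "K \<subseteq> V'" "clique K E'" for K
    proof -
      have "clique (K - {w}) E" using K by (auto simp: clique_def edge)
      hence "card (K - {w}) \<le> k + 2" using K(1) by (intro clique_le) (auto simp: V'_def)
      moreover have "card K \<le> card (K - {w}) + 1" by (simp add: card_Diff_singleton_if, arith)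
      ultimately show ?thesis by simp
    qed
    show "\<exists>K. clique K E' \<and> card K = k + 1 + 1 \<and> (\<forall>z\<in>K. {x, z} \<in> E' \<and> {y, z} \<in> E')"
      if xy: "x \<in> V'" "y \<in> V'" "x \<noteq> y" "{x, y} \<notin> E'" for x y
    proof -
      have V: "x \<in> V" "y \<in> V" "{x, y} \<notin> E" using xy w by (auto simp: V'_def edge)
      obtain K where K: "clique K E" "card K = k + 1" "\<forall>z\<in>K. {x, z} \<in> E \<and> {y, z} \<in> E"
        using common_clique[OF V(1,2) xy(3) V(3)] by blast
      have KV: "K \<subseteq> V" using K(3) edgeD by blast
      hence "w \<notin> K" "finite K" using w finite_V finite_subset by auto
      thus ?thesis using K KV V by (intro exI[of _ "insert w K"]) (auto simp: clique_def edge)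
    qed
    show "t + 1 \<le> card {u. {x, u} \<in> E'}" if "x \<in> V'" for x
      using that cnb[of x] min_deg[of x] nbw big by (auto simp: V'_def)
    show "k + 1 < t + 1" using kt by simp
  qed
qed

text \<open>\<open>deficits\<close> ranges over graphs on natural numbers, while the half-subset
  graph lives on a sum type.\<close>

lemma clique_saturated_image:
  fixes h :: "'a \<Rightarrow> 'b"
  assumes "clique_saturated V E k t" and h: "inj_on h V"
  defines "E' \<equiv> image h ` E"
  shows "clique_saturated (h ` V) E' k t"
    and "\<And>v. v \<in> V \<Longrightarrow> card {u. {h v, u} \<in> E'} = card {u. {v, u} \<in> E}"
    and "card (h ` V) = card V" and "card E' = card E"
proof -
  interpret clique_saturated V E k t by fact
  have EV: "E \<subseteq> Pow V" using E_subset by (auto simp: nsets_def)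
  have injP: "inj_on (image h) (Pow V)" using h by (rule inj_on_image_Pow)
  show "card E' = card E" unfolding E'_def using injP EV by (intro card_image) (rule inj_on_subset)
  show "card (h ` V) = card V" using h by (rule card_image)
  have edge: "{h x, h y} \<in> E' \<longleftrightarrow> {x, y} \<in> E" if "x \<in> V" "y \<in> V" for x y
  proof
    assume "{h x, h y} \<in> E'"
    then obtain e where e: "e \<in> E" "h ` {x, y} = h ` e" by (auto simp: E'_def)
    hence "{x, y} = e" using inj_onD[OF injP, of "{x, y}" e] EV that by auto
    thus "{x, y} \<in> E" using e by simp
  next
    assume "{x, y} \<in> E"
    hence "h ` {x, y} \<in> E'" unfolding E'_def by blast
    thus "{h x, h y} \<in> E'" by simp
  qed
  have E'sub: "E' \<subseteq> [h ` V]\<^bsup>2\<^esup>"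
  proof
    fix e assume "e \<in> E'"
    then obtain e0 where e0: "e0 \<in> E" "e = h ` e0" by (auto simp: E'_def)
    then obtain x y where "e0 = {x, y}" "x \<in> V" "y \<in> V" "x \<noteq> y"
      using E_subset nsets2_E[of e0 V] by blast
    thus "e \<in> [h ` V]\<^bsup>2\<^esup>" using e0 h by (auto simp: inj_on_eq_iff)
  qed
  have nbh: "{u. {h v, u} \<in> E'} = h ` {u. {v, u} \<in> E}" if v: "v \<in> V" for v
  proof
    show "{u. {h v, u} \<in> E'} \<subseteq> h ` {u. {v, u} \<in> E}"
    proof
      fix u assume u: "u \<in> {u. {h v, u} \<in> E'}"
      hence "{h v, u} \<in> [h ` V]\<^bsup>2\<^esup>" using E'sub by blast
      hence "u \<in> h ` V" unfolding doubleton_in_nsets_2 by blast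
      then obtain z where z: "z \<in> V" "u = h z" by blast
      thus "u \<in> h ` {u. {v, u} \<in> E}" using u edge[OF v z(1)] by simp
    qed
    show "h ` {u. {v, u} \<in> E} \<subseteq> {u. {h v, u} \<in> E'}"
      using edge[OF v] edgeD by blast
  qed
  show cnb: "card {u. {h v, u} \<in> E'} = card {u. {v, u} \<in> E}" if v: "v \<in> V" for v
  proof -
    have "inj_on h {u. {v, u} \<in> E}" using h by (rule inj_on_subset) (use edgeD in blast)
    thus ?thesis using nbh[OF v] by (simp add: card_image)
  qed
  have clique_iff: "clique (h ` K) E' \<longleftrightarrow> clique K E" if K: "K \<subseteq> V" for K
  proof -
    have "h x \<noteq> h y \<longleftrightarrow> x \<noteq> y" "{h x, h y} \<in> E' \<longleftrightarrow> {x, y} \<in> E" if "x \<in> K" "y \<in> K" for x y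
    proof -
      have V: "x \<in> V" "y \<in> V" using that K by auto
      show "h x \<noteq> h y \<longleftrightarrow> x \<noteq> y" using inj_on_eq_iff[OF h V] by simp
      show "{h x, h y} \<in> E' \<longleftrightarrow> {x, y} \<in> E" using edge[OF V] .
    qed
    thus ?thesis unfolding clique_def by auto
  qed
  show "clique_saturated (h ` V) E' k t"
  proof
    show "finite (h ` V)" using finite_V by simp
    show "E' \<subseteq> [h ` V]\<^bsup>2\<^esup>" by (rule E'sub)
    show "card K \<le> k + 2" if K: "K \<subseteq> h ` V" "clique K E'" for K
    proof -
      obtain K0 where K0: "K0 \<subseteq> V" "K = h ` K0" using K(1) by (metis subset_image_iff)
      hence "card K = card K0" using h by (metis card_image inj_on_subset)
      thus ?thesis using clique_le[of K0] clique_iff[of K0] K0 K(2) by simp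
    qed
    show "\<exists>K. clique K E' \<and> card K = k + 1 \<and> (\<forall>z\<in>K. {x, z} \<in> E' \<and> {y, z} \<in> E')"
      if xy: "x \<in> h ` V" "y \<in> h ` V" "x \<noteq> y" "{x, y} \<notin> E'" for x y
    proof -
      obtain x0 y0 where 0: "x = h x0" "y = h y0" "x0 \<in> V" "y0 \<in> V" using xy by blast
      obtain K where K: "clique K E" "card K = k + 1" "\<forall>z\<in>K. {x0, z} \<in> E \<and> {y0, z} \<in> E"
        using common_clique[of x0 y0] 0 xy edge[of x0 y0] by auto
      have KV: "K \<subseteq> V" using K(3) edgeD by blast
      have "card (h ` K) = k + 1" using K(2) KV h by (metis card_image inj_on_subset)
      thus ?thesis using K 0 KV clique_iff[OF KV] edge
        by (intro exI[of _ "h ` K"]) (auto dest: subsetD)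
    qed
    show "t \<le> card {u. {x, u} \<in> E'}" if "x \<in> h ` V" for x
      using that cnb min_deg by auto
    show "k < t" by (rule kt)
  qed
qed

lemma clique_saturated_triangle_free:
  assumes "finite V" "E \<subseteq> [V]\<^bsup>2\<^esup>" "0 < t"
    and tri: "\<And>x y z. {x, y} \<in> E \<Longrightarrow> {y, z} \<in> E \<Longrightarrow> {x, z} \<notin> E"
    and common: "\<And>u v. u \<in> V \<Longrightarrow> v \<in> V \<Longrightarrow> u \<noteq> v \<Longrightarrow> {u, v} \<notin> E \<Longrightarrow> \<exists>w. {u, w} \<in> E \<and> {v, w} \<in> E"
    and deg: "\<And>v. v \<in> V \<Longrightarrow> t \<le> card {u. {v, u} \<in> E}"
  shows "clique_saturated V E 0 t"
proof
  show "card K \<le> 0 + 2" if K: "clique K E" for K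
  proof (rule ccontr)
    assume "\<not> card K \<le> 0 + 2"
    then obtain K' where K': "K' \<subseteq> K" "card K' = 3"
      using obtain_subset_with_card_n[of 3 K] by force
    then obtain x y z where "K' = {x, y, z}" "x \<noteq> y" "y \<noteq> z" "x \<noteq> z" by (auto simp: card_3_iff)
    thus False using K K'(1) tri[of x y z] by (simp add: clique_def)
  qed
  show "\<exists>K. clique K E \<and> card K = 0 + 1 \<and> (\<forall>w\<in>K. {u, w} \<in> E \<and> {v, w} \<in> E)"
    if uv: "u \<in> V" "v \<in> V" "u \<noteq> v" "{u, v} \<notin> E" for u v
  proof -
    obtain w where "{u, w} \<in> E \<and> {v, w} \<in> E" using common[OF uv] by blast
    thus ?thesis by (intro exI[of _ "{w}"]) (simp add: clique_def)
  qed
qed (use assms(1-3) deg in auto)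

text \<open>\<open>K_{t,t}\<close> has deficiency \<open>t^2\<close>. It serves for
  \<open>t \<le> 2\<close>, where the half-subset graph fails: for \<open>m = 1\<close> its points
  have degree 1 instead of 2.\<close>

lemma complete_bipartite_saturated:
  fixes t :: nat
  assumes "0 < t"
  defines "V \<equiv> {..<2 * t}" and "E \<equiv> (\<lambda>(i, j). {i, j}) ` ({..<t} \<times> {t..<2 * t})"
  shows "clique_saturated V E 0 t" and "card {u. {0, u} \<in> E} = t" and "card E = t * t"
proof -
  have edge: "{i, j} \<in> E \<longleftrightarrow> (i < t \<and> t \<le> j \<and> j < 2 * t) \<or> (j < t \<and> t \<le> i \<and> i < 2 * t)" for i j
    by (auto simp: E_def doubleton_eq_iff image_iff)
  have nb: "{u. {v, u} \<in> E} = (if v < t then {t..<2 * t} else {..<t})" if "v < 2 * t" for v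
    using that by (auto simp: edge)
  show "card {u. {0, u} \<in> E} = t" using nb[of 0] assms(1) by simp
  have "inj_on (\<lambda>(i, j). {i, j}) ({..<t} \<times> {t..<2 * t})"
    by (auto simp: inj_on_def doubleton_eq_iff)
  thus "card E = t * t" by (simp add: E_def card_image)
  show "clique_saturated V E 0 t"
  proof (rule clique_saturated_triangle_free)
    show "E \<subseteq> [V]\<^bsup>2\<^esup>" by (auto simp: E_def V_def)
    show "\<exists>w. {u, w} \<in> E \<and> {v, w} \<in> E" if "u \<in> V" "v \<in> V" "u \<noteq> v" "{u, v} \<notin> E" for u v
    proof (cases "u < t")
      case True
      thus ?thesis using that by (intro exI[of _ t]) (auto simp: edge V_def)
    next
      case False
      thus ?thesis using that by (intro exI[of _ 0]) (auto simp: edge V_def)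
    qed
    show "t \<le> card {u. {v, u} \<in> E}" if "v \<in> V" for v
      using that nb[of v] by (auto simp: V_def)
  qed (use assms(1) in \<open>auto simp: edge V_def\<close>)
qed

lemma card_half_subsets_containing:
  assumes "u < 2 * m"
  shows "2 * card {S. S \<subseteq> {..<2 * m} \<and> card S = m \<and> u \<in> S} = (2 * m) choose m"
proof -
  define U where "U = {..<2 * m}"
  define P where "P = {S. S \<subseteq> U \<and> card S = m}"
  have fin: "finite P" "finite U" by (auto simp: P_def U_def)
  have compl: "U - S \<in> P" "U - (U - S) = S" if "S \<in> P" for S
    using that by (auto simp: P_def U_def card_Diff_subset finite_subset[OF _ fin(2)])
  have u: "u \<in> U" using assms by (simp add: U_def)
  have "bij_betw (\<lambda>S. U - S) {S \<in> P. u \<in> S} {S \<in> P. u \<notin> S}"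
    using compl u by (intro bij_betwI[of _ _ _ "\<lambda>S. U - S"]) auto
  hence "card {S \<in> P. u \<in> S} = card {S \<in> P. u \<notin> S}" by (rule bij_betw_same_card)
  moreover have "card {S \<in> P. u \<in> S} + card {S \<in> P. u \<notin> S} = card P"
    using fin by (subst card_Un_disjoint[symmetric]) (auto intro!: arg_cong[of _ _ card])
  moreover have "card P = (2 * m) choose m" using n_subsets[of U m] by (simp add: P_def U_def)
  ultimately have "2 * card {S \<in> P. u \<in> S} = (2 * m) choose m" by simp
  moreover have "{S \<in> P. u \<in> S} = {S. S \<subseteq> {..<2 * m} \<and> card S = m \<and> u \<in> S}"
    by (auto simp: P_def U_def)
  ultimately show ?thesis by simp
qed

text \<open>Each point of the half-subset graph lies in half of the \<open>m\<close>-subsets, so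
  this gives it degree at least \<open>m + 1\<close>. At \<open>m = 2\<close> it is the equality
  \<open>6 = 6\<close>, and the coefficient at least doubles at each step.\<close>

lemma central_binomial_ge_linear:
  assumes "m \<ge> 2"
  shows "2 * m + 2 \<le> (2 * m) choose m"
  using assms
proof (induction m rule: dec_induct)
  case (step s)
  define c where "c = real ((2 * s) choose s)"
  define d where "d = real ((2 * Suc s) choose Suc s)"
  have c: "c \<ge> 2 * real s + 2" using step.IH unfolding c_def by linarith
  have "(real s + 1) * (2 * c) \<le> 2 * (2 * real s + 1) * c"
    using c by (simp add: algebra_simps)
  also have "\<dots> = (real s + 1) * d" unfolding c_def d_def by (rule central_binomial_Suc[symmetric])
  finally have "2 * c \<le> d" by (simp only: mult_le_cancel_left_pos)
  hence "real (2 * Suc s + 2) \<le> d" using c by simp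
  thus ?case unfolding d_def of_nat_le_iff .
qed (simp add: numeral_eq_Suc)

text \<open>No triangles: points are independent, a set sees no other set but its complement, and
  these two share no point. Common neighbours: two points lie in a common half-subset as
  \<open>m \<ge> 2\<close>; a point and a set missing it both see the complement of the set; two
  half-subsets that are not complementary meet, each having half the size of
  \<open>U\<close>.\<close>

lemma half_subsets_saturated:
  fixes m :: nat
  assumes m: "m \<ge> 2"
  defines "U \<equiv> {..<2 * m}"
  defines "P \<equiv> {S. S \<subseteq> U \<and> card S = m}"
  defines "V \<equiv> Inl ` U \<union> Inr ` P"
    and "E \<equiv> {{Inl u, Inr S} | u S. S \<in> P \<and> u \<in> S} \<union> {{Inr S, Inr (U - S)} | S. S \<in> P}"
  shows "clique_saturated V E 0 (m + 1)" and "Inr {..<m} \<in> V" and "card {u. {Inr {..<m}, u} \<in> E} = m + 1"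
    and "card V = 2 * m + ((2 * m) choose m)" and "2 * card E \<le> (2 * m + 1) * ((2 * m) choose m)"
proof -
  have fin: "finite P" "finite U" by (auto simp: P_def U_def)
  have finS: "finite S" if "S \<in> P" for S using that fin(2) finite_subset by (auto simp: P_def)
  have compl: "U - S \<in> P" "U - (U - S) = S" "S \<noteq> U - S" "S \<subseteq> U" "card S = m" if "S \<in> P" for S
  proof -
    show "U - S \<in> P" "U - (U - S) = S" "S \<subseteq> U" "card S = m"
      using that by (auto simp: P_def U_def card_Diff_subset finite_subset[OF _ fin(2)])
    have "S \<noteq> {}" using that m by (auto simp: P_def)
    thus "S \<noteq> U - S" by blast
  qed
  have cardP: "card P = (2 * m) choose m" using n_subsets[of U m] by (simp add: P_def U_def)
  have LL: "{Inl u, Inl v} \<notin> E" for u v by (auto simp: E_def doubleton_eq_iff)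
  have LR: "{Inl u, Inr S} \<in> E \<longleftrightarrow> S \<in> P \<and> u \<in> S" for u S by (auto simp: E_def doubleton_eq_iff)
  have RL: "{Inr S, Inl u} \<in> E \<longleftrightarrow> S \<in> P \<and> u \<in> S" for u S
    using LR[of u S] by (simp add: insert_commute)
  have RR: "{Inr S, Inr T} \<in> E \<longleftrightarrow> S \<in> P \<and> T = U - S" for S T
    using compl(1,2) by (auto simp: E_def doubleton_eq_iff)
  have single: "{Inr T} \<notin> E" for T using RR[of T T] compl(3)[of T] by auto
  note edge = LL LR RL RR single
  have half: "2 * card {S \<in> P. u \<in> S} = (2 * m) choose m" if "u < 2 * m" for u
  proof -
    have "{S \<in> P. u \<in> S} = {S. S \<subseteq> {..<2 * m} \<and> card S = m \<and> u \<in> S}" by (auto simp: P_def U_def)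
    thus ?thesis using card_half_subsets_containing[OF that] by simp
  qed
  have nbR: "card {u. {Inr S, u} \<in> E} = m + 1" if S: "S \<in> P" for S
  proof -
    have "{u. {Inr S, u} \<in> E} = insert (Inr (U - S)) (Inl ` S)"
    proof (rule set_eqI)
      fix x :: "nat + nat set"
      show "x \<in> {u. {Inr S, u} \<in> E} \<longleftrightarrow> x \<in> insert (Inr (U - S)) (Inl ` S)"
        using S by (cases x) (auto simp: edge)
    qed
    moreover have "card (insert (Inr (U - S)) (Inl ` S :: (nat + nat set) set)) = Suc (card S)"
      using finS[OF S] by (subst card_insert_disjoint) (auto simp: card_image)
    ultimately show ?thesis using compl(5)[OF S] by simp
  qed
  have nbL: "m + 1 \<le> card {u. {Inl v, u} \<in> E}" if v: "v < 2 * m" for v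
  proof -
    have "{u. {Inl v, u} \<in> E} = Inr ` {S \<in> P. v \<in> S}"
    proof (rule set_eqI)
      fix x :: "nat + nat set"
      show "x \<in> {u. {Inl v, u} \<in> E} \<longleftrightarrow> x \<in> Inr ` {S \<in> P. v \<in> S}"
        by (cases x) (auto simp: edge)
    qed
    hence "card {u. {Inl v, u} \<in> E} = card {S \<in> P. v \<in> S}" by (simp add: card_image)
    thus ?thesis using half[OF v] central_binomial_ge_linear[OF m] by linarith
  qed
  have S0: "{..<m} \<in> P" by (auto simp: P_def U_def)
  show "Inr {..<m} \<in> V" using S0 by (simp add: V_def)
  show "card {u. {Inr {..<m}, u} \<in> E} = m + 1" using nbR[OF S0] .
  have "card V = card (Inl ` U :: (nat + nat set) set) + card (Inr ` P :: (nat + nat set) set)"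
    unfolding V_def using fin by (intro card_Un_disjoint) auto
  thus "card V = 2 * m + ((2 * m) choose m)" using cardP by (simp add: card_image U_def)
  show "2 * card E \<le> (2 * m + 1) * ((2 * m) choose m)"
  proof -
    define E1 where "E1 = {{Inl u, Inr S :: nat + nat set} | u S. S \<in> P \<and> u \<in> S}"
    define E2 where "E2 = {{Inr S :: nat + nat set, Inr (U - S)} | S. S \<in> P}"
    have "E1 \<subseteq> (\<lambda>(S, u). {Inl u, Inr S}) ` (SIGMA S:P. S)" by (force simp: E1_def)
    hence "card E1 \<le> card (SIGMA S:P. S)"
      using fin finS by (intro surj_card_le) auto
    also have "\<dots> = m * card P" using fin finS compl(5) by (simp add: card_SigmaI)
    finally have E1: "card E1 \<le> m * card P" .
    have "E2 \<subseteq> (\<lambda>S. {Inr S, Inr (U - S)}) ` {S \<in> P. 0 \<in> S}"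
    proof
      fix e assume "e \<in> E2"
      then obtain S where S: "S \<in> P" "e = {Inr S, Inr (U - S)}" by (auto simp: E2_def)
      have "0 \<in> U" using m by (simp add: U_def)
      hence "0 \<in> S \<or> 0 \<in> U - S" by blast
      thus "e \<in> (\<lambda>S. {Inr S, Inr (U - S)}) ` {S \<in> P. 0 \<in> S}"
      proof
        assume "0 \<in> U - S"
        thus ?thesis using S compl(1,2)[OF S(1)] by (intro image_eqI[of _ _ "U - S"]) auto
      qed (use S in auto)
    qed
    hence "card E2 \<le> card {S \<in> P. 0 \<in> S}" using fin by (intro surj_card_le) auto
    hence "2 * card E2 \<le> card P" using half[of 0] m cardP by linarith
    moreover have "card E \<le> card E1 + card E2"
      unfolding E_def E1_def[symmetric] E2_def[symmetric] by (rule card_Un_le)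
    ultimately have "2 * card E \<le> 2 * (m * card P) + card P" using E1 by linarith
    thus ?thesis unfolding cardP by (simp add: algebra_simps)
  qed
  show "clique_saturated V E 0 (m + 1)"
  proof (rule clique_saturated_triangle_free)
    show "finite V" using fin by (simp add: V_def)
    show "E \<subseteq> [V]\<^bsup>2\<^esup>"
    proof
      fix e assume "e \<in> E"
      then consider u S where "S \<in> P" "u \<in> S" "e = {Inl u, Inr S}" | S where "S \<in> P" "e = {Inr S, Inr (U - S)}"
        by (auto simp: E_def)
      thus "e \<in> [V]\<^bsup>2\<^esup>"
      proof cases
        case 1
        hence "u \<in> U" using compl(4) by blast
        thus ?thesis using 1 by (simp add: V_def)
      next
        case 2
        thus ?thesis using compl(1,3)[OF 2(1)] by (simp add: V_def)
      qed
    qed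
    show "{x, z} \<notin> E" if xyz: "{x, y} \<in> E" "{y, z} \<in> E" for x y z
    proof
      assume "{x, z} \<in> E"
      thus False using xyz compl by (cases x; cases y; cases z) (auto simp: edge)
    qed
    show "\<exists>w. {x, w} \<in> E \<and> {y, w} \<in> E" if xy: "x \<in> V" "y \<in> V" "x \<noteq> y" "{x, y} \<notin> E" for x y
    proof -
      have LRc: "\<exists>w. {Inl u, w} \<in> E \<and> {Inr S, w} \<in> E" if "u \<in> U" "S \<in> P" "u \<notin> S" for u S
        using that compl(1)[of S] by (intro exI[of _ "Inr (U - S)"]) (simp add: edge)
      show ?thesis
      proof (cases x; cases y)
        fix u v assume uv: "x = Inl u" "y = Inl v"
        hence "{u, v} \<subseteq> U" "card {u, v} \<le> m" "m \<le> card U"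
          using xy m by (auto simp: V_def U_def card_insert_if)
        then obtain S where "{u, v} \<subseteq> S" "S \<subseteq> U" "card S = m"
          using exists_subset_between[of "{u, v}" m U] fin by blast
        thus ?thesis using uv by (intro exI[of _ "Inr S"]) (simp add: edge P_def)
      next
        fix u S assume "x = Inl u" "y = Inr S"
        thus ?thesis using LRc[of u S] xy by (auto simp: V_def edge)
      next
        fix S u assume "x = Inr S" "y = Inl u"
        thus ?thesis using LRc[of u S] xy by (auto simp: V_def edge)
      next
        fix S T assume ST: "x = Inr S" "y = Inr T"
        hence P: "S \<in> P" "T \<in> P" "T \<noteq> U - S" using xy by (auto simp: V_def edge)
        have "S \<inter> T \<noteq> {}"
        proof
          assume "S \<inter> T = {}"
          hence "T \<subseteq> U - S" using compl(4)[OF P(2)] by blast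
          moreover have "card T = card (U - S)" using compl(5) compl(1)[OF P(1)] P(2) by metis
          ultimately show False using P(3) card_subset_eq[of "U - S" T] fin by simp
        qed
        then obtain u where "u \<in> S" "u \<in> T" by blast
        thus ?thesis using ST P by (intro exI[of _ "Inl u"]) (simp add: edge)
      qed
    qed
    show "m + 1 \<le> card {u. {v, u} \<in> E}" if "v \<in> V" for v
      using that nbL nbR by (auto simp: V_def U_def)
  qed simp
qed

text \<open>For \<open>m = s - 1\<close> the half-subset graph has deficiency at least
  \<open>c / 2\<close>, and \<open>c \<ge> 4^m / (2 * sqrt s)\<close> leads to the constant 16. The
  maximum with 1 later pays for the constant part of \<open>r^2\<close>.\<close>

lemma triangle_free_saturated_large_deficiency:
  fixes s :: nat
  assumes s: "s \<ge> 1"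
  shows "\<exists>(V :: nat set) E v. clique_saturated V E 0 s \<and> v \<in> V \<and> card {u. {v, u} \<in> E} = s \<and>
    s + 1 \<le> card V \<and> max 1 (4 ^ s / (16 * sqrt (real s))) \<le> real s * real (card V) - real (card E)"
proof (cases "s \<le> 2")
  case True
  define V where "V = {..<2 * s}"
  define E where "E = (\<lambda>(i, j). {i, j}) ` ({..<s} \<times> {s..<2 * s})"
  have sat: "clique_saturated V E 0 s" "card {u. {0, u} \<in> E} = s" "card E = s * s"
    using complete_bipartite_saturated[of s] s by (simp_all add: V_def E_def)
  have "s = 1 \<or> s = 2" using s True by auto
  hence "(4 :: real) ^ s \<le> 16" by auto
  moreover have sq: "1 \<le> sqrt (real s)" using s by simp
  ultimately have "(4 :: real) ^ s \<le> 16 * sqrt (real s)" by linarith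
  hence "max 1 (4 ^ s / (16 * sqrt (real s))) \<le> 1" using sq by (simp add: divide_le_eq)
  also have "1 \<le> real (s * s)" using mult_mono[of 1 "real s" 1 "real s"] s by simp
  finally have "max 1 (4 ^ s / (16 * sqrt (real s))) \<le> real (s * s)" .
  hence "max 1 (4 ^ s / (16 * sqrt (real s))) \<le> real s * real (card V) - real (card E)"
    using sat(3) by (simp add: V_def)
  moreover have "0 \<in> V" "s + 1 \<le> card V" using s by (auto simp: V_def)
  ultimately show ?thesis using sat by blast
next
  case False
  define m where "m = s - 1"
  have m: "m \<ge> 2" "s = m + 1" using False by (auto simp: m_def)
  define P where "P = {S. S \<subseteq> {..<2 * m} \<and> card S = m}"
  define V where "V = (Inl ` {..<2 * m} \<union> Inr ` P :: (nat + nat set) set)"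
  define E where "E = {{Inl u, Inr S} | u S. S \<in> P \<and> u \<in> S} \<union> {{Inr S, Inr ({..<2 * m} - S)} | S. S \<in> P}"
  define v :: "nat + nat set" where "v = Inr {..<m}"
  define c where "c = real ((2 * m) choose m)"
  have sat: "clique_saturated V E 0 s" "v \<in> V" "card {u. {v, u} \<in> E} = s"
    "card V = 2 * m + ((2 * m) choose m)" "2 * card E \<le> (2 * m + 1) * ((2 * m) choose m)"
    unfolding V_def E_def P_def v_def m(2) by (rule half_subsets_saturated[OF m(1)])+
  have "finite V" using sat(1) by (simp add: clique_saturated_def)
  from finite_imp_inj_to_nat_seg[OF this] obtain h :: "nat + nat set \<Rightarrow> nat" and n
    where "h ` V = {i. i < n}" and h: "inj_on h V" by (elim exE conjE)
  note image = clique_saturated_image[OF sat(1) h]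
  have c: "2 * real m + 2 \<le> c" unfolding c_def using central_binomial_ge_linear[OF m(1)] by linarith
  have "real (2 * card E) \<le> real ((2 * m + 1) * ((2 * m) choose m))" using sat(5) by (rule of_nat_mono)
  hence E: "2 * real (card E) \<le> (2 * real m + 1) * c" by (simp add: c_def algebra_simps)
  have "c / 2 \<le> real s * (2 * real m + c) - (2 * real m + 1) * c / 2"
    by (simp add: m(2) field_simps)
  also have "\<dots> \<le> real s * real (card V) - real (card E)"
    using E by (simp add: sat(4) c_def)
  finally have D: "c / 2 \<le> real s * real (card V) - real (card E)" .
  have "(4 ^ m) ^ 2 \<le> (c * (2 * sqrt (real s))) ^ 2"
  proof -
    have "(4 ^ m) ^ 2 = (16 ^ m :: real)" by (simp add: power2_eq_square power_mult_distrib[symmetric])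
    also have "\<dots> \<le> c ^ 2 * (4 * real m)" unfolding c_def using central_binomial_sq_lower[of m] m(1) by simp
    also have "\<dots> \<le> c ^ 2 * (4 * real s)" by (intro mult_left_mono) (auto simp: m(2))
    also have "\<dots> = (c * (2 * sqrt (real s))) ^ 2" by (simp add: power_mult_distrib)
    finally show ?thesis .
  qed
  hence "4 ^ m \<le> c * (2 * sqrt (real s))"
    by (rule power2_le_imp_le) (simp add: c_def)
  hence "4 ^ s / (16 * sqrt (real s)) \<le> c / 2"
    using s by (simp add: m(2) field_simps)
  hence "max 1 (4 ^ s / (16 * sqrt (real s))) \<le> real s * real (card V) - real (card E)"
    using D c by simp
  moreover have "s + 1 \<le> card V" using sat(4) m central_binomial_ge_linear[OF m(1)] by linarith
  ultimately show ?thesis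
    using image sat(2,3)
    by (intro exI[of _ "h ` V"] exI[of _ "image h ` E"] exI[of _ "h v"]) simp
qed

text \<open>The cone taken at stage \<open>i\<close> adds \<open>s + i + 1 \<ge> i + 2\<close> to
  the deficiency, and these terms for \<open>i < j\<close> sum to
  \<open>j * (j + 3) / 2\<close>.\<close>

lemma clique_saturated_large_deficiency:
  fixes s :: nat
  assumes s: "s \<ge> 1"
  shows "\<exists>(V :: nat set) E v. clique_saturated V E j (s + j) \<and> v \<in> V \<and> card {u. {v, u} \<in> E} = s + j \<and>
    s + j + 1 \<le> card V \<and> max 1 (4 ^ s / (16 * sqrt (real s))) + real j * (real j + 3) / 2
      \<le> real (s + j) * real (card V) - real (card E)"
proof (induction j)
  case 0
  show ?case using triangle_free_saturated_large_deficiency[OF s] by simp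
next
  case (Suc j)
  define D where "D = max 1 (4 ^ s / (16 * sqrt (real s)))"
  obtain V :: "nat set" and E v where VE: "clique_saturated V E j (s + j)" "v \<in> V"
    "card {u. {v, u} \<in> E} = s + j" "s + j + 1 \<le> card V"
    "D + real j * (real j + 3) / 2 \<le> real (s + j) * real (card V) - real (card E)"
    using Suc.IH unfolding D_def by (elim exE conjE)
  have "finite V" using VE(1) by (simp add: clique_saturated_def)
  then obtain w where w: "w \<notin> V" using ex_new_if_finite infinite_UNIV_nat by blast
  note cone = clique_saturated_cone[OF VE(1) w VE(4,2,3)]
  define V' where "V' = insert w V"
  define E' where "E' = E \<union> (\<lambda>u. {w, u}) ` V"
  have "D + real (Suc j) * (real (Suc j) + 3) / 2 = (D + real j * (real j + 3) / 2) + (real j + 2)"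
    by (simp add: field_simps)
  also have "\<dots> \<le> real (s + j) * real (card V) - real (card E) + (real (s + j) + 1)"
    using VE(5) s by simp
  also have "\<dots> = real (s + Suc j) * real (card V') - real (card E')"
    unfolding V'_def E'_def cone(3,4) by (simp add: algebra_simps)
  finally have "D + real (Suc j) * (real (Suc j) + 3) / 2 \<le> real (s + Suc j) * real (card V') - real (card E')" .
  moreover have "clique_saturated V' E' (Suc j) (s + Suc j)" "card {u. {v, u} \<in> E'} = s + Suc j"
    "card V' = card V + 1"
    using cone(1-3) by (simp_all add: V'_def E'_def)
  moreover have "v \<in> V'" using VE(2) by (simp add: V'_def)
  ultimately show ?case unfolding D_def using VE(4)
    by (intro exI[of _ V'] exI[of _ E'] exI[of _ v]) simp
qed

section \<open>Assembling the two bounds\<close>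

text \<open>Only the finitely many elements above a given member matter, so \<open>GREATEST\<close>
  is attained even if the set is unbounded below.\<close>

lemma Greatest_mem_int_set:
  fixes S :: "int set"
  assumes "S \<noteq> {}" "\<And>x. x \<in> S \<Longrightarrow> x \<le> b"
  shows "(GREATEST x. x \<in> S) \<in> S" and "x \<in> S \<Longrightarrow> x \<le> (GREATEST x. x \<in> S)"
proof -
  obtain x0 where x0: "x0 \<in> S" using assms(1) by blast
  define T where "T = {x \<in> S. x0 \<le> x}"
  have "T \<subseteq> {x0..b}" using assms(2) by (auto simp: T_def)
  hence fin: "finite T" using finite_subset by blast
  have "x0 \<in> T" using x0 by (simp add: T_def)
  hence "Max T \<in> T" using fin Max_in by blast
  hence mem: "Max T \<in> S" "x0 \<le> Max T" by (simp_all add: T_def)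
  have ge: "y \<le> Max T" if "y \<in> S" for y
    using that fin mem(2) by (cases "x0 \<le> y") (auto simp: T_def)
  have "(GREATEST x. x \<in> S) = Max T" using mem(1) ge by (rule Greatest_equality)
  thus "(GREATEST x. x \<in> S) \<in> S" "x \<in> S \<Longrightarrow> x \<le> (GREATEST x. x \<in> S)" using mem(1) ge by auto
qed

lemma cube_le_four_power: "real s ^ 3 \<le> 4 ^ s"
proof (cases "s \<le> 2")
  case True
  hence "s = 0 \<or> s = 1 \<or> s = 2" by auto
  thus ?thesis by auto
next
  case False
  hence "3 \<le> s" by simp
  thus ?thesis
  proof (induction s rule: dec_induct)
    case (step s)
    have s3: "3 \<le> real s" using step by simp
    hence "3 * real s \<le> real s ^ 2" by (simp add: power2_eq_square)
    moreover have "3 * real s ^ 2 \<le> real s ^ 3"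
      using mult_right_mono[OF s3, of "real s ^ 2"] by (simp add: power3_eq_cube power2_eq_square)
    moreover have "real (Suc s) ^ 3 = real s ^ 3 + 3 * real s ^ 2 + 3 * real s + 1"
      by (simp add: power3_eq_cube power2_eq_square algebra_simps)
    ultimately have "real (Suc s) ^ 3 \<le> 4 * real s ^ 3" using s3 by linarith
    also have "\<dots> \<le> 4 * 4 ^ s" using step by simp
    finally show ?case by simp
  qed simp
qed

theorem theorem1:
  shows "\<exists>C1 C2 :: real. C1 > 0 \<and> C2 > 0 \<and>
    (\<forall>r t :: nat. r \<ge> 3 \<and> t \<ge> r - 2 \<longrightarrow>
      C1 * (4 powi (int t - int r) / sqrt (real t - real r + 3) + (real r)\<^sup>2)
        \<le> real_of_int (sat_const r t) \<and>
      real_of_int (sat_const r t)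
        \<le> C2 * (4 powi (int t - int r) * min (real r) (sqrt (real t - real r + 3))
                  / sqrt (real t - real r + 3) + (real r)\<^sup>2))"
proof -
  define A :: real where "A = 4736 * 2 ^ 60"
  have A: "0 < A" by (simp add: A_def)
  \<comment> \<open>Here \<open>128 = 2 * 64\<close>: the estimate \<open>2 * Q * (1 + A)\<close> is
    compared with \<open>Q / 64\<close>, since \<open>4^(t - r) = 4^s / 64\<close>.\<close>
  define C2 where "C2 = 128 * (1 + A)"
  have main: "1 / 10 * (4 powi (int t - int r) / sqrt (real t - real r + 3) + (real r)\<^sup>2)
        \<le> real_of_int (sat_const r t) \<and>
      real_of_int (sat_const r t)
        \<le> C2 * (4 powi (int t - int r) * min (real r) (sqrt (real t - real r + 3))
                  / sqrt (real t - real r + 3) + (real r)\<^sup>2)"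
    if rt: "r \<ge> 3" "t \<ge> r - 2" for r t
  proof -
    define k where "k = r - 3"
    define s where "s = t - k"
    have r: "r = k + 3" and t: "t = s + k" and s: "s \<ge> 1" using rt by (auto simp: k_def s_def)
    have kt: "k < t" using s t by simp
    have sr: "real t - real r + 3 = real s" by (simp add: r t)
    have "int t - int r = int s - 3" by (simp add: r t)
    hence pw: "4 powi (int t - int r) = (4 ^ s / 64 :: real)" by (simp add: power_int_diff)
    have sq: "1 \<le> sqrt (real s)" using s by simp
    define Q where "Q = 4 ^ s * min (real r) (sqrt (real s)) / sqrt (real s)"
    define B where "B = min (2 * 4 ^ s) (2 * (real k + 1) * real ((2 * s) choose s))"
    have upper: "real_of_int x \<le> (real t)\<^sup>2 + A * B" if x: "x \<in> deficits r t" for x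
    proof -
      obtain G :: "nat graph" where G: "x = int t * int (card (fst G)) - int (card (snd G))"
        "simple_graph G" "fst G \<noteq> {}" "saturated (complete_graph (k + 3)) G" "min_degree G = t"
        using x unfolding deficits_def r by blast
      interpret clique_saturated "fst G" "snd G" k t
        using clique_saturated_of_saturated(1)[OF G(2-5) kt] .
      obtain v where v: "v \<in> fst G" "card {u. {v, u} \<in> snd G} = t"
        using clique_saturated_of_saturated(2)[OF G(2-5) kt] by blast
      have "real t * real (card (fst G)) - real (card (snd G)) \<le> (real t)\<^sup>2 + A * B"
        using deficiency_le[of v] v unfolding A_def B_def M_def nb_def by (simp add: t)
      thus ?thesis using G(1) by simp
    qed
    obtain V :: "nat set" and E v where VE: "clique_saturated V E k (s + k)" "v \<in> V"
      "card {u. {v, u} \<in> E} = s + k" "s + k + 1 \<le> card V"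
      "max 1 (4 ^ s / (16 * sqrt (real s))) + real k * (real k + 3) / 2
        \<le> real (s + k) * real (card V) - real (card E)"
      using clique_saturated_large_deficiency[OF s, of k] by (elim exE conjE)
    define d where "d = int t * int (card V) - int (card E)"
    have d: "d \<in> deficits r t" using deficit_mem_deficits[OF VE(1-3)] by (simp add: d_def r t)
    have bdd: "x \<le> \<lfloor>(real t)\<^sup>2 + A * B\<rfloor>" if "x \<in> deficits r t" for x
      using upper[OF that] unfolding le_floor_iff .
    have ne: "deficits r t \<noteq> {}" using d by blast
    have sc_mem: "sat_const r t \<in> deficits r t"
      unfolding sat_const_def by (rule Greatest_mem_int_set(1)[OF ne bdd])
    have sc_ge: "d \<le> sat_const r t"
      unfolding sat_const_def by (rule Greatest_mem_int_set(2)[OF ne bdd d])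
    have c_sqrt: "real ((2 * s) choose s) * sqrt (real s) \<le> 4 ^ s"
    proof -
      have "(real ((2 * s) choose s) * sqrt (real s)) ^ 2 = real ((2 * s) choose s) ^ 2 * real s"
        by (simp add: power_mult_distrib)
      also have "\<dots> \<le> real ((2 * s) choose s) ^ 2 * (2 * real s + 1)" by (intro mult_left_mono) auto
      also have "\<dots> \<le> 16 ^ s" by (rule central_binomial_sq_upper)
      also have "\<dots> = (4 ^ s) ^ 2" by (simp add: power2_eq_square power_mult_distrib[symmetric])
      finally show ?thesis by (rule power2_le_imp_le) simp
    qed
    \<comment> \<open>The random permutation supplies the bound when \<open>r \<le> sqrt s\<close>
      and the random subset otherwise; this is the origin of the minimum in the theorem.\<close>
    have BQ: "B \<le> 2 * Q"
    proof (cases "real r \<le> sqrt (real s)")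
      case True
      have "B * sqrt (real s) \<le> 2 * (real k + 1) * real ((2 * s) choose s) * sqrt (real s)"
        by (intro mult_right_mono) (auto simp: B_def)
      also have "\<dots> \<le> 2 * (real k + 1) * 4 ^ s"
        using mult_left_mono[OF c_sqrt, of "2 * (real k + 1)"] by (simp add: mult_ac)
      also have "\<dots> \<le> 2 * real r * 4 ^ s" by (simp add: r)
      finally show ?thesis using True sq by (simp add: Q_def field_simps)
    next
      case False
      hence "2 * Q = 2 * 4 ^ s" using sq by (simp add: Q_def)
      thus ?thesis by (simp add: B_def)
    qed
    have sQ: "(real s)\<^sup>2 \<le> Q"
    proof -
      have "(real s)\<^sup>2 * sqrt (real s) \<le> (real s)\<^sup>2 * real s"
        using s by (intro mult_left_mono) (auto simp: real_le_lsqrt power2_eq_square)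
      also have "\<dots> \<le> 4 ^ s" using cube_le_four_power[of s] by (simp add: power2_eq_square power3_eq_cube)
      also have "\<dots> \<le> 4 ^ s * min (real r) (sqrt (real s))" using sq by (simp add: r)
      finally show ?thesis using sq by (simp add: Q_def field_simps)
    qed
    have "1 / 10 * (4 ^ s / 64 / sqrt (real s) + (real r)\<^sup>2) \<le> real_of_int d"
    proof -
      define X where "X = 4 ^ s / (16 * sqrt (real s))"
      have X: "4 ^ s / 64 / sqrt (real s) = X / 4" by (simp add: X_def)
      define Z where "Z = real k * (real k + 3) / 2"
      have "0 \<le> X" "0 \<le> Z" by (simp_all add: X_def Z_def)
      \<comment> \<open>At \<open>k = 0\<close> the term \<open>Z\<close> vanishes while
        \<open>r^2 = 9\<close>, so the maximum with 1 has to pay; this works because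
        \<open>X / 40 + 9/10 \<le> max 1 X\<close>.\<close>
      moreover have "(real r)\<^sup>2 \<le> 9 * (1 + Z)"
        by (simp add: Z_def r power2_eq_square algebra_simps)
      ultimately have "1 / 10 * (4 ^ s / 64 / sqrt (real s) + (real r)\<^sup>2) \<le> max 1 X + Z"
        unfolding X by (simp add: max_def)
      thus ?thesis using VE(5) by (simp add: X_def Z_def d_def t)
    qed
    also have "real_of_int d \<le> real_of_int (sat_const r t)" using sc_ge by simp
    finally have lower: "1 / 10 * (4 ^ s / 64 / sqrt (real s) + (real r)\<^sup>2) \<le> real_of_int (sat_const r t)" .
    have "real_of_int (sat_const r t) \<le> (real t)\<^sup>2 + A * B" by (rule upper[OF sc_mem])
    also have "\<dots> \<le> (2 * (real r)\<^sup>2 + 2 * Q) + A * (2 * Q)"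
    proof (rule add_mono)
      \<comment> \<open>As \<open>t = s + k\<close>, the cost \<open>t^2\<close> of \<open>X\<close>
        splits into \<open>k^2\<close>, covered by \<open>r^2\<close>, and \<open>s^2\<close>,
        covered by \<open>Q\<close>.\<close>
      have "0 \<le> (real s - real k)\<^sup>2" by simp
      hence "(real t)\<^sup>2 \<le> 2 * (real k)\<^sup>2 + 2 * (real s)\<^sup>2"
        by (simp add: t power2_eq_square algebra_simps)
      also have "(real k)\<^sup>2 \<le> (real r)\<^sup>2" by (simp add: r power_mono)
      finally show "(real t)\<^sup>2 \<le> 2 * (real r)\<^sup>2 + 2 * Q" using sQ by simp
      show "A * B \<le> A * (2 * Q)" using BQ A by simp
    qed
    also have "\<dots> \<le> C2 * (Q / 64 + (real r)\<^sup>2)"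
    proof -
      have "2 * (real r)\<^sup>2 \<le> C2 * (real r)\<^sup>2" using A by (intro mult_right_mono) (auto simp: C2_def)
      thus ?thesis by (simp add: C2_def algebra_simps)
    qed
    finally have "real_of_int (sat_const r t) \<le> C2 * (Q / 64 + (real r)\<^sup>2)" .
    moreover have "4 ^ s / 64 * min (real r) (sqrt (real s)) / sqrt (real s) = Q / 64" by (simp add: Q_def)
    ultimately show ?thesis using lower unfolding sr pw by presburger
  qed
  moreover have "0 < C2" using A by (simp add: C2_def)
  ultimately show ?thesis by (intro exI[of _ "1 / 10"] exI[of _ C2] conjI allI impI) simp_all
qed

end
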